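(* Let $S$ be a cancellative right LCM semigroup with identity $1_S$ such that $S$ satisfies (C1) and the quotient semigroup $\mathcal S=S/{\sim}$ embeds into a group $\Gamma$ in such a way that $\Gamma$ is generated by $\mathcal S$. Assume that the conditional expectation $\Phi_{\mathcal C_I}:C^*(S)\to\mathcal C_I$ is faithful, and that there is a faithful conditional expectation $\Phi_0$ from $\mathcal C_I$ onto $\mathcal D$ such that $\Phi_0(e_{qS}v_x)=\delta_{x,1_S}e_{qS}$ for all $q\in S$ and $x\in S^*$. Then a $*$-homomorphism $\pi:C^*(S)\to B$ (with $B$ a $C^*$-algebra) is injective if and only if $\pi|_{\mathcal C_I}$ is injective.
   Context: $S^*$ is the group of invertible elements of $S$; $pS=\{ps:s\in S\}$. $S$ is right LCM if it is left cancellative and for all $p,q\in S$ the set $pS\cap qS$ is either empty or equal to $rS$ for some $r\in S$. Cancellative means left and right cancellative. Condition (C1): $aS^*\subseteq S^*a$ for all $a\in S$. Write $a\sim b$ if $a=xb$ for some $x\in S^*$; under (C1) this is a congruence, and $\mathcal S=S/{\sim}$ is the quotient semigroup, with identity $[1_S]$. For a right ideal $X$ and $p\in S$ put $pX=\{px: x\in X\}$ and $p^{-1}X=\{y\in S: py\in X\}$. $\mathcal J(S)$ is the smallest family of right ideals (including the empty set) containing $\emptyset$ and $S$ and closed under $X\mapsto pX$ and $X\mapsto p^{-1}X$ for all $p\in S$. $C^*(S)$ is the universal unital $C^*$-algebra generated by isometries $(v_p)_{p\in S}$ and projections $(e_X)_{X\in\mathcal J(S)}$ satisfying, for all $p,q\in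 S$ and $X,Y\in\mathcal J(S)$: $v_pv_q=v_{pq}$; $v_pe_Xv_p^*=e_{pX}$; $e_\emptyset=0$ and $e_S=1$; $e_Xe_Y=e_{X\cap Y}$. $\mathcal D=C^*(\{e_X: X\in\mathcal J(S)\})$ and $\mathcal C_I=C^*(\{e_{pS},v_x: p\in S,\,x\in S^*\})$ are subalgebras of $C^*(S)$. Under the stated hypotheses on $S$, $\mathcal S$ and $\Gamma$ there is a well-defined conditional expectation $\Phi_{\mathcal C_I}:C^*(S)\to\mathcal C_I$ determined by $\Phi_{\mathcal C_I}(v_pv_q^* )=v_xe_{qS}$ if $p=xq$ for some $x\in S^*$, and $\Phi_{\mathcal C_I}(v_pv_q^* )=0$ if $p\not\sim q$. Faithful means faithful on positive elements. *)

theory Defs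
  imports "HOL-Analysis.Analysis" "HOL-Algebra.Generated_Groups" "HOL-Library.Poly_Mapping"
begin

section \<open>C*-algebras\<close>

text \<open>The class \<^class>\<open>real_normed_algebra\<close> does not provide a unit, so neither does the
  following class. The real scalar multiplication that it inherits is tied to the complex one.\<close>

class cstar_algebra = real_normed_algebra + banach +
  fixes scaleC :: "complex \<Rightarrow> 'a \<Rightarrow> 'a" (infixr \<open>*\<^sub>C\<close> 75)
    and star :: "'a \<Rightarrow> 'a"
  assumes scaleR_scaleC: "r *\<^sub>R x = complex_of_real r *\<^sub>C x"
    and scaleC_add_right: "c *\<^sub>C (x + y) = c *\<^sub>C x + c *\<^sub>C y"
    and scaleC_add_left: "(c + d) *\<^sub>C x = c *\<^sub>C x + d *\<^sub>C x"
    and scaleC_scaleC: "c *\<^sub>C d *\<^sub>C x = (c * d) *\<^sub>C x"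
    and mult_scaleC_left: "(c *\<^sub>C x) * y = c *\<^sub>C (x * y)"
    and mult_scaleC_right: "x * (c *\<^sub>C y) = c *\<^sub>C (x * y)"
    and norm_scaleC: "norm (c *\<^sub>C x) = cmod c * norm x"
    and star_star: "star (star x) = x"
    and star_add: "star (x + y) = star x + star y"
    and star_scaleC: "star (c *\<^sub>C x) = cnj c *\<^sub>C star x"
    and star_mult: "star (x * y) = star y * star x"
    and cstar_identity: "norm (star x * x) = (norm x)\<^sup>2"

text \<open>The zero algebra is allowed, hence \<^class>\<open>monoid_mult\<close> and not \<^class>\<open>ring_1\<close>.\<close>

class unital_cstar_algebra = cstar_algebra + monoid_mult

definition star_hom :: "('a::cstar_algebra \<Rightarrow> 'b::cstar_algebra) \<Rightarrow> bool" where
  "star_hom f \<longleftrightarrow>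
     (\<forall>x y. f (x + y) = f x + f y) \<and> (\<forall>c x. f (c *\<^sub>C x) = c *\<^sub>C f x) \<and>
     (\<forall>x y. f (x * y) = f x * f y) \<and> (\<forall>x. f (star x) = star (f x))"

definition cstar_subalgebra :: "'a::cstar_algebra set \<Rightarrow> bool" where
  "cstar_subalgebra A \<longleftrightarrow> closed A \<and> 0 \<in> A \<and>
     (\<forall>x\<in>A. \<forall>y\<in>A. x + y \<in> A) \<and> (\<forall>c. \<forall>x\<in>A. c *\<^sub>C x \<in> A) \<and>
     (\<forall>x\<in>A. \<forall>y\<in>A. x * y \<in> A) \<and> (\<forall>x\<in>A. star x \<in> A)"

definition cstar_generated :: "'a::cstar_algebra set \<Rightarrow> 'a set" where
  "cstar_generated G = cstar_subalgebra hull G"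

definition positive_elements :: "'a::cstar_algebra set \<Rightarrow> 'a set" where
  "positive_elements A = {star x * x |x. x \<in> A}"

text \<open>Conditional expectations from the C*-algebra \<open>A\<close> onto its C*-subalgebra \<open>C\<close>: positive
  contractive projections that are \<open>C\<close>-bimodule maps. Complete positivity is not listed, as it
  follows from positivity and the bimodule property. Only the values of \<open>E\<close> on \<open>A\<close> matter.\<close>

definition conditional_expectation ::
  "'a::cstar_algebra set \<Rightarrow> 'a set \<Rightarrow> ('a \<Rightarrow> 'a) \<Rightarrow> bool" where
  "conditional_expectation A C E \<longleftrightarrow>
     (\<forall>a\<in>A. E a \<in> C) \<and> (\<forall>c\<in>C. E c = c) \<and>
     (\<forall>a\<in>A. \<forall>b\<in>A. E (a + b) = E a + E b) \<and> (\<forall>z. \<forall>a\<in>A. E (z *\<^sub>C a) = z *\<^sub>C E a) \<and>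
     (\<forall>a\<in>positive_elements A. E a \<in> positive_elements C) \<and>
     (\<forall>a\<in>A. norm (E a) \<le> norm a) \<and>
     (\<forall>a\<in>A. \<forall>c\<in>C. E (c * a) = c * E a \<and> E (a * c) = E a * c)"

definition faithful_on :: "'a::cstar_algebra set \<Rightarrow> ('a \<Rightarrow> 'a) \<Rightarrow> bool" where
  "faithful_on A E \<longleftrightarrow> (\<forall>a\<in>positive_elements A. E a = 0 \<longrightarrow> a = 0)"


section \<open>Semigroups with identity\<close>

text \<open>A semigroup with identity is a type of class \<^class>\<open>monoid_mult\<close>; the principal right ideal
  \<open>pS\<close> is \<open>range ((*) p)\<close>.\<close>

definition left_cancellative :: "'s::monoid_mult itself \<Rightarrow> bool" where
  "left_cancellative _ \<longleftrightarrow> (\<forall>p q r::'s. p * q = p * r \<longrightarrow> q = r)"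

definition right_cancellative :: "'s::monoid_mult itself \<Rightarrow> bool" where
  "right_cancellative _ \<longleftrightarrow> (\<forall>p q r::'s. q * p = r * p \<longrightarrow> q = r)"

definition cancellative :: "'s::monoid_mult itself \<Rightarrow> bool" where
  "cancellative S \<longleftrightarrow> left_cancellative S \<and> right_cancellative S"

definition right_LCM :: "'s::monoid_mult itself \<Rightarrow> bool" where
  "right_LCM S \<longleftrightarrow> left_cancellative S \<and>
     (\<forall>p q::'s. range ((*) p) \<inter> range ((*) q) = {} \<or>
        (\<exists>r. range ((*) p) \<inter> range ((*) q) = range ((*) r)))"

definition unit_group :: "'s::monoid_mult set" where
  "unit_group = {x. \<exists>y. x * y = 1 \<and> y * x = 1}"

definition condition_C1 :: "'s::monoid_mult itself \<Rightarrow> bool" where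
  "condition_C1 _ \<longleftrightarrow> (\<forall>a::'s. (*) a ` unit_group \<subseteq> (\<lambda>x. x * a) ` unit_group)"

definition unit_equiv :: "('s::monoid_mult \<times> 's) set" where
  "unit_equiv = {(a, b). \<exists>x\<in>unit_group. a = x * b}"

text \<open>The union of all classes of products of representatives is a single class as soon as
  \<^const>\<open>unit_equiv\<close> is a congruence, in particular under \<^const>\<open>condition_C1\<close>.\<close>

definition unit_quotient :: "'s::monoid_mult set monoid" where
  "unit_quotient = \<lparr>carrier = UNIV // unit_equiv,
     mult = (\<lambda>A B. \<Union>a\<in>A. \<Union>b\<in>B. unit_equiv `` {a * b}),
     one = unit_equiv `` {1}\<rparr>"

text \<open>All members of this family are right ideals, because the rules preserve right ideals.\<close>

inductive_set constructible_ideals :: "'s::monoid_mult set set" where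
  empty: "{} \<in> constructible_ideals"
| univ: "UNIV \<in> constructible_ideals"
| mult: "X \<in> constructible_ideals \<Longrightarrow> (*) p ` X \<in> constructible_ideals"
| preimage: "X \<in> constructible_ideals \<Longrightarrow> (*) p -` X \<in> constructible_ideals"


section \<open>The semigroup C*-algebra\<close>

subsection \<open>The free unital *-algebra on the generators\<close>

text \<open>It is the algebra of the monoid of words in the generators and their formal adjoints; the
  Boolean flag of a letter marks the adjoint. There is one generator for every set \<open>X\<close>, but those
  for \<open>X\<close> outside of \<^const>\<open>constructible_ideals\<close> are set to zero further below.\<close>

datatype 's generator = Isom 's | Proj "'s set"

datatype 's word = Word (letters: "('s generator \<times> bool) list")

instantiation word :: (type) monoid_add
begin
definition "0 = Word []"
definition "v + w = Word (letters v @ letters w)"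
instance by standard (simp_all add: zero_word_def plus_word_def)
end

type_synonym 's free_algebra = "'s word \<Rightarrow>\<^sub>0 complex"

definition word_star :: "'s word \<Rightarrow> 's word" where
  "word_star w = Word (rev (List.map (\<lambda>(g, b). (g, \<not> b)) (letters w)))"

lemma word_star_word_star [simp]: "word_star (word_star w) = w"
  by (simp add: word_star_def rev_map comp_def case_prod_unfold)

lemma word_star_plus: "word_star (v + w) = word_star w + word_star v"
  by (simp add: word_star_def plus_word_def)

lemma word_star_zero [simp]: "word_star 0 = 0"
  by (simp add: word_star_def zero_word_def)

lemma inj_word_star: "inj word_star"
  by (metis injI word_star_word_star)

lift_definition free_star :: "'s free_algebra \<Rightarrow> 's free_algebra" is
  "\<lambda>f w. cnj (f (word_star w))"
proof -
  fix f :: "'s word \<Rightarrow> complex"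
  assume "finite {w. f w \<noteq> 0}"
  then have "finite (word_star -` {w. f w \<noteq> 0})"
    by (rule finite_vimageI) (rule inj_word_star)
  then show "finite {w. cnj (f (word_star w)) \<noteq> 0}"
    by (simp add: vimage_def)
qed

definition free_scale :: "complex \<Rightarrow> 's free_algebra \<Rightarrow> 's free_algebra" where
  "free_scale c x = Poly_Mapping.single 0 c * x"

definition free_gen :: "'s generator \<Rightarrow> 's free_algebra" where
  "free_gen g = Poly_Mapping.single (Word [(g, False)]) 1"

lemma free_induct [case_names zero single add]:
  fixes x :: "'s free_algebra"
  assumes "P 0" and "\<And>w c. P (Poly_Mapping.single w c)"
    and "\<And>x y. P x \<Longrightarrow> P y \<Longrightarrow> P (x + y)"
  shows "P x"
proof (induction x rule: update_induct)
  case const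
  show ?case by fact
next
  case (update f a b)
  have "Poly_Mapping.update a b f = f + Poly_Mapping.single a b"
    using update(1)
    by (intro poly_mapping_eqI)
      (auto simp: lookup_update lookup_add lookup_single when_def in_keys_iff)
  then show ?case using assms update by simp
qed

lemma free_star_add: "free_star (x + y) = free_star x + free_star y"
  by (intro poly_mapping_eqI) (simp add: free_star.rep_eq lookup_add)

lemma free_star_diff: "free_star (x - y) = free_star x - free_star y"
  by (intro poly_mapping_eqI) (simp add: free_star.rep_eq lookup_minus)

lemma free_star_zero [simp]: "free_star 0 = 0"
  by (intro poly_mapping_eqI) (simp add: free_star.rep_eq)

lemma free_star_single:
  "free_star (Poly_Mapping.single w c) = Poly_Mapping.single (word_star w) (cnj c)"
proof (intro poly_mapping_eqI)
  fix k :: "'a word"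
  have "(w = word_star k) = (word_star w = k)" by (metis word_star_word_star)
  then show "Poly_Mapping.lookup (free_star (Poly_Mapping.single w c)) k =
      Poly_Mapping.lookup (Poly_Mapping.single (word_star w) (cnj c)) k"
    by (simp add: free_star.rep_eq lookup_single when_def)
qed

lemma free_star_star [simp]: "free_star (free_star x) = x"
  by (intro poly_mapping_eqI) (simp add: free_star.rep_eq)

lemma free_star_mult: "free_star (x * y) = free_star y * free_star x"
proof (induction x rule: free_induct)
  case (single w c)
  show ?case
    by (induction y rule: free_induct)
      (simp_all add: mult_single free_star_single word_star_plus mult.commute
        distrib_left distrib_right free_star_add)
qed (simp_all add: distrib_left distrib_right free_star_add)

lemma free_star_one [simp]: "free_star (1::'s free_algebra) = 1"
  by (metis free_star_single single_one word_star_zero complex_cnj_one)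

lemma free_scale_add_right: "free_scale c (x + y) = free_scale c x + free_scale c y"
  by (simp add: free_scale_def distrib_left)

lemma free_scale_add_left: "free_scale (c + d) x = free_scale c x + free_scale d x"
  by (simp add: free_scale_def single_add distrib_right)

lemma free_scale_diff_right: "free_scale c (x - y) = free_scale c x - free_scale c y"
  by (simp add: free_scale_def right_diff_distrib)

lemma free_scale_scale: "free_scale c (free_scale d x) = free_scale (c * d) x"
  by (simp add: free_scale_def mult.assoc [symmetric] mult_single)

lemma free_scale_one [simp]: "free_scale 1 x = x"
  by (simp add: free_scale_def)

lemma free_scale_zero [simp]: "free_scale 0 x = 0"
  by (simp add: free_scale_def)

lemma free_scale_mult_left: "free_scale c x * y = free_scale c (x * y)"
  by (simp add: free_scale_def mult.assoc)

lemma free_scale_mult_right: "x * free_scale c y = free_scale c (x * y)"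
proof -
  have "x * Poly_Mapping.single 0 c = Poly_Mapping.single 0 c * x"
    by (induction x rule: free_induct)
      (simp_all add: mult_single mult.commute distrib_left distrib_right)
  then show ?thesis by (simp add: free_scale_def mult.assoc [symmetric])
qed

lemma free_scale_single: "free_scale c (Poly_Mapping.single w d) = Poly_Mapping.single w (c * d)"
  by (simp add: free_scale_def mult_single)

lemma free_scale_minus_one: "free_scale (- 1) x = - x"
  by (simp add: free_scale_def single_uminus)

lemma free_star_scale: "free_star (free_scale c x) = free_scale (cnj c) (free_star x)"
proof -
  have "free_star (free_scale c x) = free_star x * Poly_Mapping.single 0 (cnj c)"
    by (simp add: free_scale_def free_star_mult free_star_single)
  also have "\<dots> = free_star x * free_scale (cnj c) 1"
    by (simp add: free_scale_def)
  finally show ?thesis by (simp add: free_scale_mult_right)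
qed


subsection \<open>The largest C*-seminorm that respects the relations\<close>

inductive sg_relation :: "'s::monoid_mult free_algebra \<Rightarrow> 's free_algebra \<Rightarrow> bool" where
  isometry: "sg_relation (free_star (free_gen (Isom p)) * free_gen (Isom p)) 1"
| proj_star: "sg_relation (free_star (free_gen (Proj X))) (free_gen (Proj X))"
| proj_idem: "sg_relation (free_gen (Proj X) * free_gen (Proj X)) (free_gen (Proj X))"
| mult: "sg_relation (free_gen (Isom p) * free_gen (Isom q)) (free_gen (Isom (p * q)))"
| conj: "X \<in> constructible_ideals \<Longrightarrow>
    sg_relation (free_gen (Isom p) * free_gen (Proj X) * free_star (free_gen (Isom p)))
      (free_gen (Proj ((*) p ` X)))"
| empty: "sg_relation (free_gen (Proj {})) 0"
| univ: "sg_relation (free_gen (Proj UNIV)) 1"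
| inter: "X \<in> constructible_ideals \<Longrightarrow> Y \<in> constructible_ideals \<Longrightarrow>
    sg_relation (free_gen (Proj X) * free_gen (Proj Y)) (free_gen (Proj (X \<inter> Y)))"
| outside: "X \<notin> constructible_ideals \<Longrightarrow> sg_relation (free_gen (Proj X)) 0"

definition cstar_seminorm :: "('s free_algebra \<Rightarrow> real) \<Rightarrow> bool" where
  "cstar_seminorm p \<longleftrightarrow>
     (\<forall>x y. p (x + y) \<le> p x + p y) \<and> (\<forall>c x. p (free_scale c x) = cmod c * p x) \<and>
     (\<forall>x y. p (x * y) \<le> p x * p y) \<and> (\<forall>x. p (free_star x * x) = (p x)\<^sup>2)"

definition sg_seminorms :: "('s::monoid_mult free_algebra \<Rightarrow> real) set" where
  "sg_seminorms = {p. cstar_seminorm p \<and> (\<forall>x y. sg_relation x y \<longrightarrow> p (x - y) = 0)}"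

definition sg_norm :: "'s::monoid_mult free_algebra \<Rightarrow> real" where
  "sg_norm x = (SUP p\<in>sg_seminorms. p x)"

context
  fixes p :: "'s free_algebra \<Rightarrow> real"
  assumes p: "cstar_seminorm p"
begin

lemma csn_add: "p (x + y) \<le> p x + p y"
  and csn_scale: "p (free_scale c x) = cmod c * p x"
  and csn_mult: "p (x * y) \<le> p x * p y"
  and csn_cstar: "p (free_star x * x) = (p x)\<^sup>2"
  using p by (auto simp: cstar_seminorm_def)

lemma csn_zero: "p 0 = 0"
  using csn_scale[of 0 0] by simp

lemma csn_minus: "p (- x) = p x"
  using csn_scale[of "-1" x] by (simp add: free_scale_minus_one)

lemma csn_nonneg: "0 \<le> p x"
  using csn_add[of x "- x"] by (simp add: csn_zero csn_minus)

lemma csn_minus_commute: "p (x - y) = p (y - x)"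
  using csn_minus[of "x - y"] by simp

lemma csn_abs_diff: "\<bar>p x - p y\<bar> \<le> p (x - y)"
  using csn_add[of "x - y" y] csn_add[of "y - x" x] csn_minus_commute[of x y]
  by (simp add: abs_le_iff)

lemma csn_star: "p (free_star x) = p x"
proof -
  have le: "p y \<le> p (free_star y)" for y
  proof (cases "p y = 0")
    case True
    then show ?thesis using csn_nonneg[of "free_star y"] by simp
  next
    case False
    then have "0 < p y" using csn_nonneg[of y] by linarith
    moreover have "p y * p y \<le> p (free_star y) * p y"
      using csn_cstar[of y] csn_mult[of "free_star y" y] by (simp add: power2_eq_square)
    ultimately show ?thesis by simp
  qed
  show ?thesis using le[of x] le[of "free_star x"] by simp
qed

end

lemma sg_seminormsD:
  assumes "p \<in> sg_seminorms"
  shows "cstar_seminorm p" "sg_relation x y \<Longrightarrow> p (x - y) = 0"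
  using assms by (auto simp: sg_seminorms_def)

lemma sg_seminorm_relation:
  assumes "p \<in> sg_seminorms" "sg_relation x y"
  shows "p x = p y"
  using csn_abs_diff[OF sg_seminormsD(1)[OF assms(1)], of x y] sg_seminormsD(2)[OF assms] by simp

lemma sg_seminorm_gen_le_1:
  assumes "p \<in> sg_seminorms"
  shows "p (free_gen g) \<le> 1"
proof -
  note c = sg_seminormsD(1)[OF assms]
  have idem: "t \<le> 1" if "t\<^sup>2 = t" for t :: real
    using that by (auto simp: power2_eq_square)
  show ?thesis
  proof (cases g)
    case (Isom q)
    have "p (1::'a free_algebra) \<le> 1"
      by (rule idem) (use csn_cstar[OF c, of 1] in \<open>simp only: free_star_one mult_1_left\<close>)
    moreover have "(p (free_gen g))\<^sup>2 = p 1"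
      using sg_seminorm_relation[OF assms sg_relation.isometry[of q]] csn_cstar[OF c, of "free_gen g"]
      by (simp only: Isom)
    ultimately have "(p (free_gen g))\<^sup>2 \<le> 1\<^sup>2" by simp
    then show ?thesis by (rule power2_le_imp_le) simp
  next
    case (Proj X)
    let ?e = "free_gen (Proj X)"
    have "p (free_star ?e * ?e - ?e) \<le> p (free_star ?e * ?e - ?e * ?e) + p (?e * ?e - ?e)"
      using csn_add[OF c, of "free_star ?e * ?e - ?e * ?e" "?e * ?e - ?e"] by simp
    moreover have "p (free_star ?e * ?e - ?e * ?e) \<le> p (free_star ?e - ?e) * p ?e"
      using csn_mult[OF c, of "free_star ?e - ?e" ?e] by (simp add: left_diff_distrib)
    ultimately have "p (free_star ?e * ?e - ?e) \<le> 0"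
      using sg_seminormsD(2)[OF assms sg_relation.proj_star[of X]]
        sg_seminormsD(2)[OF assms sg_relation.proj_idem[of X]] by simp
    then have "p (free_star ?e * ?e) = p ?e"
      using csn_abs_diff[OF c, of "free_star ?e * ?e" ?e] by linarith
    then have "p ?e \<le> 1" using csn_cstar[OF c, of ?e] idem by (simp only:)
    then show ?thesis by (simp only: Proj)
  qed
qed

lemma single_Word_Cons:
  "Poly_Mapping.single (Word ((g, b) # l)) (c::complex) =
     (if b then free_star (free_gen g) else free_gen g) * Poly_Mapping.single (Word l) c"
  by (simp add: free_gen_def mult_single free_star_single plus_word_def word_star_def)

lemma sg_seminorm_single_le:
  assumes "p \<in> sg_seminorms"
  shows "p (Poly_Mapping.single w c) \<le> cmod c"
proof (cases w)
  case (Word l)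
  note s = sg_seminormsD(1)[OF assms]
  have "p (Poly_Mapping.single (Word l) c) \<le> cmod c"
  proof (induction l)
    case Nil
    have "(p (1::'a free_algebra))\<^sup>2 = p 1"
      using csn_cstar[OF s, of 1] by (simp only: free_star_one mult_1_left)
    then have "p (1::'a free_algebra) \<le> 1" by (auto simp: power2_eq_square)
    moreover have "Poly_Mapping.single (Word []) c = free_scale c (1::'a free_algebra)"
      by (simp add: free_scale_def zero_word_def)
    ultimately show ?case by (simp add: csn_scale[OF s] mult_left_le)
  next
    case (Cons a l)
    obtain g b where a: "a = (g, b)" by force
    let ?g = "if b then free_star (free_gen g) else free_gen g"
    have "p (Poly_Mapping.single (Word (a # l)) c) \<le> p ?g * p (Poly_Mapping.single (Word l) c)"
      unfolding a single_Word_Cons by (rule csn_mult[OF s])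
    also have "p ?g \<le> 1" using sg_seminorm_gen_le_1[OF assms, of g] by (simp add: csn_star[OF s])
    then have "p ?g * p (Poly_Mapping.single (Word l) c) \<le> 1 * cmod c"
      using Cons by (intro mult_mono) (simp_all add: csn_nonneg[OF s])
    finally show ?case by simp
  qed
  then show ?thesis by (simp add: Word)
qed

lemma sg_seminorms_bounded: "\<exists>B. \<forall>p\<in>sg_seminorms. p x \<le> B"
proof (induction x rule: free_induct)
  case zero
  show ?case
  proof (intro exI ballI)
    fix p :: "'a free_algebra \<Rightarrow> real" assume p: "p \<in> sg_seminorms"
    show "p 0 \<le> 0" using csn_zero[OF sg_seminormsD(1)[OF p]] by simp
  qed
next
  case (single w c)
  show ?case
  proof (intro exI ballI)
    fix p :: "'a free_algebra \<Rightarrow> real" assume p: "p \<in> sg_seminorms"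
    show "p (Poly_Mapping.single w c) \<le> cmod c" by (rule sg_seminorm_single_le[OF p])
  qed
next
  case (add x y)
  from add.IH(1) obtain B where B: "\<forall>p\<in>sg_seminorms. p x \<le> B" by (rule exE)
  from add.IH(2) obtain C where C: "\<forall>p\<in>sg_seminorms. p y \<le> C" by (rule exE)
  show ?case
  proof (intro exI ballI)
    fix p :: "'a free_algebra \<Rightarrow> real" assume p: "p \<in> sg_seminorms"
    show "p (x + y) \<le> B + C"
      using csn_add[OF sg_seminormsD(1)[OF p], of x y] bspec[OF B p] bspec[OF C p] by linarith
  qed
qed

lemma bdd_above_sg: "bdd_above ((\<lambda>p. p x) ` sg_seminorms)"
proof -
  obtain B where B: "\<forall>p\<in>sg_seminorms. p x \<le> B" using sg_seminorms_bounded[of x] by (rule exE)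
  show ?thesis by (rule bdd_aboveI2[of _ _ B]) (rule bspec[OF B])
qed

lemma zero_in_sg_seminorms: "(\<lambda>_. 0) \<in> sg_seminorms"
  by (simp add: sg_seminorms_def cstar_seminorm_def)

lemma sg_norm_upper: "p \<in> sg_seminorms \<Longrightarrow> p x \<le> sg_norm x"
  unfolding sg_norm_def by (rule cSUP_upper[OF _ bdd_above_sg])

lemma sg_norm_least: "(\<And>p. p \<in> sg_seminorms \<Longrightarrow> p x \<le> B) \<Longrightarrow> sg_norm x \<le> B"
  unfolding sg_norm_def by (rule cSUP_least) (use zero_in_sg_seminorms in auto)

lemma sg_norm_nonneg: "0 \<le> sg_norm x"
  using sg_norm_upper[OF zero_in_sg_seminorms] .

lemma cstar_seminorm_sg_norm: "cstar_seminorm (sg_norm :: 's::monoid_mult free_algebra \<Rightarrow> real)"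
  unfolding cstar_seminorm_def
proof (intro conjI allI)
  fix x y :: "'s free_algebra" and c :: complex
  show "sg_norm (x + y) \<le> sg_norm x + sg_norm y"
  proof (rule sg_norm_least)
    fix p :: "'s free_algebra \<Rightarrow> real" assume p: "p \<in> sg_seminorms"
    show "p (x + y) \<le> sg_norm x + sg_norm y"
      using csn_add[OF sg_seminormsD(1)[OF p], of x y] sg_norm_upper[OF p, of x]
        sg_norm_upper[OF p, of y] by linarith
  qed
  have le: "sg_norm (free_scale c x) \<le> cmod c * sg_norm x" for c and x :: "'s free_algebra"
  proof (rule sg_norm_least)
    fix p :: "'s free_algebra \<Rightarrow> real" assume p: "p \<in> sg_seminorms"
    show "p (free_scale c x) \<le> cmod c * sg_norm x"
      unfolding csn_scale[OF sg_seminormsD(1)[OF p]]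
      by (intro mult_left_mono sg_norm_upper p norm_ge_zero)
  qed
  show "sg_norm (free_scale c x) = cmod c * sg_norm x"
  proof (cases "c = 0")
    case True
    have "sg_norm (0::'s free_algebra) \<le> 0"
    proof (rule sg_norm_least)
      fix p :: "'s free_algebra \<Rightarrow> real" assume p: "p \<in> sg_seminorms"
      show "p 0 \<le> 0" using csn_zero[OF sg_seminormsD(1)[OF p]] by simp
    qed
    then show ?thesis using True sg_norm_nonneg[of "0::'s free_algebra"] by simp
  next
    case False
    have "cmod c * sg_norm x = cmod c * sg_norm (free_scale (inverse c) (free_scale c x))"
      using False by (simp add: free_scale_scale)
    also have "\<dots> \<le> cmod c * (cmod (inverse c) * sg_norm (free_scale c x))"
      by (intro mult_left_mono le) simp
    also have "\<dots> = sg_norm (free_scale c x)"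
      using False by (simp add: norm_inverse)
    finally show ?thesis using le[of c x] by simp
  qed
  show "sg_norm (x * y) \<le> sg_norm x * sg_norm y"
  proof (rule sg_norm_least)
    fix p :: "'s free_algebra \<Rightarrow> real" assume p: "p \<in> sg_seminorms"
    note c = sg_seminormsD(1)[OF p]
    have "p (x * y) \<le> p x * p y" by (rule csn_mult[OF c])
    also have "\<dots> \<le> sg_norm x * sg_norm y"
      by (intro mult_mono sg_norm_upper p sg_norm_nonneg csn_nonneg[OF c])
    finally show "p (x * y) \<le> sg_norm x * sg_norm y" .
  qed
  show "sg_norm (free_star x * x) = (sg_norm x)\<^sup>2"
  proof (rule antisym)
    show "sg_norm (free_star x * x) \<le> (sg_norm x)\<^sup>2"
    proof (rule sg_norm_least)
      fix p :: "'s free_algebra \<Rightarrow> real" assume p: "p \<in> sg_seminorms"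
      show "p (free_star x * x) \<le> (sg_norm x)\<^sup>2"
        unfolding csn_cstar[OF sg_seminormsD(1)[OF p]]
        by (intro power_mono sg_norm_upper p csn_nonneg[OF sg_seminormsD(1)[OF p]])
    qed
    have "sg_norm x \<le> sqrt (sg_norm (free_star x * x))"
    proof (rule sg_norm_least)
      fix p :: "'s free_algebra \<Rightarrow> real" assume p: "p \<in> sg_seminorms"
      have "(p x)\<^sup>2 \<le> sg_norm (free_star x * x)"
        using sg_norm_upper[OF p, of "free_star x * x"] csn_cstar[OF sg_seminormsD(1)[OF p], of x]
        by simp
      then show "p x \<le> sqrt (sg_norm (free_star x * x))" by (rule real_le_rsqrt)
    qed
    then show "(sg_norm x)\<^sup>2 \<le> sg_norm (free_star x * x)"
      using sg_norm_nonneg[of x] sg_norm_nonneg[of "free_star x * x"]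
      by (metis power_mono real_sqrt_pow2)
  qed
qed

lemma sg_norm_relation:
  assumes "sg_relation x y" shows "sg_norm (x - y) = 0"
proof (rule antisym[OF _ sg_norm_nonneg], rule sg_norm_least)
  fix p :: "'a free_algebra \<Rightarrow> real" assume "p \<in> sg_seminorms"
  then show "p (x - y) \<le> 0" using sg_seminormsD(2)[OF _ assms, of p] by simp
qed

lemmas sgnorm_add = csn_add[OF cstar_seminorm_sg_norm]
  and sgnorm_scale = csn_scale[OF cstar_seminorm_sg_norm]
  and sgnorm_mult = csn_mult[OF cstar_seminorm_sg_norm]
  and sgnorm_cstar = csn_cstar[OF cstar_seminorm_sg_norm]
  and sgnorm_zero [simp] = csn_zero[OF cstar_seminorm_sg_norm]
  and sgnorm_minus [simp] = csn_minus[OF cstar_seminorm_sg_norm]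
  and sgnorm_minus_commute = csn_minus_commute[OF cstar_seminorm_sg_norm]
  and sgnorm_abs_diff = csn_abs_diff[OF cstar_seminorm_sg_norm]
  and sgnorm_star [simp] = csn_star[OF cstar_seminorm_sg_norm]


subsection \<open>Completion\<close>

definition sg_cauchy :: "(nat \<Rightarrow> 's::monoid_mult free_algebra) \<Rightarrow> bool" where
  "sg_cauchy X \<longleftrightarrow> (\<forall>\<epsilon>>0. \<exists>M. \<forall>m\<ge>M. \<forall>n\<ge>M. sg_norm (X m - X n) < \<epsilon>)"

definition sg_equiv ::
  "(nat \<Rightarrow> 's::monoid_mult free_algebra) \<Rightarrow> (nat \<Rightarrow> 's free_algebra) \<Rightarrow> bool" where
  "sg_equiv X Y \<longleftrightarrow> sg_cauchy X \<and> sg_cauchy Y \<and> (\<lambda>n. sg_norm (X n - Y n)) \<longlonglongrightarrow> 0"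

lemma sg_cauchyI_bound:
  assumes "sg_cauchy X" and "sg_cauchy Y" and "0 \<le> A" and "0 \<le> B"
    and "\<And>m n. sg_norm (Z m - Z n) \<le> A * sg_norm (X m - X n) + B * sg_norm (Y m - Y n)"
  shows "sg_cauchy Z"
  unfolding sg_cauchy_def
proof (intro allI impI)
  fix \<epsilon> :: real assume "0 < \<epsilon>"
  define \<delta> where "\<delta> = \<epsilon> / (A + B + 1)"
  have d: "0 < \<delta>" using \<open>0 < \<epsilon>\<close> assms(3,4) by (simp add: \<delta>_def)
  obtain M where M: "\<And>m n. m \<ge> M \<Longrightarrow> n \<ge> M \<Longrightarrow> sg_norm (X m - X n) < \<delta>"
    using assms(1) d unfolding sg_cauchy_def by blast
  obtain N where N: "\<And>m n. m \<ge> N \<Longrightarrow> n \<ge> N \<Longrightarrow> sg_norm (Y m - Y n) < \<delta>"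
    using assms(2) d unfolding sg_cauchy_def by blast
  have "sg_norm (Z m - Z n) < \<epsilon>" if "m \<ge> max M N" "n \<ge> max M N" for m n
  proof -
    have "sg_norm (Z m - Z n) \<le> A * \<delta> + B * \<delta>"
      using assms(5)[of m n] M[of m n] N[of m n] that assms(3,4)
      by (intro order_trans[OF assms(5)] add_mono mult_left_mono) auto
    also have "\<dots> < (A + B + 1) * \<delta>" using d by (simp add: algebra_simps)
    also have "\<dots> = \<epsilon>" using assms(3,4) by (simp add: \<delta>_def)
    finally show ?thesis .
  qed
  then show "\<exists>M. \<forall>m\<ge>M. \<forall>n\<ge>M. sg_norm (Z m - Z n) < \<epsilon>" by blast
qed

lemma sg_cauchy_const [simp]: "sg_cauchy (\<lambda>_. x)"
  by (simp add: sg_cauchy_def)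

lemma sg_cauchy_add: "sg_cauchy X \<Longrightarrow> sg_cauchy Y \<Longrightarrow> sg_cauchy (\<lambda>n. X n + Y n)"
  by (rule sg_cauchyI_bound[of X Y 1 1]) (simp_all add: add_diff_add sgnorm_add)

lemma sg_cauchy_scale: "sg_cauchy X \<Longrightarrow> sg_cauchy (\<lambda>n. free_scale c (X n))"
  by (rule sg_cauchyI_bound[of X X "cmod c" 0])
    (simp_all add: free_scale_diff_right [symmetric] sgnorm_scale)

lemma sg_cauchy_uminus: "sg_cauchy X \<Longrightarrow> sg_cauchy (\<lambda>n. - X n)"
  using sg_cauchy_scale[of X "-1"] by (simp add: free_scale_minus_one)

lemma sg_cauchy_diff: "sg_cauchy X \<Longrightarrow> sg_cauchy Y \<Longrightarrow> sg_cauchy (\<lambda>n. X n - Y n)"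
  using sg_cauchy_add[OF _ sg_cauchy_uminus, of X Y] by simp

lemma sg_cauchy_star: "sg_cauchy X \<Longrightarrow> sg_cauchy (\<lambda>n. free_star (X n))"
  by (rule sg_cauchyI_bound[of X X 1 0]) (simp_all add: free_star_diff [symmetric])

lemma sg_cauchy_norm: "sg_cauchy X \<Longrightarrow> convergent (\<lambda>n. sg_norm (X n))"
proof (rule Cauchy_convergent, rule metric_CauchyI)
  fix \<epsilon> :: real assume "sg_cauchy X" "0 < \<epsilon>"
  then obtain M where M: "\<forall>m\<ge>M. \<forall>n\<ge>M. sg_norm (X m - X n) < \<epsilon>"
    unfolding sg_cauchy_def by blast
  have "dist (sg_norm (X m)) (sg_norm (X n)) < \<epsilon>" if "m \<ge> M" "n \<ge> M" for m n
    using M that sgnorm_abs_diff[of "X m" "X n"] le_less_trans unfolding dist_real_def by blast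
  then show "\<exists>M. \<forall>m\<ge>M. \<forall>n\<ge>M. dist (sg_norm (X m)) (sg_norm (X n)) < \<epsilon>" by blast
qed

lemma sg_cauchy_bounded:
  assumes "sg_cauchy X" shows "\<exists>B\<ge>0. \<forall>n. sg_norm (X n) \<le> B"
proof -
  have "Bseq (\<lambda>n. sg_norm (X n))"
    using sg_cauchy_norm[OF assms] by (rule convergent_imp_Bseq)
  then obtain B where "B > 0" "\<And>n. norm (sg_norm (X n)) \<le> B" by (auto simp: Bseq_def)
  then show ?thesis by (intro exI[of _ B]) (auto simp: sg_norm_nonneg)
qed

lemma sgnorm_mult_diff:
  "sg_norm (a * b - c * d) \<le> sg_norm a * sg_norm (b - d) + sg_norm (a - c) * sg_norm d"
proof -
  have "a * b - c * d = a * (b - d) + (a - c) * d" by (simp add: algebra_simps)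
  then have "sg_norm (a * b - c * d) \<le> sg_norm (a * (b - d)) + sg_norm ((a - c) * d)"
    by (simp only: sgnorm_add)
  also have "\<dots> \<le> sg_norm a * sg_norm (b - d) + sg_norm (a - c) * sg_norm d"
    by (intro add_mono sgnorm_mult)
  finally show ?thesis .
qed

lemma sg_cauchy_mult:
  assumes "sg_cauchy X" "sg_cauchy Y" shows "sg_cauchy (\<lambda>n. X n * Y n)"
proof -
  obtain A where A: "A \<ge> 0" "\<And>n. sg_norm (X n) \<le> A" using sg_cauchy_bounded[OF assms(1)] by blast
  obtain B where B: "B \<ge> 0" "\<And>n. sg_norm (Y n) \<le> B" using sg_cauchy_bounded[OF assms(2)] by blast
  have "sg_norm (X m * Y m - X n * Y n) \<le> B * sg_norm (X m - X n) + A * sg_norm (Y m - Y n)" for m n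
  proof -
    have "sg_norm (X m * Y m - X n * Y n) \<le>
        sg_norm (X m) * sg_norm (Y m - Y n) + sg_norm (X m - X n) * sg_norm (Y n)"
      by (rule sgnorm_mult_diff)
    also have "\<dots> \<le> A * sg_norm (Y m - Y n) + sg_norm (X m - X n) * B"
      by (intro add_mono mult_mono A B order_refl sg_norm_nonneg)
    finally show ?thesis by (simp add: mult.commute)
  qed
  then show ?thesis by (rule sg_cauchyI_bound[OF assms B(1) A(1)])
qed

lemma sg_equiv_refl: "sg_cauchy X \<Longrightarrow> sg_equiv X X"
  by (simp add: sg_equiv_def)

lemma part_equivp_sg_equiv:
  "part_equivp (sg_equiv :: (nat \<Rightarrow> 's::monoid_mult free_algebra) \<Rightarrow> _)" (is "part_equivp ?R")
proof (rule part_equivpI)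
  show "\<exists>X. ?R X X" using sg_equiv_refl[OF sg_cauchy_const] by blast
  show "symp ?R" by (auto intro!: sympI simp: sg_equiv_def sgnorm_minus_commute)
  show "transp ?R"
  proof (rule transpI)
    fix X Y Z :: "nat \<Rightarrow> 's free_algebra"
    assume a: "sg_equiv X Y" "sg_equiv Y Z"
    have "(\<lambda>n. sg_norm (X n - Y n) + sg_norm (Y n - Z n)) \<longlonglongrightarrow> 0"
      using a tendsto_add[of "\<lambda>n. sg_norm (X n - Y n)" 0 _ "\<lambda>n. sg_norm (Y n - Z n)" 0]
      by (simp add: sg_equiv_def)
    moreover have "sg_norm (X n - Z n) \<le> sg_norm (X n - Y n) + sg_norm (Y n - Z n)" for n
      using sgnorm_add[of "X n - Y n" "Y n - Z n"] by simp
    ultimately have "(\<lambda>n. sg_norm (X n - Z n)) \<longlonglongrightarrow> 0"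
      by (intro Lim_null_comparison[of "\<lambda>n. sg_norm (X n - Z n)"]) (simp_all add: sg_norm_nonneg)
    then show "sg_equiv X Z" using a by (simp add: sg_equiv_def)
  qed
qed

quotient_type (overloaded) 's semigroup_cstar = "nat \<Rightarrow> 's::monoid_mult free_algebra" / partial: sg_equiv
  by (rule part_equivp_sg_equiv)


lemma sg_equivD: "sg_equiv X Y \<Longrightarrow> sg_cauchy X" "sg_equiv X Y \<Longrightarrow> sg_cauchy Y"
  by (simp_all add: sg_equiv_def)

lemma sg_equiv_self: "sg_equiv X X \<Longrightarrow> sg_cauchy X"
  by (rule sg_equivD)

lemmas sg_cauchy_intros = sg_cauchy_add sg_cauchy_diff sg_cauchy_uminus sg_cauchy_scale sg_cauchy_mult
  sg_cauchy_star sg_equiv_self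

lemma sg_equiv_pointwise: "sg_cauchy X \<Longrightarrow> (\<And>n. X n = Y n) \<Longrightarrow> sg_equiv X Y"
proof -
  assume "sg_cauchy X" "\<And>n. X n = Y n"
  then have "X = Y" by blast
  then show ?thesis using \<open>sg_cauchy X\<close> sg_equiv_refl by blast
qed

lemma sg_equivI_bound:
  assumes "sg_equiv X X'" and "sg_equiv Y Y'" and "sg_cauchy Z" and "sg_cauchy Z'"
    and "\<And>n. sg_norm (Z n - Z' n) \<le> A * sg_norm (X n - X' n) + B * sg_norm (Y n - Y' n)"
  shows "sg_equiv Z Z'"
proof -
  have "(\<lambda>n. A * sg_norm (X n - X' n) + B * sg_norm (Y n - Y' n)) \<longlonglongrightarrow> A * 0 + B * 0"
    using assms(1,2) unfolding sg_equiv_def by (intro tendsto_intros) simp_all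
  then have "(\<lambda>n. sg_norm (Z n - Z' n)) \<longlonglongrightarrow> 0"
    using assms(5) by (intro Lim_null_comparison[of "\<lambda>n. sg_norm (Z n - Z' n)"])
      (simp_all add: sg_norm_nonneg)
  then show ?thesis using assms(3,4) by (simp add: sg_equiv_def)
qed

lemma sg_equiv_add:
  "sg_equiv X X' \<Longrightarrow> sg_equiv Y Y' \<Longrightarrow> sg_equiv (\<lambda>n. X n + Y n) (\<lambda>n. X' n + Y' n)"
  by (rule sg_equivI_bound[of X X' Y Y' _ _ 1 1])
    (simp_all add: sg_cauchy_add sg_equivD add_diff_add sgnorm_add)

lemma sg_equiv_scale: "sg_equiv X X' \<Longrightarrow> sg_equiv (\<lambda>n. free_scale c (X n)) (\<lambda>n. free_scale c (X' n))"
  by (rule sg_equivI_bound[of X X' X X' _ _ "cmod c" 0])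
    (simp_all add: sg_cauchy_scale sg_equivD free_scale_diff_right [symmetric] sgnorm_scale)

lemma sg_equiv_uminus: "sg_equiv X X' \<Longrightarrow> sg_equiv (\<lambda>n. - X n) (\<lambda>n. - X' n)"
  using sg_equiv_scale[of X X' "-1"] by (simp add: free_scale_minus_one)

lemma sg_equiv_diff:
  "sg_equiv X X' \<Longrightarrow> sg_equiv Y Y' \<Longrightarrow> sg_equiv (\<lambda>n. X n - Y n) (\<lambda>n. X' n - Y' n)"
  using sg_equiv_add[OF _ sg_equiv_uminus, of X X' Y Y'] by simp

lemma sg_equiv_star: "sg_equiv X X' \<Longrightarrow> sg_equiv (\<lambda>n. free_star (X n)) (\<lambda>n. free_star (X' n))"
  by (rule sg_equivI_bound[of X X' X X' _ _ 1 0])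
    (simp_all add: sg_cauchy_star sg_equivD free_star_diff [symmetric])

lemma sg_equiv_mult:
  assumes "sg_equiv X X'" "sg_equiv Y Y'" shows "sg_equiv (\<lambda>n. X n * Y n) (\<lambda>n. X' n * Y' n)"
proof -
  obtain A where A: "A \<ge> 0" "\<And>n. sg_norm (X n) \<le> A"
    using sg_cauchy_bounded sg_equivD(1)[OF assms(1)] by blast
  obtain B where B: "B \<ge> 0" "\<And>n. sg_norm (Y' n) \<le> B"
    using sg_cauchy_bounded sg_equivD(2)[OF assms(2)] by blast
  have le: "sg_norm (X n * Y n - X' n * Y' n) \<le> B * sg_norm (X n - X' n) + A * sg_norm (Y n - Y' n)" for n
  proof -
    have "sg_norm (X n * Y n - X' n * Y' n) \<le>
        sg_norm (X n) * sg_norm (Y n - Y' n) + sg_norm (X n - X' n) * sg_norm (Y' n)"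
      by (rule sgnorm_mult_diff)
    also have "\<dots> \<le> A * sg_norm (Y n - Y' n) + sg_norm (X n - X' n) * B"
      by (intro add_mono mult_mono A B order_refl sg_norm_nonneg)
    finally show ?thesis by (simp add: mult.commute)
  qed
  show ?thesis
    by (rule sg_equivI_bound[OF assms sg_cauchy_mult[OF sg_equivD(1) sg_equivD(1)]
          sg_cauchy_mult[OF sg_equivD(2) sg_equivD(2)] le, OF assms assms])
qed

lemma sg_norm_LIMSEQ: "sg_cauchy X \<Longrightarrow> (\<lambda>n. sg_norm (X n)) \<longlonglongrightarrow> lim (\<lambda>n. sg_norm (X n))"
  using sg_cauchy_norm convergent_LIMSEQ_iff by blast

lemma sg_lim_norm_cong:
  assumes "sg_equiv X Y" shows "lim (\<lambda>n. sg_norm (X n)) = lim (\<lambda>n. sg_norm (Y n))"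
proof -
  have "(\<lambda>n. sg_norm (X n) - sg_norm (Y n)) \<longlonglongrightarrow> 0"
    using assms unfolding sg_equiv_def
    by (intro Lim_null_comparison[of "\<lambda>n. sg_norm (X n) - sg_norm (Y n)"
          "\<lambda>n. sg_norm (X n - Y n)"])
      (simp_all add: sgnorm_abs_diff)
  moreover have "(\<lambda>n. sg_norm (X n) - sg_norm (Y n)) \<longlonglongrightarrow>
      lim (\<lambda>n. sg_norm (X n)) - lim (\<lambda>n. sg_norm (Y n))"
    by (intro tendsto_diff sg_norm_LIMSEQ sg_equivD[OF assms])
  ultimately show ?thesis using LIMSEQ_unique by fastforce
qed

instantiation semigroup_cstar :: (monoid_mult) "{ring, monoid_mult}"
begin

lift_definition zero_semigroup_cstar :: "'a semigroup_cstar" is "\<lambda>_. 0"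
  by (simp add: sg_equiv_refl)

lift_definition one_semigroup_cstar :: "'a semigroup_cstar" is "\<lambda>_. 1"
  by (simp add: sg_equiv_refl)

lift_definition plus_semigroup_cstar :: "'a semigroup_cstar \<Rightarrow> 'a semigroup_cstar \<Rightarrow> 'a semigroup_cstar"
  is "\<lambda>X Y n. X n + Y n" by (rule sg_equiv_add)

lift_definition uminus_semigroup_cstar :: "'a semigroup_cstar \<Rightarrow> 'a semigroup_cstar"
  is "\<lambda>X n. - X n" by (rule sg_equiv_uminus)

lift_definition minus_semigroup_cstar :: "'a semigroup_cstar \<Rightarrow> 'a semigroup_cstar \<Rightarrow> 'a semigroup_cstar"
  is "\<lambda>X Y n. X n - Y n" by (rule sg_equiv_diff)

lift_definition times_semigroup_cstar :: "'a semigroup_cstar \<Rightarrow> 'a semigroup_cstar \<Rightarrow> 'a semigroup_cstar"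
  is "\<lambda>X Y n. X n * Y n" by (rule sg_equiv_mult)

instance
proof
  fix a b c :: "'a semigroup_cstar"
  show "a + b + c = a + (b + c)"
    by transfer (rule sg_equiv_pointwise, simp_all add: sg_cauchy_intros add.assoc)
  show "a + b = b + a"
    by transfer (rule sg_equiv_pointwise, simp_all add: sg_cauchy_intros add.commute)
  show "0 + a = a"
    by transfer (rule sg_equiv_pointwise, simp_all add: sg_cauchy_intros)
  show "- a + a = 0"
    by transfer (rule sg_equiv_pointwise, simp_all add: sg_cauchy_intros)
  show "a - b = a + - b"
    by transfer (rule sg_equiv_pointwise, simp_all add: sg_cauchy_intros)
  show "a * b * c = a * (b * c)"
    by transfer (rule sg_equiv_pointwise, simp_all add: sg_cauchy_intros mult.assoc)
  show "(a + b) * c = a * c + b * c"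
    by transfer (rule sg_equiv_pointwise, simp_all add: sg_cauchy_intros distrib_right)
  show "a * (b + c) = a * b + a * c"
    by transfer (rule sg_equiv_pointwise, simp_all add: sg_cauchy_intros distrib_left)
  show "1 * a = a"
    by transfer (rule sg_equiv_pointwise, simp_all add: sg_cauchy_intros)
  show "a * 1 = a"
    by transfer (rule sg_equiv_pointwise, simp_all add: sg_cauchy_intros)
qed

end

instantiation semigroup_cstar :: (monoid_mult) real_algebra
begin

lift_definition scaleR_semigroup_cstar :: "real \<Rightarrow> 'a semigroup_cstar \<Rightarrow> 'a semigroup_cstar"
  is "\<lambda>r X n. free_scale (complex_of_real r) (X n)" by (rule sg_equiv_scale)

instance
proof
  fix a b :: real and x y :: "'a semigroup_cstar"
  show "a *\<^sub>R (x + y) = a *\<^sub>R x + a *\<^sub>R y"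
    by transfer (rule sg_equiv_pointwise, simp_all add: sg_cauchy_intros free_scale_add_right)
  show "(a + b) *\<^sub>R x = a *\<^sub>R x + b *\<^sub>R x"
    by transfer (rule sg_equiv_pointwise, simp_all add: sg_cauchy_intros free_scale_add_left)
  show "a *\<^sub>R b *\<^sub>R x = (a * b) *\<^sub>R x"
    by transfer (rule sg_equiv_pointwise, simp_all add: sg_cauchy_intros free_scale_scale)
  show "1 *\<^sub>R x = x"
    by transfer (rule sg_equiv_pointwise, simp_all add: sg_cauchy_intros)
  show "a *\<^sub>R x * y = a *\<^sub>R (x * y)"
    by transfer (rule sg_equiv_pointwise, simp_all add: sg_cauchy_intros free_scale_mult_left)
  show "x * a *\<^sub>R y = a *\<^sub>R (x * y)"
    by transfer (rule sg_equiv_pointwise, simp_all add: sg_cauchy_intros free_scale_mult_right)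
qed

end

instantiation semigroup_cstar :: (monoid_mult) real_normed_algebra
begin

lift_definition norm_semigroup_cstar :: "'a semigroup_cstar \<Rightarrow> real"
  is "\<lambda>X. lim (\<lambda>n. sg_norm (X n))" by (rule sg_lim_norm_cong)

definition dist_semigroup_cstar :: "'a semigroup_cstar \<Rightarrow> 'a semigroup_cstar \<Rightarrow> real" where
  "dist_semigroup_cstar x y = norm (x - y)"

definition sgn_semigroup_cstar :: "'a semigroup_cstar \<Rightarrow> 'a semigroup_cstar" where
  "sgn_semigroup_cstar x = x /\<^sub>R norm x"

definition uniformity_semigroup_cstar :: "('a semigroup_cstar \<times> 'a semigroup_cstar) filter" where
  "uniformity_semigroup_cstar = (INF e\<in>{0 <..}. principal {(x, y). dist x y < e})"

definition open_semigroup_cstar :: "'a semigroup_cstar set \<Rightarrow> bool" where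
  "open_semigroup_cstar U \<longleftrightarrow> (\<forall>x\<in>U. \<forall>\<^sub>F (x', y) in uniformity. x' = x \<longrightarrow> y \<in> U)"

instance
proof
  fix a :: real and x y :: "'a semigroup_cstar" and U :: "'a semigroup_cstar set"
  show "dist x y = norm (x - y)" by (fact dist_semigroup_cstar_def)
  show "sgn x = x /\<^sub>R norm x" by (fact sgn_semigroup_cstar_def)
  show "uniformity = (INF e\<in>{0 <..}. principal {(x, y :: 'a semigroup_cstar). dist x y < e})"
    by (fact uniformity_semigroup_cstar_def)
  show "open U \<longleftrightarrow> (\<forall>x\<in>U. \<forall>\<^sub>F (x', y) in uniformity. x' = x \<longrightarrow> y \<in> U)"
    by (fact open_semigroup_cstar_def)
  show "norm x = 0 \<longleftrightarrow> x = 0"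
  proof transfer
    fix X :: "nat \<Rightarrow> 'a free_algebra" assume "sg_equiv X X"
    then have X: "sg_cauchy X" by (rule sg_equivD)
    show "lim (\<lambda>n. sg_norm (X n)) = 0 \<longleftrightarrow> sg_equiv X (\<lambda>_. 0)"
    proof
      assume "lim (\<lambda>n. sg_norm (X n)) = 0"
      then show "sg_equiv X (\<lambda>_. 0)" using sg_norm_LIMSEQ[OF X] X by (simp add: sg_equiv_def)
    next
      assume "sg_equiv X (\<lambda>_. 0)"
      then show "lim (\<lambda>n. sg_norm (X n)) = 0"
        using sg_lim_norm_cong[of X "\<lambda>_. 0"] by simp
    qed
  qed
  show "norm (x + y) \<le> norm x + norm y"
  proof transfer
    fix X Y :: "nat \<Rightarrow> 'a free_algebra" assume "sg_equiv X X" "sg_equiv Y Y"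
    then have XY: "sg_cauchy X" "sg_cauchy Y" by (auto dest: sg_equivD)
    show "lim (\<lambda>n. sg_norm (X n + Y n)) \<le> lim (\<lambda>n. sg_norm (X n)) + lim (\<lambda>n. sg_norm (Y n))"
      by (rule LIMSEQ_le[OF sg_norm_LIMSEQ[OF sg_cauchy_add[OF XY]]
            tendsto_add[OF sg_norm_LIMSEQ[OF XY(1)] sg_norm_LIMSEQ[OF XY(2)]]])
        (auto intro: sgnorm_add)
  qed
  show "norm (a *\<^sub>R x) = \<bar>a\<bar> * norm x"
  proof transfer
    fix a and X :: "nat \<Rightarrow> 'a free_algebra" assume "sg_equiv X X"
    then have X: "sg_cauchy X" by (rule sg_equivD)
    have "(\<lambda>n. sg_norm (free_scale (complex_of_real a) (X n))) \<longlonglongrightarrow> \<bar>a\<bar> * lim (\<lambda>n. sg_norm (X n))"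
      using tendsto_mult_left[OF sg_norm_LIMSEQ[OF X], of "\<bar>a\<bar>"] by (simp add: sgnorm_scale)
    then show "lim (\<lambda>n. sg_norm (free_scale (complex_of_real a) (X n))) = \<bar>a\<bar> * lim (\<lambda>n. sg_norm (X n))"
      by (rule limI)
  qed
  show "norm (x * y) \<le> norm x * norm y"
  proof transfer
    fix X Y :: "nat \<Rightarrow> 'a free_algebra" assume "sg_equiv X X" "sg_equiv Y Y"
    then have XY: "sg_cauchy X" "sg_cauchy Y" by (auto dest: sg_equivD)
    show "lim (\<lambda>n. sg_norm (X n * Y n)) \<le> lim (\<lambda>n. sg_norm (X n)) * lim (\<lambda>n. sg_norm (Y n))"
      by (rule LIMSEQ_le[OF sg_norm_LIMSEQ[OF sg_cauchy_mult[OF XY]]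
            tendsto_mult[OF sg_norm_LIMSEQ[OF XY(1)] sg_norm_LIMSEQ[OF XY(2)]]])
        (auto intro: sgnorm_mult)
  qed
qed

end

definition of_free :: "'s::monoid_mult free_algebra \<Rightarrow> 's semigroup_cstar" where
  "of_free x = abs_semigroup_cstar (\<lambda>_. x)"

lemma of_free_diff: "of_free (x - y) = of_free x - of_free y"
  by (simp add: of_free_def minus_semigroup_cstar.abs_eq sg_equiv_refl)

lemma norm_of_free: "norm (of_free x) = sg_norm x"
  by (simp add: of_free_def norm_semigroup_cstar.abs_eq sg_equiv_refl)

lemma of_free_LIMSEQ:
  assumes "sg_cauchy X" shows "(\<lambda>n. of_free (X n)) \<longlonglongrightarrow> abs_semigroup_cstar X"
proof (rule metric_LIMSEQ_I)
  fix \<epsilon> :: real assume "0 < \<epsilon>"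
  then obtain M where M: "\<forall>m\<ge>M. \<forall>n\<ge>M. sg_norm (X m - X n) < \<epsilon> / 2"
    using assms unfolding sg_cauchy_def by (meson half_gt_zero)
  have "dist (of_free (X n)) (abs_semigroup_cstar X) < \<epsilon>" if "n \<ge> M" for n
  proof -
    have c: "sg_cauchy (\<lambda>k. X n - X k)" using assms by (intro sg_cauchy_diff) simp_all
    have "of_free (X n) - abs_semigroup_cstar X = abs_semigroup_cstar (\<lambda>k. X n - X k)"
      using assms by (simp add: of_free_def minus_semigroup_cstar.abs_eq sg_equiv_refl)
    then have "dist (of_free (X n)) (abs_semigroup_cstar X) = lim (\<lambda>k. sg_norm (X n - X k))"
      using c by (simp add: dist_norm norm_semigroup_cstar.abs_eq sg_equiv_refl)
    also have "\<dots> \<le> \<epsilon> / 2"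
      by (rule LIMSEQ_le_const2[OF sg_norm_LIMSEQ[OF c]]) (use M that in \<open>auto intro: less_imp_le\<close>)
    finally show ?thesis using \<open>0 < \<epsilon>\<close> by simp
  qed
  then show "\<exists>M. \<forall>n\<ge>M. dist (of_free (X n)) (abs_semigroup_cstar X) < \<epsilon>" by blast
qed

lemma abs_rep_semigroup_cstar:
  "sg_cauchy (rep_semigroup_cstar x)" "abs_semigroup_cstar (rep_semigroup_cstar x) = x"
  using Quotient3_rep_reflp[OF Quotient3_semigroup_cstar, of x]
    Quotient3_abs_rep[OF Quotient3_semigroup_cstar, of x]
  by (auto dest: sg_equivD)

lemma rep_LIMSEQ: "(\<lambda>n. of_free (rep_semigroup_cstar x n)) \<longlonglongrightarrow> x"
  using of_free_LIMSEQ[OF abs_rep_semigroup_cstar(1)] by (simp add: abs_rep_semigroup_cstar(2))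

instance semigroup_cstar :: (monoid_mult) banach
proof
  fix A :: "nat \<Rightarrow> 'a semigroup_cstar"
  assume A: "Cauchy A"
  have "\<exists>x. dist (of_free x) (A n) < inverse (real (Suc n))" for n
    using metric_LIMSEQ_D[OF rep_LIMSEQ[of "A n"], of "inverse (real (Suc n))"] by auto
  then obtain X where X: "\<And>n. dist (of_free (X n)) (A n) < inverse (real (Suc n))" by metis
  have X0': "(\<lambda>n. dist (of_free (X n)) (A n)) \<longlonglongrightarrow> 0"
    by (rule Lim_null_comparison[OF _ LIMSEQ_inverse_real_of_nat])
      (use X in \<open>simp add: less_imp_le del: of_nat_Suc\<close>)
  from X0' have X0: "(\<lambda>n. of_free (X n) - A n) \<longlonglongrightarrow> 0"
    by (simp add: dist_norm tendsto_norm_zero_iff)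
  have "sg_cauchy X"
    unfolding sg_cauchy_def
  proof (intro allI impI)
    fix \<epsilon> :: real assume "0 < \<epsilon>"
    then have e: "0 < \<epsilon> / 3" by simp
    obtain M where M: "\<And>m n. m \<ge> M \<Longrightarrow> n \<ge> M \<Longrightarrow> dist (A m) (A n) < \<epsilon> / 3"
      using A e unfolding Cauchy_def by blast
    obtain N where N: "\<And>n. n \<ge> N \<Longrightarrow> dist (of_free (X n)) (A n) < \<epsilon> / 3"
      using metric_LIMSEQ_D[OF X0' e] by auto
    have "sg_norm (X m - X n) < \<epsilon>" if "m \<ge> max M N" "n \<ge> max M N" for m n
    proof -
      have "sg_norm (X m - X n) = dist (of_free (X m)) (of_free (X n))"
        by (simp add: dist_norm of_free_diff [symmetric] norm_of_free)
      also have "\<dots> \<le> dist (of_free (X m)) (A m) + dist (A m) (A n) + dist (of_free (X n)) (A n)"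
        by metric
      also have "\<dots> < \<epsilon>" using M[of m n] N[of m] N[of n] that by simp
      finally show ?thesis .
    qed
    then show "\<exists>M. \<forall>m\<ge>M. \<forall>n\<ge>M. sg_norm (X m - X n) < \<epsilon>" by blast
  qed
  then have "(\<lambda>n. of_free (X n)) \<longlonglongrightarrow> abs_semigroup_cstar X" by (rule of_free_LIMSEQ)
  from tendsto_diff[OF this X0] show "convergent A" by (auto simp: convergent_def)
qed

instantiation semigroup_cstar :: (monoid_mult) unital_cstar_algebra
begin

lift_definition scaleC_semigroup_cstar :: "complex \<Rightarrow> 'a semigroup_cstar \<Rightarrow> 'a semigroup_cstar"
  is "\<lambda>c X n. free_scale c (X n)" by (rule sg_equiv_scale)

lift_definition star_semigroup_cstar :: "'a semigroup_cstar \<Rightarrow> 'a semigroup_cstar"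
  is "\<lambda>X n. free_star (X n)" by (rule sg_equiv_star)

instance
proof
  fix r :: real and c d :: complex and x y :: "'a semigroup_cstar"
  show "r *\<^sub>R x = complex_of_real r *\<^sub>C x"
    by transfer (rule sg_equiv_pointwise, simp_all add: sg_cauchy_intros)
  show "c *\<^sub>C (x + y) = c *\<^sub>C x + c *\<^sub>C y"
    by transfer (rule sg_equiv_pointwise, simp_all add: sg_cauchy_intros free_scale_add_right)
  show "(c + d) *\<^sub>C x = c *\<^sub>C x + d *\<^sub>C x"
    by transfer (rule sg_equiv_pointwise, simp_all add: sg_cauchy_intros free_scale_add_left)
  show "c *\<^sub>C d *\<^sub>C x = (c * d) *\<^sub>C x"
    by transfer (rule sg_equiv_pointwise, simp_all add: sg_cauchy_intros free_scale_scale)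
  show "c *\<^sub>C x * y = c *\<^sub>C (x * y)"
    by transfer (rule sg_equiv_pointwise, simp_all add: sg_cauchy_intros free_scale_mult_left)
  show "x * c *\<^sub>C y = c *\<^sub>C (x * y)"
    by transfer (rule sg_equiv_pointwise, simp_all add: sg_cauchy_intros free_scale_mult_right)
  show "star (star x) = x"
    by transfer (rule sg_equiv_pointwise, simp_all add: sg_cauchy_intros)
  show "star (x + y) = star x + star y"
    by transfer (rule sg_equiv_pointwise, simp_all add: sg_cauchy_intros free_star_add)
  show "star (c *\<^sub>C x) = cnj c *\<^sub>C star x"
    by transfer (rule sg_equiv_pointwise, simp_all add: sg_cauchy_intros free_star_scale)
  show "star (x * y) = star y * star x"
    by transfer (rule sg_equiv_pointwise, simp_all add: sg_cauchy_intros free_star_mult)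
  show "norm (c *\<^sub>C x) = cmod c * norm x"
  proof transfer
    fix c and X :: "nat \<Rightarrow> 'a free_algebra" assume "sg_equiv X X"
    then have X: "sg_cauchy X" by (rule sg_equivD)
    have "(\<lambda>n. sg_norm (free_scale c (X n))) \<longlonglongrightarrow> cmod c * lim (\<lambda>n. sg_norm (X n))"
      using tendsto_mult_left[OF sg_norm_LIMSEQ[OF X], of "cmod c"] by (simp add: sgnorm_scale)
    then show "lim (\<lambda>n. sg_norm (free_scale c (X n))) = cmod c * lim (\<lambda>n. sg_norm (X n))"
      by (rule limI)
  qed
  show "norm (star x * x) = (norm x)\<^sup>2"
  proof transfer
    fix X :: "nat \<Rightarrow> 'a free_algebra" assume "sg_equiv X X"
    then have X: "sg_cauchy X" by (rule sg_equivD)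
    have "(\<lambda>n. sg_norm (free_star (X n) * X n)) \<longlonglongrightarrow> (lim (\<lambda>n. sg_norm (X n)))\<^sup>2"
      using tendsto_power[OF sg_norm_LIMSEQ[OF X], of 2] by (simp add: sgnorm_cstar)
    then show "lim (\<lambda>n. sg_norm (free_star (X n) * X n)) = (lim (\<lambda>n. sg_norm (X n)))\<^sup>2"
      by (rule limI)
  qed
qed

end

lemma of_free_add: "of_free (x + y) = of_free x + of_free y"
  by (simp add: of_free_def plus_semigroup_cstar.abs_eq sg_equiv_refl)

lemma of_free_mult: "of_free (x * y) = of_free x * of_free y"
  by (simp add: of_free_def times_semigroup_cstar.abs_eq sg_equiv_refl)

lemma of_free_zero: "of_free 0 = 0"
  by (simp add: of_free_def zero_semigroup_cstar_def)

lemma of_free_one: "of_free 1 = 1"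
  by (simp add: of_free_def one_semigroup_cstar_def)

lemma of_free_scale: "of_free (free_scale c x) = c *\<^sub>C of_free x"
  by (simp add: of_free_def scaleC_semigroup_cstar.abs_eq sg_equiv_refl)

lemma of_free_star: "of_free (free_star x) = star (of_free x)"
  by (simp add: of_free_def star_semigroup_cstar.abs_eq sg_equiv_refl)

lemma of_free_relation: "sg_relation x y \<Longrightarrow> of_free x = of_free y"
  using sg_norm_relation[of x y] norm_of_free[of "x - y"] by (simp add: of_free_diff)


subsection \<open>The generators and the universal property\<close>

definition sg_v :: "'s::monoid_mult \<Rightarrow> 's semigroup_cstar" where
  "sg_v p = of_free (free_gen (Isom p))"

definition sg_e :: "'s::monoid_mult set \<Rightarrow> 's semigroup_cstar" where
  "sg_e X = of_free (free_gen (Proj X))"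

definition sg_representation ::
  "('s::monoid_mult \<Rightarrow> 'b::unital_cstar_algebra) \<Rightarrow> ('s set \<Rightarrow> 'b) \<Rightarrow> bool" where
  "sg_representation w f \<longleftrightarrow>
     (\<forall>p. star (w p) * w p = 1) \<and>
     (\<forall>X\<in>constructible_ideals. star (f X) = f X \<and> f X * f X = f X) \<and>
     (\<forall>p q. w p * w q = w (p * q)) \<and>
     (\<forall>p. \<forall>X\<in>constructible_ideals. w p * f X * star (w p) = f ((*) p ` X)) \<and>
     f {} = 0 \<and> f UNIV = 1 \<and>
     (\<forall>X\<in>constructible_ideals. \<forall>Y\<in>constructible_ideals. f X * f Y = f (X \<inter> Y))"

theorem sg_representation_generators: "sg_representation sg_v sg_e"
  unfolding sg_representation_def sg_v_def sg_e_def
  by (simp add: sg_relation.intros(1-8)[THEN of_free_relation,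
        unfolded of_free_mult of_free_star of_free_zero of_free_one])

lemma cstar_subalgebra_generated: "cstar_subalgebra (cstar_generated G)"
  unfolding cstar_generated_def
proof (rule hull_in)
  fix T :: "'a set set" assume "Ball T cstar_subalgebra"
  then have T: "\<And>A. A \<in> T \<Longrightarrow> cstar_subalgebra A" by blast
  have "closed (\<Inter>T)" using T by (intro closed_Inter) (simp add: cstar_subalgebra_def)
  then show "cstar_subalgebra (\<Inter>T)" using T by (simp add: cstar_subalgebra_def)
qed

theorem semigroup_cstar_generated:
  "cstar_generated (range sg_v \<union> sg_e ` constructible_ideals) = (UNIV :: 's::monoid_mult semigroup_cstar set)"
proof -
  let ?G = "cstar_generated (range sg_v \<union> sg_e ` constructible_ideals) :: 's semigroup_cstar set"
  have sub: "cstar_subalgebra ?G" by (rule cstar_subalgebra_generated)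
  have inG: "range sg_v \<union> sg_e ` constructible_ideals \<subseteq> ?G"
    unfolding cstar_generated_def by (rule hull_subset)
  have zero: "0 \<in> ?G" and cl: "closed ?G" and mult: "\<And>x y. x \<in> ?G \<Longrightarrow> y \<in> ?G \<Longrightarrow> x * y \<in> ?G"
    and st: "\<And>x. x \<in> ?G \<Longrightarrow> star x \<in> ?G" and add: "\<And>x y. x \<in> ?G \<Longrightarrow> y \<in> ?G \<Longrightarrow> x + y \<in> ?G"
    and sc: "\<And>c x. x \<in> ?G \<Longrightarrow> c *\<^sub>C x \<in> ?G"
    using sub by (simp_all add: cstar_subalgebra_def)
  have gen: "of_free (free_gen g) \<in> ?G" for g :: "'s generator"
  proof (cases g)
    case (Isom p)
    then show ?thesis using inG by (auto simp: sg_v_def)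
  next
    case (Proj X)
    show ?thesis
    proof (cases "X \<in> constructible_ideals")
      case True
      then show ?thesis using inG Proj by (auto simp: sg_e_def)
    next
      case False
      from of_free_relation[OF sg_relation.outside[OF False]] show ?thesis
        using Proj zero by (simp add: of_free_zero)
    qed
  qed
  have "sg_e UNIV \<in> ?G" using inG constructible_ideals.univ by blast
  then have one: "1 \<in> ?G"
    using sg_representation_generators[where 'a='s] by (simp add: sg_representation_def)
  have word: "of_free (Poly_Mapping.single (Word l) 1) \<in> ?G" for l :: "('s generator \<times> bool) list"
  proof (induction l)
    case Nil
    then show ?case using one by (simp add: of_free_one zero_word_def [symmetric])
  next
    case (Cons a l)
    obtain g b where a: "a = (g, b)" by force
    have "of_free (if b then free_star (free_gen g) else free_gen g) \<in> ?G"
      using gen st by (simp add: of_free_star)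
    then show ?case using mult Cons unfolding a single_Word_Cons of_free_mult by blast
  qed
  have free: "of_free x \<in> ?G" for x :: "'s free_algebra"
  proof (induction x rule: free_induct)
    case (single w c)
    have "Poly_Mapping.single w c = free_scale c (Poly_Mapping.single (Word (letters w)) 1)"
      by (simp add: free_scale_single)
    then show ?case using sc[OF word[of "letters w"], of c] by (simp add: of_free_scale)
  qed (use zero add in \<open>simp_all add: of_free_zero of_free_add\<close>)
  have "x \<in> ?G" for x
    by (rule Lim_in_closed_set[OF cl _ _ rep_LIMSEQ[of x]]) (simp_all add: free)
  then show ?thesis by blast
qed

lemma constructible_ideals_Int:
  assumes "left_cancellative TYPE('s::monoid_mult)"
    and "X \<in> constructible_ideals" and "Y \<in> constructible_ideals"
  shows "X \<inter> Y \<in> (constructible_ideals :: 's set set)"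
  using assms(2,3)
proof (induction X arbitrary: Y)
  case (mult X p)
  have "(*) p ` X \<inter> Y = (*) p ` (X \<inter> (*) p -` Y)" by auto
  then show ?case using mult by (simp add: constructible_ideals.intros)
next
  case (preimage X p)
  have "inj ((*) p)" using assms(1) unfolding left_cancellative_def inj_def by blast
  then have "(*) p -` X \<inter> Y = (*) p -` (X \<inter> (*) p ` Y)"
    by (simp add: vimage_Int inj_vimage_image_eq)
  then show ?case using preimage by (simp add: constructible_ideals.intros del: vimage_Int)
qed (simp_all add: constructible_ideals.intros)

lemma norm_star [simp]: "norm (star x) = norm (x :: 'a::cstar_algebra)"
proof -
  have le: "norm y \<le> norm (star y)" for y :: 'a
  proof (cases "norm y = 0")
    case False
    have "norm y * norm y \<le> norm (star y) * norm y"
      using norm_mult_ineq[of "star y" y] by (simp add: cstar_identity power2_eq_square)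
    then show ?thesis using False by (simp add: mult_le_cancel_right)
  qed simp
  show ?thesis using le[of x] le[of "star x"] by (simp add: star_star)
qed

lemma star_minus: "star (- x) = - star (x :: 'a::cstar_algebra)"
  using star_add[of x "- x"] star_add[of "0::'a" 0] by (simp add: eq_neg_iff_add_eq_0 add.commute)

lemma star_diff: "star (x - y) = star x - star (y :: 'a::cstar_algebra)"
  using star_add[of x "- y"] by (simp add: star_minus)

lemma star_zero [simp]: "star 0 = (0 :: 'a::cstar_algebra)"
  using star_diff[of "0::'a" 0] by simp

lemma tendsto_star: "(f \<longlongrightarrow> l) F \<Longrightarrow> ((\<lambda>x. star (f x)) \<longlongrightarrow> star (l :: 'a::cstar_algebra)) F"
  unfolding tendsto_iff by (simp add: dist_norm star_diff [symmetric])

lemma scaleC_diff_right: "c *\<^sub>C (x - y) = c *\<^sub>C x - c *\<^sub>C (y :: 'a::cstar_algebra)"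
  using scaleC_add_right[of c "x - y" y] by simp

lemma tendsto_scaleC:
  assumes "(f \<longlongrightarrow> l) F" shows "((\<lambda>x. c *\<^sub>C f x) \<longlongrightarrow> c *\<^sub>C (l :: 'a::cstar_algebra)) F"
proof -
  have "((\<lambda>x. cmod c * norm (f x - l)) \<longlongrightarrow> cmod c * 0) F"
    using assms by (intro tendsto_mult_left) (simp add: LIM_zero tendsto_norm_zero)
  then have "((\<lambda>x. norm (c *\<^sub>C f x - c *\<^sub>C l)) \<longlongrightarrow> 0) F"
    by (simp add: scaleC_diff_right [symmetric] norm_scaleC)
  then show ?thesis using LIM_zero_cancel tendsto_norm_zero_iff by blast
qed

lemma scaleC_simps [simp]:
  "0 *\<^sub>C x = (0 :: 'a::cstar_algebra)" "1 *\<^sub>C x = x" "c *\<^sub>C 0 = (0 :: 'a)" "(-1) *\<^sub>C x = - x"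
  using scaleR_scaleC[of 0 x] scaleR_scaleC[of 1 x] scaleR_scaleC[of "-1" x]
    scaleC_diff_right[of c "0::'a" 0] by simp_all

text \<open>Evaluation of noncommutative *-polynomials at the images of the generators.\<close>

definition eval_letter ::
  "('s generator \<Rightarrow> 'b::unital_cstar_algebra) \<Rightarrow> 's generator \<times> bool \<Rightarrow> 'b" where
  "eval_letter h a = (if snd a then star (h (fst a)) else h (fst a))"

definition eval_word :: "('s generator \<Rightarrow> 'b::unital_cstar_algebra) \<Rightarrow> 's word \<Rightarrow> 'b" where
  "eval_word h w = prod_list (List.map (eval_letter h) (letters w))"

definition eval_free :: "('s generator \<Rightarrow> 'b::unital_cstar_algebra) \<Rightarrow> 's free_algebra \<Rightarrow> 'b" where
  "eval_free h x = (\<Sum>w\<in>Poly_Mapping.keys x. Poly_Mapping.lookup x w *\<^sub>C eval_word h w)"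

lemma star_one [simp]: "star 1 = (1 :: 'b::unital_cstar_algebra)"
  by (metis mult_1_left mult_1_right star_mult star_star)

lemma eval_word_plus: "eval_word h (v + w) = eval_word h v * eval_word h w"
  by (simp add: eval_word_def plus_word_def)

lemma eval_word_star: "eval_word h (word_star w) = star (eval_word h w)"
proof (cases w)
  case (Word l)
  have "eval_word h (word_star (Word l)) = star (eval_word h (Word l))"
    by (induction l)
      (auto simp: eval_word_def word_star_def eval_letter_def star_mult star_star split_beta)
  then show ?thesis by (simp add: Word)
qed

lemma eval_free_add: "eval_free h (x + y) = eval_free h x + eval_free h y"
  unfolding eval_free_def
  by (rule setsum_keys_plus_distrib) (simp_all add: scaleC_add_left)

lemma eval_free_single: "eval_free h (Poly_Mapping.single w c) = c *\<^sub>C eval_word h w"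
  by (simp add: eval_free_def)

lemma eval_free_zero [simp]: "eval_free h 0 = 0"
  by (simp add: eval_free_def)

lemma eval_free_mult: "eval_free h (x * y) = eval_free h x * eval_free h y"
proof (induction x rule: free_induct)
  case (single w c)
  show ?case
    by (induction y rule: free_induct)
      (simp_all add: mult_single eval_free_single eval_word_plus mult_scaleC_left mult_scaleC_right
        scaleC_scaleC mult.commute distrib_left distrib_right eval_free_add)
qed (simp_all add: distrib_left distrib_right eval_free_add)

lemma eval_free_star: "eval_free h (free_star x) = star (eval_free h x)"
proof (induction x rule: free_induct)
  case zero
  show ?case by simp
next
  case (single w c)
  show ?case by (simp add: free_star_single eval_free_single eval_word_star star_scaleC)
next
  case (add x y)
  then show ?case by (simp add: free_star_add eval_free_add star_add)
qed

lemma eval_free_one: "eval_free h 1 = 1"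
proof -
  have "eval_word h 0 = 1" by (simp add: eval_word_def zero_word_def)
  then show ?thesis using eval_free_single[of h 0 1] by simp
qed

lemma eval_free_scale: "eval_free h (free_scale c x) = c *\<^sub>C eval_free h x"
  by (simp add: free_scale_def eval_free_mult eval_free_single)
    (simp add: eval_word_def zero_word_def mult_scaleC_left)

lemma eval_free_diff: "eval_free h (x - y) = eval_free h x - eval_free h y"
  using eval_free_add[of h "x - y" y] by simp

lemma eval_free_gen: "eval_free h (free_gen g) = h g"
  by (simp add: free_gen_def eval_free_single eval_word_def eval_letter_def)

lemma eval_free_norm_le:
  fixes h :: "'s::monoid_mult generator \<Rightarrow> 'b::unital_cstar_algebra"
  assumes "\<And>x y. sg_relation x y \<Longrightarrow> eval_free h x = eval_free h y"
  shows "norm (eval_free h x) \<le> sg_norm x"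
proof -
  have "(\<lambda>x. norm (eval_free h x)) \<in> sg_seminorms"
    using assms
    by (simp add: sg_seminorms_def cstar_seminorm_def eval_free_add eval_free_scale eval_free_mult
        eval_free_star eval_free_diff norm_triangle_ineq norm_scaleC norm_mult_ineq cstar_identity)
  then show ?thesis by (rule sg_norm_upper)
qed

lemma of_free_LIMSEQ_eval:
  fixes h :: "'s::monoid_mult generator \<Rightarrow> 'b::unital_cstar_algebra"
  assumes "\<And>x y. sg_relation x y \<Longrightarrow> eval_free h x = eval_free h y"
    and X: "(\<lambda>n. of_free (X n)) \<longlonglongrightarrow> a" and Y: "(\<lambda>n. of_free (Y n)) \<longlonglongrightarrow> a"
    and l: "(\<lambda>n. eval_free h (X n)) \<longlonglongrightarrow> l"
  shows "(\<lambda>n. eval_free h (Y n)) \<longlonglongrightarrow> l"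
proof -
  have "(\<lambda>n. norm (of_free (Y n) - of_free (X n))) \<longlonglongrightarrow> 0"
    using tendsto_norm_zero[OF LIM_zero[OF tendsto_diff[OF Y X]]] by simp
  then have "(\<lambda>n. eval_free h (Y n) - eval_free h (X n)) \<longlonglongrightarrow> 0"
    by (rule Lim_null_comparison[rotated])
      (simp add: of_free_diff [symmetric] norm_of_free eval_free_diff [symmetric]
        eval_free_norm_le[OF assms(1)])
  from tendsto_add[OF this l] show ?thesis by simp
qed

text \<open>The universal property, for representations in arbitrary unital C*-algebras; *-homomorphisms
  of C*-algebras are automatically continuous.\<close>

theorem semigroup_cstar_universal:
  fixes w :: "'s::monoid_mult \<Rightarrow> 'b::unital_cstar_algebra" and f :: "'s set \<Rightarrow> 'b"
  assumes canc: "left_cancellative TYPE('s)" and rep: "sg_representation w f"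
  shows "\<exists>!\<phi>. star_hom \<phi> \<and> continuous_on UNIV \<phi> \<and> \<phi> 1 = 1 \<and>
           (\<forall>p. \<phi> (sg_v p) = w p) \<and> (\<forall>X\<in>constructible_ideals. \<phi> (sg_e X) = f X)"
proof -
  define h where "h g = (case g of Isom p \<Rightarrow> w p
    | Proj X \<Rightarrow> if X \<in> constructible_ideals then f X else 0)" for g
  have h_simps: "h (Isom p) = w p" "X \<in> constructible_ideals \<Longrightarrow> h (Proj X) = f X"
    "X \<notin> constructible_ideals \<Longrightarrow> h (Proj X) = 0" for p X
    by (simp_all add: h_def)
  have R: "star (w p) * w p = 1" "X \<in> constructible_ideals \<Longrightarrow> star (f X) = f X"
    "X \<in> constructible_ideals \<Longrightarrow> f X * f X = f X" "w p * w q = w (p * q)"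
    "X \<in> constructible_ideals \<Longrightarrow> w p * f X * star (w p) = f ((*) p ` X)"
    "f {} = 0" "f UNIV = 1"
    "X \<in> constructible_ideals \<Longrightarrow> Y \<in> constructible_ideals \<Longrightarrow> f X * f Y = f (X \<inter> Y)"
    for p q X Y
    using rep unfolding sg_representation_def by simp_all
  have rel: "eval_free h x = eval_free h y" if "sg_relation x y" for x y
    using that
  proof cases
    case (proj_star X)
    then show ?thesis
      by (cases "X \<in> constructible_ideals") (simp_all add: eval_free_star eval_free_gen h_simps R)
  next
    case (proj_idem X)
    then show ?thesis
      by (cases "X \<in> constructible_ideals") (simp_all add: eval_free_mult eval_free_gen h_simps R)
  qed (simp_all add: eval_free_mult eval_free_star eval_free_gen eval_free_one h_simps R
      constructible_ideals.intros constructible_ideals_Int[OF canc])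
  define \<phi> where "\<phi> a = lim (\<lambda>n. eval_free h (rep_semigroup_cstar a n))" for a
  have conv: "convergent (\<lambda>n. eval_free h (X n))" if X: "sg_cauchy X" for X
  proof (rule Cauchy_convergent, rule metric_CauchyI)
    fix \<epsilon> :: real assume "0 < \<epsilon>"
    then obtain M where M: "\<forall>m\<ge>M. \<forall>n\<ge>M. sg_norm (X m - X n) < \<epsilon>"
      using X unfolding sg_cauchy_def by blast
    have "dist (eval_free h (X m)) (eval_free h (X n)) < \<epsilon>" if "m \<ge> M" "n \<ge> M" for m n
      using eval_free_norm_le[OF rel, of "X m - X n"] M that
      by (simp add: dist_norm eval_free_diff order_le_less_trans[of _ "sg_norm (X m - X n)"])
    then show "\<exists>M. \<forall>m\<ge>M. \<forall>n\<ge>M. dist (eval_free h (X m)) (eval_free h (X n)) < \<epsilon>" by blast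
  qed
  have lim_rep: "(\<lambda>n. eval_free h (rep_semigroup_cstar a n)) \<longlonglongrightarrow> \<phi> a" for a
    unfolding \<phi>_def using conv[OF abs_rep_semigroup_cstar(1)] convergent_LIMSEQ_iff by blast
  have lim: "(\<lambda>n. eval_free h (X n)) \<longlonglongrightarrow> \<phi> a" if "(\<lambda>n. of_free (X n)) \<longlonglongrightarrow> a" for X a
    by (rule of_free_LIMSEQ_eval[OF rel rep_LIMSEQ that lim_rep])
  have phi_free: "\<phi> (of_free x) = eval_free h x" for x
    using lim[of "\<lambda>_. x" "of_free x"] by (simp add: LIMSEQ_const_iff)
  let ?r = rep_semigroup_cstar
  have add: "\<phi> (a + b) = \<phi> a + \<phi> b" for a b
  proof (rule LIMSEQ_unique)
    show "(\<lambda>n. eval_free h (?r a n + ?r b n)) \<longlonglongrightarrow> \<phi> (a + b)"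
      by (rule lim) (simp add: of_free_add tendsto_add rep_LIMSEQ)
    show "(\<lambda>n. eval_free h (?r a n + ?r b n)) \<longlonglongrightarrow> \<phi> a + \<phi> b"
      by (simp add: eval_free_add tendsto_add lim_rep)
  qed
  have mult: "\<phi> (a * b) = \<phi> a * \<phi> b" for a b
  proof (rule LIMSEQ_unique)
    show "(\<lambda>n. eval_free h (?r a n * ?r b n)) \<longlonglongrightarrow> \<phi> (a * b)"
      by (rule lim) (simp add: of_free_mult tendsto_mult rep_LIMSEQ)
    show "(\<lambda>n. eval_free h (?r a n * ?r b n)) \<longlonglongrightarrow> \<phi> a * \<phi> b"
      by (simp add: eval_free_mult tendsto_mult lim_rep)
  qed
  have scale: "\<phi> (c *\<^sub>C a) = c *\<^sub>C \<phi> a" for c a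
  proof (rule LIMSEQ_unique)
    show "(\<lambda>n. eval_free h (free_scale c (?r a n))) \<longlonglongrightarrow> \<phi> (c *\<^sub>C a)"
      by (rule lim) (simp add: of_free_scale tendsto_scaleC rep_LIMSEQ)
    show "(\<lambda>n. eval_free h (free_scale c (?r a n))) \<longlonglongrightarrow> c *\<^sub>C \<phi> a"
      by (simp add: eval_free_scale tendsto_scaleC lim_rep)
  qed
  have star: "\<phi> (star a) = star (\<phi> a)" for a
  proof (rule LIMSEQ_unique)
    show "(\<lambda>n. eval_free h (free_star (?r a n))) \<longlonglongrightarrow> \<phi> (star a)"
      by (rule lim) (simp add: of_free_star tendsto_star rep_LIMSEQ)
    show "(\<lambda>n. eval_free h (free_star (?r a n))) \<longlonglongrightarrow> star (\<phi> a)"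
      by (simp add: eval_free_star tendsto_star lim_rep)
  qed
  have norm_le: "norm (\<phi> a) \<le> norm a" for a
    by (rule LIMSEQ_le[OF tendsto_norm[OF lim_rep] tendsto_norm[OF rep_LIMSEQ]])
      (simp add: norm_of_free eval_free_norm_le[OF rel])
  have "linear \<phi>" by (rule linearI) (simp_all add: add scale scaleR_scaleC)
  then have "bounded_linear \<phi>"
    using norm_le by (intro bounded_linear_intro[of \<phi> 1])
      (simp_all add: linear_add linear_scale)
  then have cont: "continuous_on UNIV \<phi>" by (rule linear_continuous_on)
  show ?thesis
  proof (rule ex1I[of _ \<phi>])
    show "star_hom \<phi> \<and> continuous_on UNIV \<phi> \<and> \<phi> 1 = 1 \<and>
        (\<forall>p. \<phi> (sg_v p) = w p) \<and> (\<forall>X\<in>constructible_ideals. \<phi> (sg_e X) = f X)"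
      using cont phi_free[of 1]
      by (simp add: star_hom_def add mult scale star of_free_one eval_free_one sg_v_def sg_e_def
          phi_free eval_free_gen h_def)
  next
    fix \<psi> assume psi: "star_hom \<psi> \<and> continuous_on UNIV \<psi> \<and> \<psi> 1 = 1 \<and>
        (\<forall>p. \<psi> (sg_v p) = w p) \<and> (\<forall>X\<in>constructible_ideals. \<psi> (sg_e X) = f X)"
    let ?E = "{a. \<psi> a = \<phi> a}"
    have psi_hom: "\<psi> (a + b) = \<psi> a + \<psi> b" "\<psi> (c *\<^sub>C a) = c *\<^sub>C \<psi> a" "\<psi> (a * b) = \<psi> a * \<psi> b"
      "\<psi> (star a) = star (\<psi> a)" for a b c
      using psi by (auto simp: star_hom_def)
    have "closed ?E" using psi cont by (intro closed_Collect_eq) auto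
    moreover have "\<psi> 0 = \<phi> 0" using psi_hom(1)[of 0 0] add[of 0 0] by simp
    ultimately have "cstar_subalgebra ?E"
      by (simp add: cstar_subalgebra_def psi_hom add mult scale star)
    moreover have "range sg_v \<union> sg_e ` constructible_ideals \<subseteq> ?E"
      using psi by (auto simp: sg_v_def sg_e_def phi_free eval_free_gen h_def)
    ultimately have "cstar_generated (range sg_v \<union> sg_e ` constructible_ideals) \<subseteq> ?E"
      unfolding cstar_generated_def by (intro hull_minimal)
    then show "\<psi> = \<phi>" by (auto simp: semigroup_cstar_generated)
  qed
qed


subsection \<open>The subalgebras and the conditional expectation onto the larger one\<close>

definition cstar_D :: "'s::monoid_mult semigroup_cstar set" where
  "cstar_D = cstar_generated (sg_e ` constructible_ideals)"

definition cstar_CI :: "'s::monoid_mult semigroup_cstar set" where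
  "cstar_CI = cstar_generated (range (\<lambda>p. sg_e (range ((*) p))) \<union> sg_v ` unit_group)"

text \<open>The values prescribed below determine \<open>\<Phi>\<close>, because a conditional expectation is linear and
  contractive and the products \<open>sg_v p * star (sg_v q)\<close> span a dense subspace for right LCM
  semigroups.\<close>

definition is_expectation_CI :: "('s::monoid_mult semigroup_cstar \<Rightarrow> 's semigroup_cstar) \<Rightarrow> bool" where
  "is_expectation_CI \<Phi> \<longleftrightarrow> conditional_expectation UNIV cstar_CI \<Phi> \<and>
     (\<forall>p q. \<forall>x\<in>unit_group. p = x * q \<longrightarrow>
        \<Phi> (sg_v p * star (sg_v q)) = sg_v x * sg_e (range ((*) q))) \<and>
     (\<forall>p q. (p, q) \<notin> unit_equiv \<longrightarrow> \<Phi> (sg_v p * star (sg_v q)) = 0)"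

end

theory Submission
  imports Defs
begin

text \<open>The composite \<open>E = \<Phi>\<^sub>0 \<circ> \<Phi>\<close> is a faithful contraction onto the commutative algebra
  \<^const>\<open>cstar_D\<close>, so it suffices that \<open>norm (E T) \<le> norm (\<pi> T)\<close> for \<open>T\<close> in the dense span of the
  elements \<open>v\<^sub>p v\<^sub>q\<^sup>*\<close>: then \<open>E\<close> vanishes on the kernel of \<open>\<pi>\<close>.
  As \<open>E T\<close> is a finite combination of commuting projections \<open>e\<^bsub>qS\<^esub>\<close>, its norm is attained on a
  projection \<open>Q = e\<^bsub>cS\<^esub> (1 - e\<^bsub>dS\<^esub>) \<dots> (1 - e\<^bsub>d'S\<^esub>)\<close> with \<open>c\<close> in none of the ideals \<open>dS\<close>, in the sense
  that \<open>Q (E T) = \<mu> Q\<close> with \<open>norm (E T) \<le> \<bar>\<mu>\<bar>\<close>. Shrinking \<open>Q\<close> by finitely many further factors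
  removes the terms with \<open>p \<nsim> q\<close>, so that \<open>Q T Q = Q \<Phi>(T) Q\<close> lies in \<^const>\<open>cstar_CI\<close>, where \<open>\<pi>\<close> is
  isometric; hence \<open>\<bar>\<mu>\<bar> = norm (\<Phi>\<^sub>0 (Q T Q)) \<le> norm (\<pi> T)\<close>. The left regular representation shows that
  \<open>Q \<noteq> 0\<close>. That \<open>\<pi>\<close> is contractive, and isometric where it is injective, is obtained
  from the power series of the square root alone, without spectral theory.\<close>


section \<open>Square roots in C*-algebras\<close>

text \<open>These are the Taylor coefficients at 0 of \<open>1 - sqrt (1 - x)\<close>: the recursion
  compares coefficients in \<open>w * w = 2 * w - x\<close>, solved for the linear term.\<close>

fun sqrt_coeff :: "nat \<Rightarrow> real" where
  "sqrt_coeff n = (if n = 0 then 0 else if n = 1 then 1 / 2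
     else (\<Sum>i\<in>{1..<n}. sqrt_coeff i * sqrt_coeff (n - i)) / 2)"

declare sqrt_coeff.simps [simp del]

lemma sqrt_coeff_0 [simp]: "sqrt_coeff 0 = 0"
  and sqrt_coeff_1 [simp]: "sqrt_coeff (Suc 0) = 1 / 2"
  by (simp_all add: sqrt_coeff.simps)

lemma sqrt_coeff_nonneg: "0 \<le> sqrt_coeff n"
proof (induction n rule: less_induct)
  case (less n)
  have "0 \<le> (\<Sum>i\<in>{1..<n}. sqrt_coeff i * sqrt_coeff (n - i))"
    by (intro sum_nonneg mult_nonneg_nonneg less) auto
  then show ?case by (subst sqrt_coeff.simps) simp
qed

lemma sqrt_coeff_convolution:
  "(\<Sum>i\<le>n. sqrt_coeff i * sqrt_coeff (n - i)) = 2 * sqrt_coeff n - (if n = 1 then 1 else 0)"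
proof -
  have "(\<Sum>i\<le>n. sqrt_coeff i * sqrt_coeff (n - i)) = (\<Sum>i\<in>{1..<n}. sqrt_coeff i * sqrt_coeff (n - i))"
    by (rule sum.mono_neutral_right) (auto simp: not_less_eq_eq not_less)
  then show ?thesis
    by (subst (3) sqrt_coeff.simps) auto
qed

text \<open>By the convolution identity, twice the partial sum up to \<open>Suc n\<close> is 1 plus
  a sum of products over a triangle of index pairs. As \<open>sqrt_coeff 0 = 0\<close>, only pairs
  with both indices at most \<open>n\<close> contribute, and all terms are nonnegative. So a partial
  sum \<open>s\<close> is followed by one that is at most \<open>(1 + s * s) / 2\<close>, which
  preserves the bound 1.\<close>

lemma sqrt_coeff_sum_le: "(\<Sum>i\<le>n. sqrt_coeff i) \<le> 1"
proof (induction n)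
  case (Suc n)
  let ?c = sqrt_coeff
  have "2 * (\<Sum>k\<le>Suc n. ?c k) = 1 + (\<Sum>k\<le>Suc n. \<Sum>i\<le>k. ?c i * ?c (k - i))"
    by (simp add: sqrt_coeff_convolution sum_subtractf sum_distrib_left sum.delta
        del: sum.atMost_Suc)
  also have "(\<Sum>k\<le>Suc n. \<Sum>i\<le>k. ?c i * ?c (k - i)) =
      (\<Sum>(i, j)\<in>{(i, j). i + j \<le> Suc n}. ?c i * ?c j)"
    by (simp add: sum.triangle_reindex_eq)
  also have "\<dots> = (\<Sum>(i, j)\<in>{(i, j). i + j \<le> Suc n \<and> i \<le> n \<and> j \<le> n}. ?c i * ?c j)"
  proof (rule sum.mono_neutral_right)
    show "finite {(i, j). i + j \<le> Suc n}"
      by (rule finite_subset[of _ "{..Suc n} \<times> {..Suc n}"]) auto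
    show "\<forall>x\<in>{(i, j). i + j \<le> Suc n} - {(i, j). i + j \<le> Suc n \<and> i \<le> n \<and> j \<le> n}.
        (case x of (i, j) \<Rightarrow> ?c i * ?c j) = 0"
    proof
      fix x assume "x \<in> {(i, j). i + j \<le> Suc n} - {(i, j). i + j \<le> Suc n \<and> i \<le> n \<and> j \<le> n}"
      then obtain i j where "x = (i, j)" "i = 0 \<or> j = 0" by force
      then show "(case x of (i, j) \<Rightarrow> ?c i * ?c j) = 0" by auto
    qed
  qed auto
  also have "\<dots> \<le> (\<Sum>(i, j)\<in>{..n} \<times> {..n}. ?c i * ?c j)"
    by (rule sum_mono2) (auto simp: sqrt_coeff_nonneg)
  also have "\<dots> = (\<Sum>i\<le>n. ?c i) * (\<Sum>j\<le>n. ?c j)"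
    by (simp add: sum_product sum.cartesian_product)
  also have "\<dots> \<le> 1 * 1"
    by (intro mult_mono Suc) (auto intro: sum_nonneg sqrt_coeff_nonneg)
  finally show ?case by simp
qed simp

lemma summable_sqrt_coeff: "summable sqrt_coeff"
  by (rule bounded_imp_summable[where B = 1]) (simp_all add: sqrt_coeff_nonneg sqrt_coeff_sum_le)

lemma suminf_sqrt_coeff_le: "suminf sqrt_coeff \<le> 1"
  by (rule suminf_le_const[OF summable_sqrt_coeff])
    (metis sqrt_coeff_sum_le lessThan_Suc_atMost not0_implies_Suc lessThan_0 sum.empty zero_le_one)

lemma norm_idem_le_1:
  fixes e :: "'a::cstar_algebra"
  assumes "star e = e" "e * e = e"
  shows "norm e \<le> 1"
  using cstar_identity[of e] by (auto simp: assms power2_eq_square)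

text \<open>Equality can fail, because the class admits the zero algebra.\<close>

lemma norm_one_le: "norm (1::'a::unital_cstar_algebra) \<le> 1"
  by (rule norm_idem_le_1) simp_all

lemma norm_power_le_1:
  fixes x :: "'a::unital_cstar_algebra"
  assumes "norm x \<le> 1"
  shows "norm (x ^ n) \<le> 1"
proof (induction n)
  case 0
  then show ?case by (simp add: norm_one_le)
next
  case (Suc n)
  then have "norm x * norm (x ^ n) \<le> 1 * 1" using assms by (intro mult_mono) simp_all
  then show ?case using norm_mult_ineq[of x "x ^ n"] by simp
qed

lemma bounded_linear_star: "bounded_linear (star :: 'a::cstar_algebra \<Rightarrow> 'a)"
  by (rule bounded_linear_intro[of _ 1]) (simp_all add: star_add scaleR_scaleC star_scaleC)

lemma star_power: "star (x ^ n) = star x ^ n" for x :: "'a::unital_cstar_algebra"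
  by (induction n) (simp_all add: star_mult power_commutes)

lemma cstar_subalgebraD:
  assumes "cstar_subalgebra A"
  shows "closed A" "0 \<in> A" "x \<in> A \<Longrightarrow> y \<in> A \<Longrightarrow> x + y \<in> A" "x \<in> A \<Longrightarrow> c *\<^sub>C x \<in> A"
    "x \<in> A \<Longrightarrow> y \<in> A \<Longrightarrow> x * y \<in> A" "x \<in> A \<Longrightarrow> star x \<in> A" "x \<in> A \<Longrightarrow> r *\<^sub>R x \<in> A"
    "x \<in> A \<Longrightarrow> - x \<in> A" "x \<in> A \<Longrightarrow> y \<in> A \<Longrightarrow> x - y \<in> A"
proof -
  show *: "closed A" "0 \<in> A" "\<And>x y. x \<in> A \<Longrightarrow> y \<in> A \<Longrightarrow> x + y \<in> A"
    "\<And>c x. x \<in> A \<Longrightarrow> c *\<^sub>C x \<in> A" "x \<in> A \<Longrightarrow> y \<in> A \<Longrightarrow> x * y \<in> A" "x \<in> A \<Longrightarrow> star x \<in> A"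
    using assms by (auto simp: cstar_subalgebra_def)
  show "x \<in> A \<Longrightarrow> r *\<^sub>R x \<in> A" by (simp add: scaleR_scaleC *)
  show uminus: "\<And>x. x \<in> A \<Longrightarrow> - x \<in> A" using *(4)[of _ "-1"] by simp
  show "x \<in> A \<Longrightarrow> y \<in> A \<Longrightarrow> x - y \<in> A"
    unfolding diff_conv_add_uminus[of x y] by (intro *(3) uminus)
qed

lemma cstar_subalgebra_sums:
  assumes "cstar_subalgebra A" "\<And>n. f n \<in> A" "f sums s"
  shows "s \<in> A"
proof (rule closed_sequentially[OF cstar_subalgebraD(1)[OF assms(1)]])
  show "(\<lambda>n. \<Sum>i<n. f i) \<longlonglongrightarrow> s" using assms(3) by (simp add: sums_def)
  show "(\<Sum>i<n. f i) \<in> A" for n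
    by (induction n) (simp_all add: cstar_subalgebraD[OF assms(1)] assms(2))
qed

text \<open>Square roots are produced below with the information that they lie in every
  C*-subalgebra containing the original element. Applied to this commutant, that shows that the root
  commutes with each self-adjoint element with which the original one commutes.\<close>

lemma cstar_subalgebra_commutant:
  fixes z :: "'a::cstar_algebra"
  assumes "star z = z"
  shows "cstar_subalgebra {x. x * z = z * x}"
  unfolding cstar_subalgebra_def
proof (intro conjI ballI allI)
  show "closed {x. x * z = z * x}" by (intro closed_Collect_eq continuous_intros)
next
  fix x assume "x \<in> {x. x * z = z * x}"
  then have "star (x * z) = star (z * x)" by simp
  then show "star x \<in> {x. x * z = z * x}" by (simp add: star_mult assms)
next
  fix x y assume "x \<in> {x. x * z = z * x}" "y \<in> {x. x * z = z * x}"
  then have xy: "x * z = z * x" "y * z = z * y" by simp_all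
  have "x * y * z = z * (x * y)" by (metis xy mult.assoc)
  then show "x * y \<in> {x. x * z = z * x}" by simp
qed (auto simp: distrib_left distrib_right mult_scaleC_left mult_scaleC_right)

text \<open>The element \<open>1 - w\<close> is the square root of \<open>1 - x\<close>; the series for \<open>w\<close> converges absolutely
  even when \<open>norm x = 1\<close>.\<close>

lemma sqrt_one_minus:
  fixes x :: "'a::unital_cstar_algebra"
  assumes x: "norm x \<le> 1" "star x = x"
  obtains w where "norm w \<le> 1" "star w = w" "(1 - w) * (1 - w) = 1 - x"
    "\<And>A. cstar_subalgebra A \<Longrightarrow> x \<in> A \<Longrightarrow> w \<in> A"
proof -
  let ?f = "\<lambda>n. sqrt_coeff n *\<^sub>R x ^ n"
  define w where "w = suminf ?f"
  have le: "norm (?f n) \<le> sqrt_coeff n" for n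
    using norm_power_le_1[OF x(1), of n] sqrt_coeff_nonneg[of n] by (simp add: mult_left_le)
  then have sn: "summable (\<lambda>n. norm (?f n))"
    by (intro summable_comparison_test'[OF summable_sqrt_coeff, of 0]) simp_all
  then have s: "?f sums w" unfolding w_def by (rule summable_sums[OF summable_norm_cancel])
  have "norm w \<le> suminf (\<lambda>n. norm (?f n))" unfolding w_def by (rule summable_norm[OF sn])
  also have "\<dots> \<le> suminf sqrt_coeff" by (rule suminf_le[OF le sn summable_sqrt_coeff])
  finally have norm_w: "norm w \<le> 1" using suminf_sqrt_coeff_le by linarith
  have star_w: "star w = w"
    using bounded_linear.sums[OF bounded_linear_star s] s
    by (simp add: scaleR_scaleC star_scaleC star_power x(2) sums_iff)
  have "(\<lambda>k. \<Sum>i\<le>k. ?f i * ?f (k - i)) sums (w * w)"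
    unfolding w_def by (rule Cauchy_product_sums[OF sn sn])
  moreover have "(\<Sum>i\<le>k. ?f i * ?f (k - i)) = 2 *\<^sub>R ?f k - (if k = 1 then x else 0)" for k
  proof -
    have "(\<Sum>i\<le>k. ?f i * ?f (k - i)) = (\<Sum>i\<le>k. sqrt_coeff i * sqrt_coeff (k - i)) *\<^sub>R x ^ k"
      by (simp add: power_add[symmetric] scaleR_sum_left mult.commute)
    then show ?thesis by (simp add: sqrt_coeff_convolution scaleR_diff_left)
  qed
  ultimately have "(\<lambda>k. 2 *\<^sub>R ?f k - (if k = 1 then x else 0)) sums (w * w)" by simp
  moreover have "(\<lambda>k. 2 *\<^sub>R ?f k - (if k = 1 then x else 0)) sums (2 *\<^sub>R w - x)"
    using sums_diff[OF sums_scaleR_right[OF s, of 2] sums_single[of 1 "\<lambda>_. x"]] by simp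
  ultimately have "w * w = 2 *\<^sub>R w - x" by (rule sums_unique2)
  then have "(1 - w) * (1 - w) = 1 - x" by (simp add: algebra_simps scaleR_2)
  moreover have "w \<in> A" if A: "cstar_subalgebra A" "x \<in> A" for A
  proof (rule cstar_subalgebra_sums[OF A(1) _ s])
    fix n
    \<comment> \<open>\<open>A\<close> need not contain \<open>1\<close>. Only positive powers enter
      the series, as \<open>sqrt_coeff 0 = 0\<close>.\<close>
    have "x ^ Suc n \<in> A" for n by (induction n) (simp_all add: A cstar_subalgebraD[OF A(1)])
    then show "?f n \<in> A" by (cases n) (simp_all add: cstar_subalgebraD[OF A(1)])
  qed
  ultimately show ?thesis using that norm_w star_w by blast
qed

text \<open>Here \<open>b + ic\<close> is normal with square norm \<open>norm (b\<^sup>2 + c\<^sup>2)\<close>, and \<open>b\<close> is its real part.\<close>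

lemma norm_le_sum_squares:
  fixes b c :: "'a::cstar_algebra"
  assumes "star b = b" "star c = c" "b * c = c * b"
  shows "(norm b)\<^sup>2 \<le> norm (b * b + c * c)"
proof -
  let ?u = "b + \<i> *\<^sub>C c"
  have su: "star ?u = b - \<i> *\<^sub>C c"
    using scaleC_scaleC[of "-1" \<i> c] by (simp add: star_add star_scaleC assms)
  have "star ?u * ?u = b * b + c * c"
    unfolding su
    by (simp add: distrib_left distrib_right left_diff_distrib right_diff_distrib
        mult_scaleC_left mult_scaleC_right scaleC_scaleC scaleC_diff_right assms)
  then have u: "(norm ?u)\<^sup>2 = norm (b * b + c * c)" using cstar_identity[of ?u] by simp
  have "2 *\<^sub>R b = ?u + star ?u" unfolding su by (simp add: scaleR_2)
  then have "2 * norm b \<le> norm ?u + norm (star ?u)"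
    using norm_triangle_ineq[of ?u "star ?u"] by (metis norm_scaleR abs_numeral)
  then have "norm b \<le> norm ?u" by simp
  then have "(norm b)\<^sup>2 \<le> (norm ?u)\<^sup>2" by (rule power_mono) simp
  then show ?thesis using u by simp
qed

lemma norm_sa_square: "star x = x \<Longrightarrow> norm (x * x) = (norm x)\<^sup>2" for x :: "'a::cstar_algebra"
  using cstar_identity[of x] by simp

text \<open>Here \<open>s\<close> is the square root of \<open>1 - h * h\<close>. A *-homomorphism
  keeps the commutation and maps the sum of squares to the image of \<open>1\<close>, so
  \<open>norm_le_sum_squares\<close> can bound the image of \<open>h\<close> without any use of
  spectra.\<close>

lemma cosine_sine:
  fixes h :: "'a::unital_cstar_algebra"
  assumes h: "norm h \<le> 1" "star h = h"
  obtains s where "star s = s" "h * s = s * h" "h * h + s * s = 1"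
proof -
  have "norm (h * h) \<le> 1" using h by (simp add: norm_sa_square abs_square_le_1)
  then obtain w where w: "star w = w" "(1 - w) * (1 - w) = 1 - h * h"
    "\<And>A. cstar_subalgebra A \<Longrightarrow> h * h \<in> A \<Longrightarrow> w \<in> A"
    using sqrt_one_minus[of "h * h"] h by (metis star_mult)
  have "w * h = h * w"
    using w(3)[OF cstar_subalgebra_commutant[OF h(2)]] by (simp add: mult.assoc)
  with w show ?thesis
    by (intro that[of "1 - w"]) (simp_all add: star_diff algebra_simps)
qed

text \<open>The roles of cosine and sine are exchanged: \<open>1 - h * h\<close> is
  \<open>s * s\<close>, and \<open>s\<close> is the summand that gets bounded. With this bound
  \<open>sqrt_one_minus\<close> applies to \<open>1 - k * k\<close> and produces the absolute value
  of \<open>k\<close>.\<close>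

lemma norm_one_minus_square:
  fixes h :: "'a::unital_cstar_algebra"
  assumes h: "norm h \<le> 1" "star h = h"
  shows "norm (1 - h * h) \<le> 1"
proof -
  obtain s where s: "star s = s" "h * s = s * h" "h * h + s * s = 1"
    using cosine_sine[OF h] by blast
  have "(norm s)\<^sup>2 \<le> norm (s * s + h * h)" by (rule norm_le_sum_squares) (simp_all add: s h)
  also have "\<dots> \<le> 1" using s(3) norm_one_le by (simp add: add.commute)
  finally have "norm (s * s) \<le> 1" using s(1) by (simp add: norm_sa_square)
  then show ?thesis using s(3) by (metis add_diff_cancel_left')
qed


section \<open>Homomorphisms of C*-algebras\<close>

context
  fixes \<pi> :: "'a::cstar_algebra \<Rightarrow> 'b::cstar_algebra"
  assumes hom: "star_hom \<pi>"
begin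

lemma star_hom_add: "\<pi> (x + y) = \<pi> x + \<pi> y"
  and star_hom_scaleC: "\<pi> (c *\<^sub>C x) = c *\<^sub>C \<pi> x"
  and star_hom_mult: "\<pi> (x * y) = \<pi> x * \<pi> y"
  and star_hom_star: "\<pi> (star x) = star (\<pi> x)"
  using hom by (auto simp: star_hom_def)

lemma star_hom_scaleR: "\<pi> (r *\<^sub>R x) = r *\<^sub>R \<pi> x"
  by (simp add: scaleR_scaleC star_hom_scaleC)

lemma star_hom_zero: "\<pi> 0 = 0"
  using star_hom_add[of 0 0] by simp

lemma star_hom_diff: "\<pi> (x - y) = \<pi> x - \<pi> y"
  using star_hom_add[of "x - y" y] by simp

end

text \<open>For self-adjoint \<open>h\<close> in the unit ball, the images of \<open>h\<close> and
  its sine have squares adding up to \<open>\<pi> 1\<close>, which is a projection and has norm at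
  most 1. Scaling gives all self-adjoint elements, and the C*-identity gives the rest. Neither
  continuity of \<open>\<pi>\<close> nor a unit in the codomain is assumed.\<close>

lemma star_hom_contractive:
  fixes \<pi> :: "'a::unital_cstar_algebra \<Rightarrow> 'b::cstar_algebra"
  assumes hom: "star_hom \<pi>"
  shows "norm (\<pi> a) \<le> norm a"
proof -
  note H = star_hom_add[OF hom] star_hom_mult[OF hom] star_hom_star[OF hom] star_hom_scaleR[OF hom]
    star_hom_zero[OF hom]
  have e: "norm (\<pi> 1) \<le> 1"
    by (rule norm_idem_le_1) (simp_all add: H(2,3)[symmetric])
  have unit: "norm (\<pi> h) \<le> 1" if h: "norm h \<le> 1" "star h = h" for h
  proof -
    obtain s where s: "star s = s" "h * s = s * h" "h * h + s * s = 1"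
      using cosine_sine[OF h] by blast
    have "(norm (\<pi> h))\<^sup>2 \<le> norm (\<pi> h * \<pi> h + \<pi> s * \<pi> s)"
      by (rule norm_le_sum_squares) (simp_all add: H(2,3)[symmetric] s h)
    also have "\<dots> = norm (\<pi> 1)" by (simp add: H(1,2)[symmetric] s)
    finally have "(norm (\<pi> h))\<^sup>2 \<le> 1" using e by simp
    then show ?thesis by (simp add: abs_square_le_1)
  qed
  have sa: "norm (\<pi> h) \<le> norm h" if h: "star h = h" for h
  proof (cases "h = 0")
    case False
    have "norm (\<pi> (inverse (norm h) *\<^sub>R h)) \<le> 1"
      using False by (intro unit) (simp_all add: h scaleR_scaleC star_scaleC norm_scaleC norm_inverse)
    then show ?thesis using False by (simp add: H divide_simps)
  qed (simp add: H)
  have "(norm (\<pi> a))\<^sup>2 \<le> (norm a)\<^sup>2"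
    using sa[of "star a * a"] by (simp add: H star_mult star_star cstar_identity)
  then show ?thesis by (rule power2_le_imp_le) simp
qed

text \<open>With \<open>norm c = 1\<close>, \<open>t < 1\<close> and \<open>k = (c\<^sup>2 - t) / 2\<close>, the element \<open>\<bar>k\<bar> + k\<close> lies in \<open>C\<close> and
  is annihilated by \<open>\<pi>\<close> as soon as \<open>norm (\<pi> c)\<^sup>2 < t\<close>; it is nonzero because otherwise
  \<open>t - c\<^sup>2\<close> would be a square and hence \<open>norm c\<^sup>2 \<le> t\<close>.\<close>

lemma star_hom_inj_isometric:
  fixes \<pi> :: "'a::unital_cstar_algebra \<Rightarrow> 'b::cstar_algebra"
  assumes hom: "star_hom \<pi>" and C: "cstar_subalgebra C" "1 \<in> C" and inj: "inj_on \<pi> C"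
    and a: "a \<in> C"
  shows "norm (\<pi> a) = norm a"
proof -
  note H = star_hom_add[OF hom] star_hom_mult[OF hom] star_hom_star[OF hom] star_hom_scaleR[OF hom]
    star_hom_zero[OF hom] star_hom_diff[OF hom]
  note C' = cstar_subalgebraD[OF C(1)]
  have unit: "norm (\<pi> c) \<ge> 1" if c: "c \<in> C" "norm c = 1" "star c = c" for c
  proof (rule ccontr)
    assume "\<not> norm (\<pi> c) \<ge> 1"
    then have "(norm (\<pi> c))\<^sup>2 < 1" by (simp add: abs_square_less_1)
    then obtain t where t: "(norm (\<pi> c))\<^sup>2 < t" "t < 1" using dense by blast
    have t0: "0 < t" using t(1) zero_le_power2[of "norm (\<pi> c)"] by linarith
    define k where "k = (1 / 2) *\<^sub>R (c * c - t *\<^sub>R 1)"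
    have k: "k \<in> C" "star k = k"
      unfolding k_def by (simp_all add: C' C(2) c scaleR_scaleC star_scaleC star_diff star_mult)
    have "norm (c * c - t *\<^sub>R 1) \<le> norm (c * c) + norm (t *\<^sub>R 1 :: 'a)" by (rule norm_triangle_ineq4)
    also have "\<dots> \<le> 1 + 1 * 1"
      using t t0 c norm_one_le[where 'a='a] by (intro add_mono) (simp_all add: norm_sa_square mult_le_one)
    finally have nk: "norm k \<le> 1" by (simp add: k_def)
    have "star (1 - k * k) = 1 - k * k" by (simp add: k star_diff star_mult)
    from sqrt_one_minus[OF norm_one_minus_square[OF nk k(2)] this]
    obtain w where w': "norm w \<le> 1" "star w = w" "(1 - w) * (1 - w) = 1 - (1 - k * k)"
      and wA: "\<And>A. cstar_subalgebra A \<Longrightarrow> 1 - k * k \<in> A \<Longrightarrow> w \<in> A"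
      by blast
    have w: "norm w \<le> 1" "star w = w" "(1 - w) * (1 - w) = k * k" "w \<in> C"
      using w' wA[OF C(1)] by (simp_all add: k C C')
    have wk: "w * k = k * w"
      using wA[OF cstar_subalgebra_commutant[OF k(2)]] by (simp add: algebra_simps)
    \<comment> \<open>As \<open>1 - w\<close> is the absolute value of \<open>k\<close>,
      \<open>d\<close> is twice the positive part of \<open>k\<close>. The factorization
      \<open>(1 - w - k) * d = 0\<close> says that left multiplication by \<open>y\<close> scales
      \<open>d\<close> by \<open>1 + t / 2\<close>. This factor exceeds the norm of
      \<open>\<pi> y\<close>, so \<open>\<pi> d\<close> has to vanish.\<close>
    define d where "d = 1 - w + k"
    define y where "y = w + (1 / 2) *\<^sub>R (c * c)"
    have "(1 - w - k) * d = 0" using w(3) wk by (simp add: d_def algebra_simps)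
    moreover have "1 - w - k = (1 + t / 2) *\<^sub>R 1 - y"
      by (simp add: y_def k_def algebra_simps)
    ultimately have "y * d = (1 + t / 2) *\<^sub>R d" by (simp add: left_diff_distrib)
    then have "\<pi> y * \<pi> d = (1 + t / 2) *\<^sub>R \<pi> d" by (simp only: H(2,4)[symmetric])
    then have "\<bar>1 + t / 2\<bar> * norm (\<pi> d) \<le> norm (\<pi> y) * norm (\<pi> d)"
      using norm_mult_ineq[of "\<pi> y" "\<pi> d"] by (metis norm_scaleR)
    moreover have "norm (\<pi> y) < 1 + t / 2"
    proof -
      have "norm (\<pi> y) \<le> norm (\<pi> w) + norm ((1 / 2) *\<^sub>R (\<pi> c * \<pi> c))"
        unfolding y_def H by (rule norm_triangle_ineq)
      also have "\<dots> < 1 + t / 2"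
        using star_hom_contractive[OF hom, of w] w(1) t(1) c(3)
        by (simp add: norm_sa_square H(3)[symmetric])
      finally show ?thesis .
    qed
    ultimately have "norm (\<pi> d) \<le> 0"
      using t0 by (smt (verit) mult_strict_right_mono)
    then have "\<pi> d = \<pi> 0" by (simp add: H)
    moreover have "d \<in> C" unfolding d_def by (intro C' C k w)
    ultimately have "d = 0" using inj C'(2) by (auto simp: inj_on_def)
    then have wk': "1 - w = - k" unfolding d_def by (simp add: add_eq_0_iff2)
    \<comment> \<open>At this point \<open>1 - w\<close> equals \<open>- k\<close>. A second root,
      now of \<open>1 - w\<close> itself, makes \<open>t - c * c\<close> a square up to the factor
      hidden in \<open>sqrt 2\<close>.\<close>
    obtain m where m: "star m = m" "(1 - m) * (1 - m) = 1 - w"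
      and mA: "\<And>A. cstar_subalgebra A \<Longrightarrow> w \<in> A \<Longrightarrow> m \<in> A"
      using sqrt_one_minus[OF w(1,2)] by metis
    have w_eq: "w = 1 + k" using wk' by (simp add: algebra_simps)
    have "w * c = c * w" unfolding w_eq by (simp add: k_def algebra_simps)
    then have mc: "m * c = c * m" using mA[OF cstar_subalgebra_commutant[OF c(3)]] by simp
    let ?s = "sqrt 2 *\<^sub>R (1 - m)"
    have "?s * ?s = 2 *\<^sub>R (1 - w)" by (simp add: m(2))
    also have "\<dots> = t *\<^sub>R 1 - c * c" unfolding wk' by (simp add: k_def)
    finally have "c * c + ?s * ?s = t *\<^sub>R 1" by (simp only: add_diff_eq add_diff_cancel_left')
    moreover have "(norm c)\<^sup>2 \<le> norm (c * c + ?s * ?s)"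
      by (rule norm_le_sum_squares)
        (simp_all add: c m scaleR_scaleC star_scaleC star_diff mult_scaleC_left mult_scaleC_right
          left_diff_distrib right_diff_distrib mc)
    ultimately have "1 \<le> t * norm (1 :: 'a)" using t0 c(2) by simp
    also have "\<dots> \<le> t * 1" using t0 by (intro mult_left_mono norm_one_le) simp
    finally show False using t(2) by simp
  qed
  have sa: "norm h \<le> norm (\<pi> h)" if h: "h \<in> C" "star h = h" for h
  proof (cases "h = 0")
    case False
    have "1 \<le> norm (\<pi> (inverse (norm h) *\<^sub>R h))"
      using False by (intro unit) (simp_all add: h C' scaleR_scaleC star_scaleC norm_scaleC norm_inverse)
    then show ?thesis using False by (simp add: H divide_simps)
  qed simp
  have "(norm a)\<^sup>2 \<le> (norm (\<pi> a))\<^sup>2"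
    using sa[of "star a * a"] a by (simp add: H star_mult star_star cstar_identity C')
  then have "norm a \<le> norm (\<pi> a)" by (rule power2_le_imp_le) simp
  then show ?thesis using star_hom_contractive[OF hom, of a] by simp
qed

section \<open>Norms under splitting by a commuting projection\<close>

lemma le_of_power_bound:
  fixes x M :: real
  assumes "0 \<le> M" and le: "\<And>n. x ^ (2 ^ n) \<le> 2 * M ^ (2 ^ n)"
  shows "x \<le> M"
proof (rule ccontr)
  assume "\<not> x \<le> M"
  then have xM: "M < x" by simp
  show False
  proof (cases "M = 0")
    case True
    then show ?thesis using le[of 0] xM by simp
  next
    case False
    then have M: "0 < M" using assms(1) by simp
    then obtain n where "2 < (x / M) ^ n" using real_arch_pow[of "x / M" 2] xM by auto
    also have "\<dots> \<le> (x / M) ^ (2 ^ n)"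
      using xM M by (intro power_increasing) simp_all
    also have "\<dots> \<le> 2" using le[of n] M by (simp add: power_divide divide_simps)
    finally show False by simp
  qed
qed

text \<open>For self-adjoint \<open>g\<close> commuting with \<open>P\<close>, the pieces
  \<open>P * g\<close> and \<open>g - P * g\<close> are orthogonal, so repeated squaring turns the
  triangle inequality into one for \<open>2 ^ n\<close>-th powers of the norms. The resulting
  constant 2 disappears on taking roots with \<open>n\<close> growing, by
  \<open>le_of_power_bound\<close>. A general \<open>d\<close> is reduced to
  \<open>star d * d\<close>.\<close>

lemma norm_le_max_projection:
  fixes d P :: "'a::cstar_algebra"
  assumes P: "star P = P" "P * P = P" and Pd: "P * d = d * P"
  shows "norm d \<le> max (norm (P * d)) (norm (d - P * d))"
proof -
  have sa: "norm g ^ (2 ^ n) \<le> norm (P * g) ^ (2 ^ n) + norm (g - P * g) ^ (2 ^ n)"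
    if "star g = g" "P * g = g * P" for g n
    using that
  proof (induction n arbitrary: g)
    case 0
    then show ?case using norm_triangle_ineq[of "P * g" "g - P * g"] by simp
  next
    case (Suc n)
    have Pg: "P * (P * g) = P * g" "g * (P * g) = P * (g * g)" "P * (g * (P * g)) = P * (g * g)"
      using P Suc.prems by (metis mult.assoc)+
    have "(norm g)\<^sup>2 = norm (g * g)" using Suc.prems by (simp add: norm_sa_square)
    moreover have "(norm (P * g))\<^sup>2 = norm (P * (g * g))"
      using Suc.prems P norm_sa_square[of "P * g"] Pg by (simp add: star_mult mult.assoc)
    moreover have "(norm (g - P * g))\<^sup>2 = norm (g * g - P * (g * g))"
    proof -
      have "star (g - P * g) = g - P * g" using Suc.prems P by (simp add: star_diff star_mult)
      moreover have "(g - P * g) * (g - P * g) = g * g - P * (g * g)"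
        using Pg by (simp add: algebra_simps)
      ultimately show ?thesis using norm_sa_square[of "g - P * g"] by simp
    qed
    moreover have "P * (g * g) = g * g * P" using Suc.prems by (metis mult.assoc)
    then have "norm (g * g) ^ (2 ^ n) \<le> norm (P * (g * g)) ^ (2 ^ n) + norm (g * g - P * (g * g)) ^ (2 ^ n)"
      using Suc.prems by (intro Suc.IH) (simp_all add: star_mult)
    ultimately show ?case by (simp add: power_mult)
  qed
  let ?M = "max (norm (P * d)) (norm (d - P * d))"
  have Psd: "P * star d = star d * P" using Pd by (metis star_mult P(1))
  have sPd: "star (P * d) = P * star d" by (simp add: star_mult P Psd)
  have mid: "star d * (P * d) = P * (star d * d)" by (metis Psd mult.assoc)
  have *: "star (P * d) * (P * d) = P * (star d * d)"
    unfolding sPd by (metis mid P(2) mult.assoc)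
  then have "star (d - P * d) * (d - P * d) = star d * d - P * (star d * d)"
    unfolding star_diff left_diff_distrib right_diff_distrib mid by (simp add: sPd mult.assoc)
  then have norms: "norm (P * (star d * d)) = (norm (P * d))\<^sup>2"
    "norm (star d * d - P * (star d * d)) = (norm (d - P * d))\<^sup>2"
    using * by (metis cstar_identity)+
  have "(norm d)\<^sup>2 \<le> ?M\<^sup>2"
  proof (rule le_of_power_bound)
    fix n
    have "((norm d)\<^sup>2) ^ (2 ^ n) \<le> ((norm (P * d))\<^sup>2) ^ (2 ^ n) + ((norm (d - P * d))\<^sup>2) ^ (2 ^ n)"
      using sa[of "star d * d" n] mid Pd by (simp add: star_mult star_star norms cstar_identity mult.assoc)
    also have "\<dots> \<le> (?M\<^sup>2) ^ (2 ^ n) + (?M\<^sup>2) ^ (2 ^ n)" by (intro add_mono power_mono) auto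
    finally show "((norm d)\<^sup>2) ^ (2 ^ n) \<le> 2 * (?M\<^sup>2) ^ (2 ^ n)" by simp
  qed simp
  then show ?thesis by (rule power2_le_imp_le) (simp add: le_max_iff_disj)
qed


section \<open>The left regular representation\<close>

text \<open>The action is defined on all functions, so no completion is involved.
  \<open>Isom p\<close> transports a function along left multiplication by \<open>p\<close>, its
  adjoint pulls back, and the description in \<open>THE\<close> is unique under left cancellation.
  \<open>Proj X\<close> acts as zero for non-constructible \<open>X\<close>, in accordance with the
  relation \<open>outside\<close>.\<close>

fun letter_act :: "'s::monoid_mult generator \<times> bool \<Rightarrow> ('s \<Rightarrow> complex) \<Rightarrow> 's \<Rightarrow> complex" where
  "letter_act (Isom p, False) f = (\<lambda>s. if s \<in> range ((*) p) then f (THE t. s = p * t) else 0)"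
| "letter_act (Isom p, True) f = (\<lambda>s. f (p * s))"
| "letter_act (Proj X, _) f = (\<lambda>s. if s \<in> X \<and> X \<in> constructible_ideals then f s else 0)"

definition word_act :: "'s::monoid_mult word \<Rightarrow> ('s \<Rightarrow> complex) \<Rightarrow> 's \<Rightarrow> complex" where
  "word_act w = foldr letter_act (letters w)"

definition free_act :: "'s::monoid_mult free_algebra \<Rightarrow> ('s \<Rightarrow> complex) \<Rightarrow> 's \<Rightarrow> complex" where
  "free_act x f s = (\<Sum>w\<in>Poly_Mapping.keys x. Poly_Mapping.lookup x w * word_act w f s)"

lemma letter_act_linear:
  "letter_act a (\<lambda>s. c * f s + g s) = (\<lambda>s. c * letter_act a f s + letter_act a g s)"
  by (cases "(a, f)" rule: letter_act.cases) auto

lemma word_act_linear: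
  "word_act w (\<lambda>s. c * f s + g s) = (\<lambda>s. c * word_act w f s + word_act w g s)"
proof (cases w)
  case (Word l)
  have "foldr letter_act l (\<lambda>s. c * f s + g s) = (\<lambda>s. c * foldr letter_act l f s + foldr letter_act l g s)"
    by (induction l) (simp_all add: letter_act_linear)
  then show ?thesis by (simp add: word_act_def Word)
qed

lemma word_act_zero: "word_act w (\<lambda>_. 0) = (\<lambda>_. 0)"
proof
  fix s show "word_act w (\<lambda>_. 0) s = 0"
    using fun_cong[OF word_act_linear[of w 1 "\<lambda>_. 0" "\<lambda>_. 0"], of s] by simp
qed

lemma word_act_plus: "word_act (v + w) f = word_act v (word_act w f)"
  by (simp add: word_act_def plus_word_def)

lemma free_act_add: "free_act (x + y) f = (\<lambda>s. free_act x f s + free_act y f s)"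
  unfolding free_act_def
  by (rule ext, rule setsum_keys_plus_distrib) (simp_all add: distrib_right)

lemma free_act_zero [simp]: "free_act 0 f = (\<lambda>_. 0)"
  by (simp add: free_act_def fun_eq_iff)

lemma free_act_single: "free_act (Poly_Mapping.single w c) f = (\<lambda>s. c * word_act w f s)"
  by (simp add: free_act_def fun_eq_iff)

lemma free_act_diff: "free_act (x - y) f = (\<lambda>s. free_act x f s - free_act y f s)"
  using free_act_add[of "x - y" y f] by (simp add: fun_eq_iff)

lemma free_act_gen: "free_act (free_gen g) f = letter_act (g, False) f"
  by (simp add: free_gen_def free_act_single word_act_def)

lemma free_act_star_gen: "free_act (free_star (free_gen g)) f = letter_act (g, True) f"
  by (simp add: free_gen_def free_star_single free_act_single word_act_def word_star_def)

lemma free_act_one: "free_act 1 f = f"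
proof -
  have "free_act (Poly_Mapping.single 0 1) f = f"
    unfolding free_act_single by (simp add: word_act_def zero_word_def)
  then show ?thesis by simp
qed

lemma free_act_linear_arg:
  "free_act x (\<lambda>s. c * f s + g s) = (\<lambda>s. c * free_act x f s + free_act x g s)"
proof (induction x rule: free_induct)
  case (single w d)
  show ?case by (simp add: free_act_single word_act_linear distrib_left mult.left_commute)
qed (simp_all add: free_act_add distrib_left add_ac)

lemma free_act_mult: "free_act (x * y) f = free_act x (free_act y f)"
proof (induction x rule: free_induct)
  case (single w c)
  have single_zero: "free_act (Poly_Mapping.single w c) (\<lambda>_. 0) = (\<lambda>_. 0)"
    by (simp add: free_act_single word_act_zero)
  show ?case
  proof (induction y rule: free_induct)
    case zero
    then show ?case by (simp add: single_zero)
  next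
    case (single v d)
    then show ?case
      using word_act_linear[of w d "word_act v f" "\<lambda>_. 0"]
      by (simp add: mult_single free_act_single word_act_plus word_act_zero mult.assoc)
  next
    case (add y z)
    then show ?case
      using free_act_linear_arg[of "Poly_Mapping.single w c" 1 "free_act y f" "free_act z f"]
      by (simp add: distrib_left free_act_add)
  qed
qed (simp_all add: distrib_right free_act_add)

lemma free_act_scale: "free_act (free_scale c x) f = (\<lambda>s. c * free_act x f s)"
  unfolding free_scale_def free_act_mult free_act_single by (simp add: word_act_def zero_word_def)

section \<open>Inner product and norm of finitely supported functions\<close>

definition fin_supp :: "('s \<Rightarrow> complex) set" where
  "fin_supp = {f. finite {s. f s \<noteq> 0}}"

definition ip :: "('s \<Rightarrow> complex) \<Rightarrow> ('s \<Rightarrow> complex) \<Rightarrow> complex" where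
  "ip f g = (\<Sum>s | f s \<noteq> 0. cnj (f s) * g s)"

definition l2norm :: "('s \<Rightarrow> complex) \<Rightarrow> real" where
  "l2norm f = L2_set (\<lambda>s. cmod (f s)) {s. f s \<noteq> 0}"

lemma ip_superset:
  assumes "finite A" "{s. f s \<noteq> 0} \<subseteq> A"
  shows "ip f g = (\<Sum>s\<in>A. cnj (f s) * g s)"
  unfolding ip_def by (rule sum.mono_neutral_left[OF assms]) auto

lemma l2norm_superset:
  assumes "finite A" "{s. f s \<noteq> 0} \<subseteq> A"
  shows "l2norm f = L2_set (\<lambda>s. cmod (f s)) A"
  unfolding l2norm_def L2_set_def
  by (rule arg_cong[of _ _ sqrt], rule sum.mono_neutral_left[OF assms]) auto

lemma l2norm_nonneg: "0 \<le> l2norm f"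
  by (simp add: l2norm_def L2_set_nonneg)

lemma ip_self: "ip f f = complex_of_real ((l2norm f)\<^sup>2)"
  by (simp add: ip_def l2norm_def L2_set_def sum_nonneg complex_norm_square mult.commute del: of_real_power)

lemma fin_supp_linear: "f \<in> fin_supp \<Longrightarrow> g \<in> fin_supp \<Longrightarrow> (\<lambda>s. c * f s + g s) \<in> fin_supp"
  unfolding fin_supp_def
  by (auto intro: finite_subset[of _ "{s. f s \<noteq> 0} \<union> {s. g s \<noteq> 0}"])

lemma fin_supp_zero: "(\<lambda>_. 0) \<in> fin_supp"
  by (simp add: fin_supp_def)

lemma fin_supp_add: "f \<in> fin_supp \<Longrightarrow> g \<in> fin_supp \<Longrightarrow> (\<lambda>s. f s + g s) \<in> fin_supp"
  using fin_supp_linear[of f g 1] by simp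

lemma fin_supp_scale: "f \<in> fin_supp \<Longrightarrow> (\<lambda>s. c * f s) \<in> fin_supp"
  using fin_supp_linear[OF _ fin_supp_zero, of f c] by simp

lemma ip_common:
  assumes "f \<in> fin_supp" "g \<in> fin_supp"
  obtains A where "finite A" "{s. f s \<noteq> 0} \<subseteq> A" "{s. g s \<noteq> 0} \<subseteq> A"
  using assms by (intro that[of "{s. f s \<noteq> 0} \<union> {s. g s \<noteq> 0}"]) (auto simp: fin_supp_def)

lemma ip_commute:
  assumes "f \<in> fin_supp" "g \<in> fin_supp"
  shows "ip g f = cnj (ip f g)"
proof -
  obtain A where A: "finite A" "{s. f s \<noteq> 0} \<subseteq> A" "{s. g s \<noteq> 0} \<subseteq> A"
    using ip_common[OF assms] .
  show ?thesis
    by (simp add: ip_superset[OF A(1,2)] ip_superset[OF A(1,3)] mult.commute)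
qed

lemma ip_linear_right: "ip f (\<lambda>s. c * g s + h s) = c * ip f g + ip f h"
  by (simp add: ip_def sum_distrib_left distrib_left sum.distrib mult.left_commute)

lemma ip_linear_left:
  assumes "f \<in> fin_supp" "g \<in> fin_supp" "h \<in> fin_supp"
  shows "ip (\<lambda>s. c * f s + g s) h = cnj c * ip f h + ip g h"
  using ip_linear_right[of h c f g]
    ip_commute[OF assms(3) fin_supp_linear[OF assms(1,2), of c]] ip_commute[OF assms(3,1)]
    ip_commute[OF assms(3,2)] by simp

lemma ip_Cauchy_Schwarz:
  assumes "f \<in> fin_supp" "g \<in> fin_supp"
  shows "cmod (ip f g) \<le> l2norm f * l2norm g"
proof -
  obtain A where A: "finite A" "{s. f s \<noteq> 0} \<subseteq> A" "{s. g s \<noteq> 0} \<subseteq> A"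
    using ip_common[OF assms] .
  have "cmod (ip f g) \<le> (\<Sum>s\<in>A. \<bar>cmod (f s)\<bar> * \<bar>cmod (g s)\<bar>)"
    unfolding ip_superset[OF A(1,2)] by (rule order_trans[OF norm_sum]) (simp add: norm_mult)
  also have "\<dots> \<le> l2norm f * l2norm g"
    unfolding l2norm_superset[OF A(1,2)] l2norm_superset[OF A(1,3)] by (rule L2_set_mult_ineq)
  finally show ?thesis .
qed

lemma l2norm_add:
  assumes "f \<in> fin_supp" "g \<in> fin_supp"
  shows "l2norm (\<lambda>s. f s + g s) \<le> l2norm f + l2norm g"
proof -
  obtain A where A: "finite A" "{s. f s \<noteq> 0} \<subseteq> A" "{s. g s \<noteq> 0} \<subseteq> A"
    using ip_common[OF assms] .
  then have "f s = 0" "g s = 0" if "s \<notin> A" for s using that by auto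
  then have "{s. f s + g s \<noteq> 0} \<subseteq> A" by force
  then have "l2norm (\<lambda>s. f s + g s) = L2_set (\<lambda>s. cmod (f s + g s)) A"
    by (rule l2norm_superset[OF A(1)])
  also have "\<dots> \<le> L2_set (\<lambda>s. cmod (f s) + cmod (g s)) A"
    by (rule L2_set_mono) (simp_all add: norm_triangle_ineq)
  also have "\<dots> \<le> l2norm f + l2norm g"
    unfolding l2norm_superset[OF A(1,2)] l2norm_superset[OF A(1,3)] by (rule L2_set_triangle_ineq)
  finally show ?thesis .
qed

lemma l2norm_scale:
  assumes "f \<in> fin_supp"
  shows "l2norm (\<lambda>s. c * f s) = cmod c * l2norm f"
proof -
  let ?A = "{s. f s \<noteq> 0}"
  have "l2norm (\<lambda>s. c * f s) = L2_set (\<lambda>s. cmod c * cmod (f s)) ?A"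
    using assms by (subst l2norm_superset[of ?A]) (auto simp: fin_supp_def norm_mult)
  then show ?thesis by (simp add: L2_set_right_distrib l2norm_def)
qed

lemma l2norm_zero [simp]: "l2norm (\<lambda>_. 0) = 0"
  by (simp add: l2norm_def)

lemma l2norm_eq_0:
  assumes "f \<in> fin_supp" "l2norm f = 0"
  shows "f = (\<lambda>_. 0)"
  using assms by (auto simp: l2norm_def fin_supp_def L2_set_eq_0_iff)

section \<open>Adjoints and bounds for the action of the free algebra\<close>

context
  assumes canc: "left_cancellative TYPE('s::monoid_mult)"
begin

lemma inj_mult_left: "inj ((*) (p :: 's))"
  using canc unfolding left_cancellative_def inj_def by blast

lemma letter_act_Isom [simp]: "letter_act (Isom p, False) f (p * t :: 's) = f t"
proof -
  have "(THE u. p * t = p * u) = t"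
    by (rule the_equality) (use inj_mult_left[of p] in \<open>auto dest: injD\<close>)
  then show ?thesis by simp
qed

lemma letter_act_Isom_outside [simp]:
  "s \<notin> range ((*) p) \<Longrightarrow> letter_act (Isom p, False) f (s :: 's) = 0"
  by simp

lemma letter_act_Isom_eqI:
  assumes "\<And>t. f t = g (p * t)" "\<And>s. s \<notin> range ((*) p) \<Longrightarrow> g s = 0"
  shows "letter_act (Isom (p :: 's), False) f = g"
proof
  fix s show "letter_act (Isom p, False) f s = g s"
  proof (cases "s \<in> range ((*) p)")
    case True
    then obtain t where "s = p * t" by auto
    then show ?thesis using assms(1) by (simp del: letter_act.simps)
  next
    case False
    then show ?thesis using assms(2) by (simp del: letter_act.simps)
  qed
qed

lemma supp_Isom: "{s. letter_act (Isom (p :: 's), False) f s \<noteq> 0} = (*) p ` {t. f t \<noteq> 0}"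
proof (intro equalityI subsetI)
  fix s assume s: "s \<in> {s. letter_act (Isom p, False) f s \<noteq> 0}"
  then obtain t where "s = p * t" using letter_act_Isom_outside by blast
  then show "s \<in> (*) p ` {t. f t \<noteq> 0}" using s by (simp del: letter_act.simps)
qed (auto simp del: letter_act.simps)

lemma letter_act_fin_supp:
  assumes "f \<in> fin_supp"
  shows "letter_act a (f :: 's \<Rightarrow> complex) \<in> fin_supp"
proof (cases "(a, f)" rule: letter_act.cases)
  case (1 p g)
  then show ?thesis using assms supp_Isom[of p f] by (simp add: fin_supp_def del: letter_act.simps)
next
  case (2 p g)
  then show ?thesis using assms finite_vimageI[OF _ inj_mult_left, of "{s. f s \<noteq> 0}" p]
    by (simp add: fin_supp_def vimage_def)
next
  case (3 X b g)
  have "{s. letter_act a f s \<noteq> 0} \<subseteq> {s. f s \<noteq> 0}" using 3 by auto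
  then show ?thesis using assms unfolding fin_supp_def by (auto intro: finite_subset)
qed

lemma ip_Isom:
  "ip (letter_act (Isom p, False) f) h = ip f (letter_act (Isom p, True) (h :: 's \<Rightarrow> complex))"
  unfolding ip_def supp_Isom
  by (simp add: sum.reindex[OF inj_on_subset[OF inj_mult_left]] del: letter_act.simps(1))

lemma ip_letter:
  assumes "f \<in> fin_supp" "h \<in> fin_supp"
  shows "ip (letter_act (g, b) f) h = ip f (letter_act (g, \<not> b) (h :: 's \<Rightarrow> complex))"
proof (cases g)
  case (Isom p)
  show ?thesis
  proof (cases b)
    case True
    have "ip (letter_act (g, b) f) h = cnj (ip h (letter_act (g, b) f))"
      by (rule ip_commute) (intro letter_act_fin_supp assms)+
    also have "ip h (letter_act (g, b) f) = ip (letter_act (g, False) h) f"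
      using ip_Isom True Isom by simp
    also have "cnj \<dots> = ip f (letter_act (g, \<not> b) h)"
      using ip_commute[OF letter_act_fin_supp[OF assms(2)] assms(1), of "(g, False)"] True by simp
    finally show ?thesis .
  qed (use ip_Isom Isom in simp)
next
  case (Proj X)
  obtain A where A: "finite A" "{s. f s \<noteq> 0} \<subseteq> A" "{s. h s \<noteq> 0} \<subseteq> A"
    using ip_common[OF assms] .
  then have "{s. letter_act (g, b) f s \<noteq> 0} \<subseteq> A" using Proj by auto
  then show ?thesis
    unfolding ip_superset[OF A(1,2)] by (subst ip_superset[OF A(1)]) (auto simp: Proj intro: sum.cong)
qed

lemma word_act_fin_supp:
  assumes "f \<in> fin_supp"
  shows "word_act w (f :: 's \<Rightarrow> complex) \<in> fin_supp"
proof (cases w)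
  case (Word l)
  have "foldr letter_act l f \<in> fin_supp"
    by (induction l) (simp_all add: assms letter_act_fin_supp)
  then show ?thesis by (simp add: word_act_def Word)
qed

lemma ip_word:
  assumes "f \<in> fin_supp" "h \<in> fin_supp"
  shows "ip (word_act w f) h = ip f (word_act (word_star w) (h :: 's \<Rightarrow> complex))"
proof (cases w)
  case (Word l)
  have "ip (word_act (Word l) f) h = ip f (word_act (word_star (Word l)) h)"
    using assms(2)
  proof (induction l arbitrary: h)
    case (Cons a l)
    obtain g b where a: "a = (g, b)" by force
    have "ip (letter_act (g, b) (word_act (Word l) f)) h =
        ip (word_act (Word l) f) (letter_act (g, \<not> b) h)"
      by (intro ip_letter word_act_fin_supp assms(1) Cons.prems)
    also have "\<dots> = ip f (word_act (word_star (Word l)) (letter_act (g, \<not> b) h))"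
      by (intro Cons.IH letter_act_fin_supp Cons.prems)
    finally show ?case by (simp add: a word_act_def word_star_def)
  qed (simp add: word_act_def word_star_def)
  then show ?thesis by (simp add: Word)
qed

lemma free_act_fin_supp:
  assumes "f \<in> fin_supp"
  shows "free_act x (f :: 's \<Rightarrow> complex) \<in> fin_supp"
  by (induction x rule: free_induct)
    (simp_all add: free_act_single free_act_add fin_supp_zero fin_supp_add fin_supp_scale
      word_act_fin_supp assms)

lemma ip_free:
  assumes f: "f \<in> fin_supp" and h: "h \<in> fin_supp"
  shows "ip (free_act x f) h = ip f (free_act (free_star x) (h :: 's \<Rightarrow> complex))"
proof (induction x rule: free_induct)
  case zero
  show ?case by (simp add: ip_def)
next
  case (single w c)
  show ?case
    using ip_linear_left[OF word_act_fin_supp[OF f] fin_supp_zero h, of c w]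
      ip_linear_right[of f "cnj c" "word_act (word_star w) h" "\<lambda>_. 0"] ip_word[OF f h, of w]
    by (simp add: free_act_single free_star_single ip_def)
next
  case (add x y)
  then show ?case
    using ip_linear_left[OF free_act_fin_supp[OF f] free_act_fin_supp[OF f] h, of 1 x y]
      ip_linear_right[of f 1 "free_act (free_star x) h" "free_act (free_star y) h"]
    by (simp add: free_act_add free_star_add)
qed

lemma l2norm_letter:
  assumes "f \<in> fin_supp"
  shows "l2norm (letter_act a (f :: 's \<Rightarrow> complex)) \<le> l2norm f"
proof (cases "(a, f)" rule: letter_act.cases)
  case (1 p g)
  have "l2norm (letter_act (Isom p, False) f) = l2norm f"
    unfolding l2norm_def supp_Isom L2_set_def
    by (simp add: sum.reindex[OF inj_on_subset[OF inj_mult_left]] del: letter_act.simps(1))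
  then show ?thesis using 1 by (simp del: letter_act.simps)
next
  case (2 p g)
  let ?B = "(*) p -` {s. f s \<noteq> 0}"
  have fin: "finite {s. f s \<noteq> 0}" using assms by (simp add: fin_supp_def)
  have "(\<Sum>s\<in>?B. (cmod (f (p * s)))\<^sup>2) = (\<Sum>s\<in>(*) p ` ?B. (cmod (f s))\<^sup>2)"
    by (simp add: sum.reindex[OF inj_on_subset[OF inj_mult_left]])
  also have "\<dots> \<le> (\<Sum>s | f s \<noteq> 0. (cmod (f s))\<^sup>2)" by (rule sum_mono2[OF fin]) auto
  finally show ?thesis using 2 by (simp add: l2norm_def L2_set_def vimage_def)
next
  case (3 X b g)
  have fin: "finite {s. f s \<noteq> 0}" using assms by (simp add: fin_supp_def)
  have "l2norm (letter_act a f) = L2_set (\<lambda>s. cmod (letter_act a f s)) {s. f s \<noteq> 0}"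
    by (rule l2norm_superset[OF fin]) (use 3 in auto)
  also have "\<dots> \<le> l2norm f" unfolding l2norm_def by (rule L2_set_mono) (use 3 in auto)
  finally show ?thesis .
qed

text \<open>Every letter acts as a contraction, hence so does every word, and coefficients add up.
  The bound is what makes the supremum in the operator seminorm meaningful.\<close>

lemma free_act_bounded: "\<exists>B\<ge>0. \<forall>f\<in>fin_supp. l2norm (free_act x (f :: 's \<Rightarrow> complex)) \<le> B * l2norm f"
proof (induction x rule: free_induct)
  case zero
  show ?case by (intro exI[of _ 0]) simp
next
  case (single w c)
  obtain l where w: "w = Word l" by (cases w)
  have "l2norm (foldr letter_act l f) \<le> l2norm f" if f: "f \<in> fin_supp" for f :: "'s \<Rightarrow> complex"
  proof (induction l)
    case (Cons a l)
    have "foldr letter_act l f \<in> fin_supp" using word_act_fin_supp[OF f, of "Word l"] by (simp add: word_act_def)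
    then show ?case using l2norm_letter[of "foldr letter_act l f" a] Cons by simp
  qed simp
  then have "l2norm (free_act (Poly_Mapping.single w c) f) \<le> cmod c * l2norm f" if "f \<in> fin_supp" for f
    unfolding free_act_single l2norm_scale[OF word_act_fin_supp[OF that]]
    using that by (intro mult_left_mono) (simp_all add: word_act_def w)
  then show ?case by (intro exI[of _ "cmod c"]) simp
next
  case (add x y)
  then obtain B C where B: "B \<ge> 0" "\<And>f. f \<in> fin_supp \<Longrightarrow> l2norm (free_act x f) \<le> B * l2norm f"
    and C: "C \<ge> 0" "\<And>f. f \<in> fin_supp \<Longrightarrow> l2norm (free_act y f) \<le> C * l2norm f" by blast
  have "l2norm (free_act (x + y) f) \<le> (B + C) * l2norm f" if f: "f \<in> fin_supp" for f
    using l2norm_add[OF free_act_fin_supp[OF f] free_act_fin_supp[OF f], of x y] B(2)[OF f] C(2)[OF f]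
    by (simp add: free_act_add distrib_right)
  then show ?case using B(1) C(1) by (intro exI[of _ "B + C"]) simp
qed

section \<open>The operator seminorm of the left regular representation\<close>

definition regular_seminorm :: "'s free_algebra \<Rightarrow> real" where
  "regular_seminorm x = (SUP f\<in>{f\<in>fin_supp. l2norm f \<le> 1}. l2norm (free_act x f))"

lemma regular_seminorm_least:
  assumes "\<And>f. f \<in> fin_supp \<Longrightarrow> l2norm f \<le> 1 \<Longrightarrow> l2norm (free_act x f) \<le> B"
  shows "regular_seminorm x \<le> B"
  unfolding regular_seminorm_def
proof (rule cSUP_least)
  have "(\<lambda>_. 0) \<in> {f \<in> fin_supp :: ('s \<Rightarrow> complex) set. l2norm f \<le> 1}" by (simp add: fin_supp_zero)
  then show "{f \<in> fin_supp :: ('s \<Rightarrow> complex) set. l2norm f \<le> 1} \<noteq> {}" by blast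
qed (use assms in auto)

lemma regular_seminorm_upper:
  assumes f: "f \<in> fin_supp" "l2norm f \<le> 1"
  shows "l2norm (free_act x f) \<le> regular_seminorm x"
  unfolding regular_seminorm_def
proof (rule cSUP_upper)
  obtain B where B: "B \<ge> 0" "\<And>f. f \<in> fin_supp \<Longrightarrow> l2norm (free_act x f) \<le> B * l2norm f"
    using free_act_bounded[of x] by blast
  have "l2norm (free_act x g) \<le> B" if "g \<in> fin_supp" "l2norm g \<le> 1" for g
    using B(2)[OF that(1)] mult_left_le[OF that(2) B(1)] by simp
  then show "bdd_above ((\<lambda>f. l2norm (free_act x f)) ` {f \<in> fin_supp. l2norm f \<le> 1})"
    by (intro bdd_aboveI2[of _ _ B]) auto
qed (use f in simp)

lemma regular_seminorm_nonneg: "0 \<le> regular_seminorm x"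
  using regular_seminorm_upper[OF fin_supp_zero, of x] l2norm_nonneg by (metis l2norm_zero order_trans zero_le_one)

lemma l2norm_free_act_le:
  assumes f: "f \<in> fin_supp"
  shows "l2norm (free_act x f) \<le> regular_seminorm x * l2norm f"
proof (cases "l2norm f = 0")
  case True
  then have "f = (\<lambda>_. 0)" using l2norm_eq_0[OF f] by simp
  moreover have "free_act x (\<lambda>_. 0) = (\<lambda>_. 0)"
    using free_act_linear_arg[of x "-1" "\<lambda>_. 0" "\<lambda>_. 0"] by (simp add: fun_eq_iff)
  ultimately show ?thesis by simp
next
  case False
  let ?c = "complex_of_real (inverse (l2norm f))"
  have pos: "0 < l2norm f" using False l2norm_nonneg[of f] by linarith
  have "l2norm (\<lambda>s. ?c * f s) \<le> 1" using pos by (simp add: l2norm_scale[OF f] norm_inverse)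
  moreover have "free_act x (\<lambda>s. ?c * f s) = (\<lambda>s. ?c * free_act x f s)"
    using free_act_linear_arg[of x ?c f "\<lambda>_. 0"] free_act_linear_arg[of x "-1" "\<lambda>_. 0" "\<lambda>_. 0"]
    by (simp add: fun_eq_iff)
  ultimately have "l2norm (\<lambda>s. ?c * free_act x f s) \<le> regular_seminorm x"
    using regular_seminorm_upper[OF fin_supp_scale[OF f], of ?c x] by simp
  then have "inverse (l2norm f) * l2norm (free_act x f) \<le> regular_seminorm x"
    using pos by (simp add: l2norm_scale[OF free_act_fin_supp[OF f]] norm_inverse)
  then show ?thesis using pos by (simp add: field_simps)
qed

text \<open>With \<open>?g\<close> the image of \<open>f\<close> under the adjoint, the square of
  its norm is the inner product of \<open>f\<close> with \<open>free_act x ?g\<close>.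
  Cauchy-Schwarz bounds this by \<open>regular_seminorm x * l2norm ?g\<close>, and one factor
  \<open>l2norm ?g\<close> cancels.\<close>

lemma regular_seminorm_star_le: "regular_seminorm (free_star x) \<le> regular_seminorm x"
proof (rule regular_seminorm_least)
  fix f :: "'s \<Rightarrow> complex" assume f: "f \<in> fin_supp" "l2norm f \<le> 1"
  let ?g = "free_act (free_star x) f"
  have g: "?g \<in> fin_supp" by (rule free_act_fin_supp[OF f(1)])
  have "(l2norm ?g)\<^sup>2 = cmod (ip ?g ?g)" by (simp add: ip_self norm_power)
  also have "ip ?g ?g = ip f (free_act x ?g)" using ip_free[OF f(1) g, of "free_star x"] by simp
  also have "cmod \<dots> \<le> l2norm f * l2norm (free_act x ?g)"
    by (rule ip_Cauchy_Schwarz[OF f(1) free_act_fin_supp[OF g]])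
  also have "\<dots> \<le> 1 * (regular_seminorm x * l2norm ?g)"
    by (intro mult_mono f l2norm_free_act_le g l2norm_nonneg) simp
  finally have "l2norm ?g * l2norm ?g \<le> regular_seminorm x * l2norm ?g" by (simp add: power2_eq_square)
  then show "l2norm ?g \<le> regular_seminorm x"
    using l2norm_nonneg[of ?g] regular_seminorm_nonneg[of x]
    by (cases "l2norm ?g = 0") (auto simp: mult_le_cancel_right)
qed

lemma cstar_seminorm_regular: "cstar_seminorm regular_seminorm"
  unfolding cstar_seminorm_def
proof (intro conjI allI)
  fix x y :: "'s free_algebra" and c :: complex
  show "regular_seminorm (x + y) \<le> regular_seminorm x + regular_seminorm y"
  proof (rule regular_seminorm_least)
    fix f :: "'s \<Rightarrow> complex" assume f: "f \<in> fin_supp" "l2norm f \<le> 1"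
    show "l2norm (free_act (x + y) f) \<le> regular_seminorm x + regular_seminorm y"
      unfolding free_act_add
      using l2norm_add[OF free_act_fin_supp[OF f(1)] free_act_fin_supp[OF f(1)], of x y]
        regular_seminorm_upper[OF f, of x] regular_seminorm_upper[OF f, of y] by linarith
  qed
  have scale_le: "regular_seminorm (free_scale c x) \<le> cmod c * regular_seminorm x" for c x
    by (rule regular_seminorm_least)
      (simp add: free_act_scale l2norm_scale free_act_fin_supp regular_seminorm_upper mult_left_mono)
  show "regular_seminorm (free_scale c x) = cmod c * regular_seminorm x"
  proof (cases "c = 0")
    case True
    then show ?thesis using scale_le[of 0 x] regular_seminorm_nonneg[of "0 :: 's free_algebra"] by simp
  next
    case False
    have "cmod c * regular_seminorm x = cmod c * regular_seminorm (free_scale (inverse c) (free_scale c x))"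
      using False by (simp add: free_scale_scale)
    also have "\<dots> \<le> cmod c * (cmod (inverse c) * regular_seminorm (free_scale c x))"
      by (intro mult_left_mono scale_le) simp
    also have "\<dots> = regular_seminorm (free_scale c x)" using False by (simp add: norm_inverse)
    finally show ?thesis using scale_le[of c x] by simp
  qed
  have mult: "regular_seminorm (x * y) \<le> regular_seminorm x * regular_seminorm y" for x y
  proof (rule regular_seminorm_least)
    fix f :: "'s \<Rightarrow> complex" assume f: "f \<in> fin_supp" "l2norm f \<le> 1"
    have "l2norm (free_act (x * y) f) \<le> regular_seminorm x * l2norm (free_act y f)"
      unfolding free_act_mult by (rule l2norm_free_act_le[OF free_act_fin_supp[OF f(1)]])
    also have "\<dots> \<le> regular_seminorm x * regular_seminorm y"
      by (intro mult_left_mono regular_seminorm_upper f regular_seminorm_nonneg)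
    finally show "l2norm (free_act (x * y) f) \<le> regular_seminorm x * regular_seminorm y" .
  qed
  show "regular_seminorm (x * y) \<le> regular_seminorm x * regular_seminorm y" by (rule mult)
  show "regular_seminorm (free_star x * x) = (regular_seminorm x)\<^sup>2"
  proof (rule antisym)
    have "regular_seminorm (free_star x * x) \<le> regular_seminorm (free_star x) * regular_seminorm x"
      by (rule mult)
    also have "\<dots> \<le> regular_seminorm x * regular_seminorm x"
      by (intro mult_right_mono regular_seminorm_star_le regular_seminorm_nonneg)
    finally show "regular_seminorm (free_star x * x) \<le> (regular_seminorm x)\<^sup>2"
      by (simp add: power2_eq_square)
    have "regular_seminorm x \<le> sqrt (regular_seminorm (free_star x * x))"
    proof (rule regular_seminorm_least)
      fix f :: "'s \<Rightarrow> complex" assume f: "f \<in> fin_supp" "l2norm f \<le> 1"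
      let ?g = "free_act x f"
      have "(l2norm ?g)\<^sup>2 = cmod (ip ?g ?g)" by (simp add: ip_self norm_power)
      also have "ip ?g ?g = ip f (free_act (free_star x * x) f)"
        unfolding free_act_mult by (rule ip_free[OF f(1) free_act_fin_supp[OF f(1)]])
      also have "cmod \<dots> \<le> l2norm f * l2norm (free_act (free_star x * x) f)"
        by (rule ip_Cauchy_Schwarz[OF f(1) free_act_fin_supp[OF f(1)]])
      also have "\<dots> \<le> 1 * regular_seminorm (free_star x * x)"
        by (intro mult_mono f regular_seminorm_upper l2norm_nonneg) simp
      finally show "l2norm ?g \<le> sqrt (regular_seminorm (free_star x * x))"
        by (intro real_le_rsqrt) simp
    qed
    then show "(regular_seminorm x)\<^sup>2 \<le> regular_seminorm (free_star x * x)"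
      using regular_seminorm_nonneg by (metis power_mono real_sqrt_pow2)
  qed
qed

lemma free_act_relation:
  assumes "sg_relation x y"
  shows "free_act x f = free_act y (f :: 's \<Rightarrow> complex)"
  using assms
proof cases
  case (mult p q)
  show ?thesis
    unfolding mult free_act_mult free_act_gen
  proof (rule letter_act_Isom_eqI)
    fix t
    show "letter_act (Isom q, False) f t = letter_act (Isom (p * q), False) f (p * t)"
    proof (cases "t \<in> range ((*) q)")
      case True
      then obtain u where "t = q * u" by auto
      then show ?thesis using letter_act_Isom[of "p * q" f u]
        by (simp add: mult.assoc del: letter_act.simps)
    next
      case False
      then have "p * t \<notin> range ((*) (p * q))"
        using inj_mult_left[of p] by (auto simp: mult.assoc dest: injD)
      then show ?thesis using False by (simp del: letter_act.simps)
    qed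
  next
    fix s assume "s \<notin> range ((*) p)"
    then have "s \<notin> range ((*) (p * q))" by (auto simp: mult.assoc)
    then show "letter_act (Isom (p * q), False) f s = 0" by (rule letter_act_Isom_outside)
  qed
next
  case (conj X p)
  have "t \<in> X" if "p * t = p * u" "u \<in> X" for t u
    using that inj_mult_left[of p] by (auto dest: injD)
  then show ?thesis
    unfolding conj(1,2) free_act_mult free_act_gen free_act_star_gen using conj(3)
    by (intro letter_act_Isom_eqI) (auto simp: constructible_ideals.mult)
\<comment> \<open>For \<open>inter\<close> the intersection must be known to be constructible, since
  otherwise its projection would act as zero.\<close>
qed (auto simp: free_act_mult free_act_gen free_act_star_gen free_act_one fun_eq_iff
    constructible_ideals.intros constructible_ideals_Int[OF canc] simp del: letter_act.simps(1))

text \<open>As one of the seminorms in the supremum, \<open>regular_seminorm\<close> is a lower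
  bound for \<open>sg_norm\<close>. Elements of the universal algebra can thus be shown to be
  nonzero on basis vectors.\<close>

lemma regular_seminorm_in: "regular_seminorm \<in> sg_seminorms"
proof -
  have "regular_seminorm (x - y) = 0" if "sg_relation x y" for x y
  proof (rule antisym[OF regular_seminorm_least regular_seminorm_nonneg])
    show "l2norm (free_act (x - y) f) \<le> 0" for f
      using free_act_relation[OF that, of f] by (simp add: free_act_diff)
  qed
  then show ?thesis by (simp add: sg_seminorms_def cstar_seminorm_regular)
qed

text \<open>In the left regular representation the projection below fixes the basis vector at \<open>c\<close>.\<close>

lemma avoiding_projection_nonzero:
  assumes "\<And>d. d \<in> set ds \<Longrightarrow> c \<notin> range ((*) d)"
  shows "sg_e (range ((*) c)) * prod_list (map (\<lambda>d. 1 - sg_e (range ((*) d))) ds) \<noteq> (0 :: 's semigroup_cstar)"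
proof
  let ?\<delta> = "\<lambda>s. if s = c then 1 else 0 :: complex"
  let ?y = "prod_list (map (\<lambda>d. 1 - free_gen (Proj (range ((*) d)))) ds) :: 's free_algebra"
  let ?x = "free_gen (Proj (range ((*) c))) * ?y"
  assume 0: "sg_e (range ((*) c)) * prod_list (map (\<lambda>d. 1 - sg_e (range ((*) d))) ds) = (0 :: 's semigroup_cstar)"
  have "of_free ?y = prod_list (map (\<lambda>d. 1 - sg_e (range ((*) d))) ds)"
    by (induction ds) (simp_all add: of_free_mult of_free_diff of_free_one sg_e_def)
  then have "of_free ?x = 0" using 0 by (simp add: of_free_mult sg_e_def)
  then have x: "sg_norm ?x = 0" using norm_of_free[of ?x] by simp
  have "free_act ?y ?\<delta> = ?\<delta>"
    using assms
    by (induction ds) (auto simp: free_act_one free_act_mult free_act_diff free_act_gen fun_eq_iff)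
  moreover have "c \<in> range ((*) c)" by (metis mult_1_right rangeI)
  moreover have "range ((*) c) \<in> constructible_ideals"
    by (rule constructible_ideals.mult[OF constructible_ideals.univ])
  ultimately have "free_act ?x ?\<delta> = ?\<delta>"
    by (auto simp: free_act_mult free_act_gen fun_eq_iff)
  moreover have "l2norm ?\<delta> = 1" by (simp add: l2norm_def L2_set_def)
  moreover have "?\<delta> \<in> fin_supp" by (simp add: fin_supp_def)
  ultimately have "1 \<le> regular_seminorm ?x"
    using regular_seminorm_upper[of ?\<delta> ?x] by simp
  then show False using sg_norm_upper[OF regular_seminorm_in, of ?x] x by simp
qed

end


section \<open>Dense subalgebra and projections\<close>

lemma cstar_subalgebra_closure:
  fixes V :: "'a::cstar_algebra set"
  assumes "0 \<in> V" and add: "\<And>x y. x \<in> V \<Longrightarrow> y \<in> V \<Longrightarrow> x + y \<in> V"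
    and scale: "\<And>c x. x \<in> V \<Longrightarrow> c *\<^sub>C x \<in> V"
    and mult: "\<And>x y. x \<in> V \<Longrightarrow> y \<in> V \<Longrightarrow> x * y \<in> V" and st: "\<And>x. x \<in> V \<Longrightarrow> star x \<in> V"
  shows "cstar_subalgebra (closure V)"
  unfolding cstar_subalgebra_def
proof (intro conjI ballI allI)
  show "0 \<in> closure V" using assms(1) closure_subset by blast
next
  fix x y assume "x \<in> closure V" "y \<in> closure V"
  then obtain X Y where X: "\<And>n. X n \<in> V" "X \<longlonglongrightarrow> x" and Y: "\<And>n. Y n \<in> V" "Y \<longlonglongrightarrow> y"
    unfolding closure_sequential by blast
  show "x + y \<in> closure V"
    unfolding closure_sequential
    by (rule exI[of _ "\<lambda>n. X n + Y n"]) (simp add: X Y add tendsto_add)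
  show "x * y \<in> closure V"
    unfolding closure_sequential
    by (rule exI[of _ "\<lambda>n. X n * Y n"]) (simp add: X Y mult tendsto_mult)
next
  fix c x assume "x \<in> closure V"
  then obtain X where X: "\<And>n. X n \<in> V" "X \<longlonglongrightarrow> x" unfolding closure_sequential by blast
  show "c *\<^sub>C x \<in> closure V"
    unfolding closure_sequential
    by (rule exI[of _ "\<lambda>n. c *\<^sub>C X n"]) (simp add: X scale tendsto_scaleC)
next
  fix x assume "x \<in> closure V"
  then obtain X where X: "\<And>n. X n \<in> V" "X \<longlonglongrightarrow> x" unfolding closure_sequential by blast
  show "star x \<in> closure V"
    unfolding closure_sequential
    by (rule exI[of _ "\<lambda>n. star (X n)"]) (simp add: X st tendsto_star)
qed simp

section \<open>Units, cancellation and condition (C1)\<close>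

lemma unit_group_inverse:
  assumes "x \<in> unit_group" obtains y where "y \<in> unit_group" "x * y = 1" "y * x = 1"
  using assms unfolding unit_group_def by blast

lemma unit_group_mult:
  assumes "x \<in> unit_group" "y \<in> unit_group" shows "x * y \<in> unit_group"
proof -
  obtain x' y' where "x * x' = 1" "x' * x = 1" "y * y' = 1" "y' * y = 1"
    using assms unfolding unit_group_def by blast
  then have "(x * y) * (y' * x') = 1" "(y' * x') * (x * y) = 1"
    by (metis mult.assoc mult_1_left)+
  then show ?thesis unfolding unit_group_def by blast
qed

text \<open>Left cancellation turns a right inverse of \<open>a\<close> into a two-sided one. Hence,
  for nonunits \<open>a\<close>, the projection of the ideal of \<open>c * a\<close> may be removed
  from that of \<open>c\<close> without destroying the basis vector at \<open>c\<close>.\<close>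

lemma nonunit_avoids:
  assumes "left_cancellative TYPE('s::monoid_mult)" "a \<notin> unit_group"
  shows "c \<notin> range ((*) (c * a :: 's))"
proof
  have cancel: "\<And>p q r :: 's. p * q = p * r \<Longrightarrow> q = r"
    using assms(1) unfolding left_cancellative_def by blast
  assume "c \<in> range ((*) (c * a))"
  then obtain t where "c * 1 = c * (a * t)" by (auto simp: mult.assoc)
  then have at: "a * t = 1" using cancel by metis
  then have "a * (t * a) = a * 1" by (simp add: mult.assoc[symmetric])
  then have "t * a = 1" using cancel by blast
  then show False using at assms(2) unfolding unit_group_def by blast
qed

text \<open>(C1) moves the units \<open>a\<close> and \<open>b\<close> to the left of
  \<open>\<alpha>\<close> and \<open>\<beta>\<close>, so that \<open>\<alpha> = z * \<beta>\<close>
  with a unit \<open>z\<close>. Right cancellation of \<open>\<beta>\<close> leaves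
  \<open>p * z = q\<close>, and (C1) moves \<open>z\<close> to the left of \<open>p\<close>.\<close>

lemma unit_equiv_of_common_multiple:
  fixes p q \<alpha> \<beta> a b :: "'s::monoid_mult"
  assumes "right_cancellative TYPE('s)" "condition_C1 TYPE('s)"
    and "p * \<alpha> = q * \<beta>" "\<alpha> * a = \<beta> * b" "a \<in> unit_group" "b \<in> unit_group"
  shows "(p, q) \<in> unit_equiv"
proof -
  have cancel: "\<And>p q r :: 's. q * p = r * p \<Longrightarrow> q = r"
    using assms(1) unfolding right_cancellative_def by blast
  have C1: "\<exists>x\<in>unit_group. r * u = x * r" if "u \<in> unit_group" for r u :: 's
    using assms(2) that unfolding condition_C1_def by blast
  obtain x y where xy: "x \<in> unit_group" "\<alpha> * a = x * \<alpha>" "y \<in> unit_group" "\<beta> * b = y * \<beta>"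
    using C1 assms(5,6) by meson
  obtain x' where x': "x' \<in> unit_group" "x' * x = 1" using unit_group_inverse[OF xy(1)] by metis
  define z where "z = x' * y"
  have "\<alpha> = x' * (x * \<alpha>)" using x' by (simp add: mult.assoc[symmetric])
  also have "\<dots> = z * \<beta>" using xy assms(4) by (simp add: z_def mult.assoc)
  finally have "p * z * \<beta> = q * \<beta>" using assms(3) by (simp add: mult.assoc)
  then have pz: "p * z = q" by (rule cancel)
  have "z \<in> unit_group" unfolding z_def by (intro unit_group_mult x' xy)
  then obtain w where w: "w \<in> unit_group" "p * z = w * p" using C1 by blast
  obtain w' where w': "w' \<in> unit_group" "w' * w = 1" using unit_group_inverse[OF w(1)] by metis
  have "p = w' * q" using w' pz w(2) by (metis mult.assoc mult_1_left)
  then show ?thesis using w'(1) unfolding unit_equiv_def by blast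
qed

section \<open>Range projections of the isometries\<close>

abbreviation (input) range_proj :: "'s::monoid_mult \<Rightarrow> 's semigroup_cstar" where
  "range_proj p \<equiv> sg_e (range ((*) p))"

lemma self_in_range: "p \<in> range ((*) (p :: 's::monoid_mult))"
  by (metis mult_1_right rangeI)

lemma range_constructible: "range ((*) p) \<in> constructible_ideals"
  by (rule constructible_ideals.mult[OF constructible_ideals.univ])

lemma sg_v_isometry: "star (sg_v p) * sg_v p = 1"
  and sg_v_mult: "sg_v p * sg_v q = sg_v (p * q)"
  and sg_e_empty: "sg_e {} = 0"
  and range_proj_star: "star (range_proj p) = range_proj p"
  and range_proj_idem: "range_proj p * range_proj p = range_proj p"
  and range_proj_eq: "range_proj p = sg_v p * star (sg_v p)"
  and range_proj_Int: "range_proj p * range_proj q = sg_e (range ((*) p) \<inter> range ((*) q))"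
  and sg_e_UNIV: "sg_e UNIV = 1"
proof -
  note rep = sg_representation_generators[unfolded sg_representation_def]
  note rp = range_constructible[of p] range_constructible[of q]
  show "star (sg_v p) * sg_v p = 1" "sg_v p * sg_v q = sg_v (p * q)" "sg_e {} = 0"
    "star (range_proj p) = range_proj p" "range_proj p * range_proj p = range_proj p"
    "range_proj p * range_proj q = sg_e (range ((*) p) \<inter> range ((*) q))"
    and 1: "sg_e UNIV = 1"
    using rep rp by blast+
  have "sg_v p * sg_e UNIV * star (sg_v p) = range_proj p"
    using rep constructible_ideals.univ by blast
  then show "range_proj p = sg_v p * star (sg_v p)" by (simp add: 1)
qed

lemma range_proj_commute: "range_proj p * range_proj q = range_proj q * range_proj p"
  by (simp add: range_proj_Int Int_commute)

text \<open>An idempotent isometry is \<open>1\<close>, because its adjoint cancels it on the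
  left.\<close>

lemma sg_v_one: "sg_v 1 = 1"
proof -
  have "star (sg_v 1) * (sg_v 1 * sg_v 1) = star (sg_v 1) * (sg_v 1 :: 'a semigroup_cstar)"
    by (simp add: sg_v_mult)
  then show ?thesis by (metis mult.assoc mult_1_left sg_v_isometry)
qed

lemma range_proj_sg_v: "range_proj p * sg_v p = sg_v p"
  by (simp add: range_proj_eq mult.assoc sg_v_isometry)

lemma star_sg_v_range_proj: "star (sg_v p) * range_proj p = star (sg_v p)"
  by (metis range_proj_star range_proj_sg_v star_mult)

lemma range_proj_absorb:
  assumes "c \<in> range ((*) d)" shows "range_proj c * range_proj d = range_proj c"
proof -
  have "range ((*) c) \<inter> range ((*) d) = range ((*) c)" using assms by (auto simp: mult.assoc)
  then show ?thesis by (simp add: range_proj_Int)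
qed

section \<open>Projections that avoid finitely many principal ideals\<close>

definition complement_prod :: "'s::monoid_mult list \<Rightarrow> 's semigroup_cstar" where
  "complement_prod ds = prod_list (map (\<lambda>d. 1 - range_proj d) ds)"

text \<open>In the left regular representation this is the indicator of the ideal of
  \<open>c\<close> minus the union of the ideals of the members of \<open>ds\<close>. A list fixes
  an order of the factors, although they commute.\<close>

definition avoiding_proj :: "'s::monoid_mult \<Rightarrow> 's list \<Rightarrow> 's semigroup_cstar" where
  "avoiding_proj c ds = range_proj c * complement_prod ds"

lemma complement_prod_Nil [simp]: "complement_prod [] = 1"
  and complement_prod_Cons: "complement_prod (d # ds) = (1 - range_proj d) * complement_prod ds"
  and complement_prod_append: "complement_prod (ds @ ds') = complement_prod ds * complement_prod ds'"
  by (simp_all add: complement_prod_def)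

lemma complement_prod_commutes:
  assumes "\<And>q. range_proj q * z = z * range_proj q"
  shows "complement_prod ds * z = z * complement_prod ds"
proof (induction ds)
  case (Cons d ds)
  have "(1 - range_proj d) * (complement_prod ds * z) = (1 - range_proj d) * z * complement_prod ds"
    by (simp add: Cons.IH mult.assoc)
  also have "(1 - range_proj d) * z = z * (1 - range_proj d)"
    by (simp add: left_diff_distrib right_diff_distrib assms)
  finally show ?case by (simp add: complement_prod_Cons mult.assoc)
qed simp

lemma complement_prod_range_proj: "complement_prod ds * range_proj q = range_proj q * complement_prod ds"
  by (rule complement_prod_commutes) (rule range_proj_commute)

lemma complement_prod_complement: "complement_prod ds * (1 - range_proj q) = (1 - range_proj q) * complement_prod ds"
  by (simp add: left_diff_distrib right_diff_distrib complement_prod_range_proj)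

lemma complement_prod_projection:
  "star (complement_prod ds) = complement_prod ds"
  "complement_prod ds * complement_prod ds = complement_prod ds"
proof (induction ds)
  case (Cons d ds)
  let ?f = "1 - range_proj d" and ?R = "complement_prod ds"
  have f: "star ?f = ?f" "?f * ?f = ?f"
    by (simp_all add: star_diff range_proj_star left_diff_distrib right_diff_distrib range_proj_idem)
  show "star (complement_prod (d # ds)) = complement_prod (d # ds)"
    by (simp only: complement_prod_Cons star_mult f Cons.IH(1) complement_prod_complement)
  have "?f * ?R * (?f * ?R) = ?f * (?R * ?f) * ?R" by (simp only: mult.assoc)
  also have "\<dots> = (?f * ?f) * (?R * ?R)" by (simp only: complement_prod_complement mult.assoc)
  finally show "complement_prod (d # ds) * complement_prod (d # ds) = complement_prod (d # ds)"
    by (simp only: complement_prod_Cons f Cons.IH(2))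
qed simp_all

lemma complement_prod_kills: "d \<in> set ds \<Longrightarrow> complement_prod ds * range_proj d = 0"
proof (induction ds)
  case (Cons a ds)
  show ?case
  proof (cases "d = a")
    case True
    have "complement_prod (a # ds) * range_proj d = (1 - range_proj a) * range_proj d * complement_prod ds"
      by (simp only: complement_prod_Cons mult.assoc complement_prod_range_proj)
    also have "(1 - range_proj a) * range_proj d = 0" by (simp add: True left_diff_distrib range_proj_idem)
    finally show ?thesis by simp
  qed (use Cons in \<open>simp add: complement_prod_Cons mult.assoc\<close>)
qed simp

lemma avoiding_proj_projection:
  "star (avoiding_proj c ds) = avoiding_proj c ds"
  "avoiding_proj c ds * avoiding_proj c ds = avoiding_proj c ds"
proof -
  show "star (avoiding_proj c ds) = avoiding_proj c ds"
    by (simp add: avoiding_proj_def star_mult complement_prod_projection range_proj_star complement_prod_range_proj)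
  have "avoiding_proj c ds * avoiding_proj c ds =
      range_proj c * (complement_prod ds * range_proj c) * complement_prod ds"
    by (simp only: avoiding_proj_def mult.assoc)
  also have "\<dots> = (range_proj c * range_proj c) * (complement_prod ds * complement_prod ds)"
    by (simp only: complement_prod_range_proj mult.assoc)
  finally show "avoiding_proj c ds * avoiding_proj c ds = avoiding_proj c ds"
    by (simp only: range_proj_idem complement_prod_projection avoiding_proj_def)
qed

lemma avoiding_proj_commutes:
  assumes "\<And>q. range_proj q * z = z * range_proj q"
  shows "avoiding_proj c ds * z = z * avoiding_proj c ds"
  unfolding avoiding_proj_def mult.assoc complement_prod_commutes[OF assms]
  by (simp add: assms mult.assoc[symmetric])

lemma avoiding_proj_range_proj: "avoiding_proj c ds * range_proj c = avoiding_proj c ds"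
  by (simp add: avoiding_proj_def mult.assoc complement_prod_range_proj)
    (simp add: mult.assoc[symmetric] range_proj_idem)

lemma avoiding_proj_kills: "d \<in> set ds \<Longrightarrow> avoiding_proj c ds * range_proj d = 0"
  by (simp add: avoiding_proj_def mult.assoc complement_prod_kills)

lemma avoiding_proj_Cons:
  "avoiding_proj c (q # ds) = avoiding_proj c ds - avoiding_proj c ds * range_proj q"
  by (simp add: avoiding_proj_def complement_prod_Cons mult.assoc complement_prod_range_proj
      left_diff_distrib right_diff_distrib)

text \<open>If \<open>c\<close> lies in the ideal of \<open>d\<close>, then
  \<open>range_proj c\<close> is absorbed by \<open>range_proj d\<close>, which the product
  annihilates. Read backwards, a nonzero avoiding projection has its \<open>c\<close> outside all
  the removed ideals.\<close>

lemma avoiding_proj_eq_0: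
  assumes "d \<in> set ds" "c \<in> range ((*) d)"
  shows "avoiding_proj c ds = 0"
proof -
  have "avoiding_proj c ds = avoiding_proj c ds * (range_proj d * range_proj c)"
    using avoiding_proj_range_proj range_proj_absorb[OF assms(2)] by (metis range_proj_commute)
  then show ?thesis by (simp add: mult.assoc[symmetric] avoiding_proj_kills[OF assms(1)])
qed

lemma avoiding_proj_in_subalgebra:
  assumes A: "cstar_subalgebra A" "\<And>p. range_proj p \<in> A"
  shows "avoiding_proj c ds \<in> A"
proof -
  note C = cstar_subalgebraD[OF A(1)]
  have "complement_prod ds \<in> A"
  proof (induction ds)
    case Nil
    then show ?case using A(2)[of 1] by (simp add: sg_e_UNIV)
  next
    case (Cons d ds)
    have "1 \<in> A" using A(2)[of 1] by (simp add: sg_e_UNIV)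
    then show ?case unfolding complement_prod_Cons by (intro C A Cons)
  qed
  then show ?thesis unfolding avoiding_proj_def by (intro C A)
qed

section \<open>Right LCM semigroups and the dense span\<close>

context
  assumes right_lcm: "right_LCM TYPE('s::monoid_mult)"
begin

lemma canc: "left_cancellative TYPE('s)"
  using right_lcm by (simp add: right_LCM_def)

lemma left_cancel: "p * q = p * r \<Longrightarrow> q = (r :: 's)"
  using canc unfolding left_cancellative_def by blast

lemma lcm_cases:
  obtains (disjoint) "range ((*) p) \<inter> range ((*) (q :: 's)) = {}"
  | (lcm) a b where "p * a = q * b" "range ((*) p) \<inter> range ((*) q) = range ((*) (p * a))"
proof (cases "range ((*) p) \<inter> range ((*) q) = {}")
  case False
  have "\<forall>p q :: 's. range ((*) p) \<inter> range ((*) q) = {} \<or>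
      (\<exists>r. range ((*) p) \<inter> range ((*) q) = range ((*) r))"
    using right_lcm unfolding right_LCM_def by (rule conjunct2)
  with False obtain r where r: "range ((*) p) \<inter> range ((*) q) = range ((*) r)" by metis
  have "r \<in> range ((*) p) \<inter> range ((*) q)" unfolding r by (rule self_in_range)
  then obtain a b where ab: "r = p * a" "r = q * b" by (elim IntE rangeE)
  show ?thesis by (rule that(2)[of a b]) (use ab r in simp_all)
qed (rule that(1))

lemma star_sg_v_disjoint:
  assumes "range ((*) p) \<inter> range ((*) (q :: 's)) = {}"
  shows "star (sg_v p) * sg_v q = 0"
proof -
  have "star (sg_v p) * sg_v q = star (sg_v p) * (range_proj p * range_proj q) * sg_v q"
    by (metis mult.assoc star_sg_v_range_proj range_proj_sg_v)
  then show ?thesis by (simp add: range_proj_Int assms sg_e_empty)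
qed

text \<open>Both range projections can be inserted in the middle. Their product is the range
  projection of the least common multiple \<open>p * a = q * b\<close>, and the outer isometries
  cancel. This is what makes the span of the products \<open>sg_v p * star (sg_v q)\<close>
  multiplicatively closed.\<close>

lemma star_sg_v_sg_v:
  assumes "p * a = q * b" "range ((*) p) \<inter> range ((*) (q :: 's)) = range ((*) (p * a))"
  shows "star (sg_v p) * sg_v q = sg_v a * star (sg_v b)"
proof -
  have "range_proj p * range_proj q = range_proj (p * a)" by (simp only: range_proj_Int assms(2))
  also have "\<dots> = sg_v (p * a) * star (sg_v (q * b))" by (simp add: range_proj_eq assms(1))
  finally have "range_proj p * range_proj q = sg_v (p * a) * star (sg_v (q * b))" .
  then have e: "range_proj p * range_proj q = sg_v p * sg_v a * (star (sg_v b) * star (sg_v q))"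
    by (simp add: sg_v_mult[symmetric] star_mult)
  have "star (sg_v p) * sg_v q = star (sg_v p) * (range_proj p * range_proj q) * sg_v q"
    by (metis mult.assoc star_sg_v_range_proj range_proj_sg_v)
  also have "\<dots> = (star (sg_v p) * sg_v p) * sg_v a * star (sg_v b) * (star (sg_v q) * sg_v q)"
    by (simp only: e mult.assoc)
  finally show ?thesis by (simp add: sg_v_isometry)
qed

text \<open>The right LCM property enters for preimages: if the ideals of \<open>p\<close> and
  \<open>q\<close> meet in that of \<open>p * a\<close>, then left cancellation identifies the
  preimage under \<open>p\<close> of the ideal of \<open>q\<close> with the ideal of
  \<open>a\<close>.\<close>

lemma constructible_principal:
  "X \<in> constructible_ideals \<Longrightarrow> X = {} \<or> (\<exists>p :: 's. X = range ((*) p))"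
proof (induction X rule: constructible_ideals.induct)
  case univ
  have "UNIV = range ((*) (1 :: 's))" by auto
  then show ?case by blast
next
  case (mult X p)
  then consider "X = {}" | q where "X = range ((*) q)" by blast
  then show ?case
  proof cases
    case 2
    then have "(*) p ` X = range ((*) (p * q))" by (auto simp: mult.assoc image_iff)
    then show ?thesis by blast
  qed simp
next
  case (preimage X p)
  then consider "X = {}" | q where "X = range ((*) q)" by blast
  then show ?case
  proof cases
    case X: 2
    show ?thesis
    proof (cases rule: lcm_cases[of p q])
      case disjoint
      then show ?thesis unfolding X by blast
    next
      case (lcm a b)
      have "(*) p -` X = range ((*) a)"
      proof (intro equalityI subsetI)
        fix s assume "s \<in> (*) p -` X"
        then have "p * s \<in> range ((*) (p * a))" using lcm(2) X by blast
        then obtain t where "p * s = p * (a * t)" by (auto simp: mult.assoc)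
        then show "s \<in> range ((*) a)" using left_cancel by blast
      next
        fix s assume "s \<in> range ((*) a)"
        then obtain t where "s = a * t" by auto
        then have "p * s = q * (b * t)" by (metis lcm(1) mult.assoc)
        then show "s \<in> (*) p -` X" using X by auto
      qed
      then show ?thesis by blast
    qed
  qed simp
qed simp

text \<open>\<open>span\<close> is the real linear span, so the complex multiples are put among the
  generators.\<close>

definition toeplitz_span :: "'s semigroup_cstar set" where
  "toeplitz_span = span (range (\<lambda>(c, p, q). c *\<^sub>C (sg_v p * star (sg_v q))))"

lemma toeplitz_span_gen: "c *\<^sub>C (sg_v p * star (sg_v q)) \<in> toeplitz_span"
  unfolding toeplitz_span_def by (rule span_base, rule image_eqI[of _ _ "(c, p, q)"]) simp_all

lemma toeplitz_span_induct [consumes 1, case_names zero add scaleR gen]: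
  assumes "T \<in> toeplitz_span" "P 0" "\<And>x y. P x \<Longrightarrow> P y \<Longrightarrow> P (x + y)"
    "\<And>r x. P x \<Longrightarrow> P (r *\<^sub>R x)" "\<And>c p q. P (c *\<^sub>C (sg_v p * star (sg_v q)))"
  shows "P T"
  using assms(1) unfolding toeplitz_span_def
proof (induction rule: span_induct)
  case base
  then show ?case using assms(2-4) by (auto simp: subspace_def)
next
  case (step x)
  then show ?case using assms(5) by auto
qed

lemma toeplitz_span_closed:
  "0 \<in> toeplitz_span" "x \<in> toeplitz_span \<Longrightarrow> y \<in> toeplitz_span \<Longrightarrow> x + y \<in> toeplitz_span"
  "x \<in> toeplitz_span \<Longrightarrow> r *\<^sub>R x \<in> toeplitz_span"
  unfolding toeplitz_span_def by (simp_all add: span_zero span_add span_scale)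

lemma toeplitz_span_scaleC: "x \<in> toeplitz_span \<Longrightarrow> c *\<^sub>C x \<in> toeplitz_span"
proof (induction x rule: toeplitz_span_induct)
  case (scaleR r x)
  have "c *\<^sub>C r *\<^sub>R x = r *\<^sub>R c *\<^sub>C x"
    by (simp add: scaleR_scaleC scaleC_scaleC mult.commute)
  then show ?case using scaleR by (simp add: toeplitz_span_closed)
qed (simp_all add: toeplitz_span_closed scaleC_add_right scaleC_scaleC toeplitz_span_gen)

lemma toeplitz_span_star: "x \<in> toeplitz_span \<Longrightarrow> star x \<in> toeplitz_span"
proof (induction x rule: toeplitz_span_induct)
  case (scaleR r x)
  then show ?case by (simp add: scaleR_scaleC star_scaleC toeplitz_span_scaleC)
qed (simp_all add: toeplitz_span_closed star_add star_scaleC star_mult star_star toeplitz_span_gen)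

lemma toeplitz_span_mult:
  assumes "x \<in> toeplitz_span" "y \<in> toeplitz_span" shows "x * y \<in> toeplitz_span"
  using assms(1)
proof (induction x rule: toeplitz_span_induct)
  case (gen c p q)
  show ?case
    using assms(2)
  proof (induction y rule: toeplitz_span_induct)
    case (gen d r s)
    have eq: "c *\<^sub>C (sg_v p * star (sg_v q)) * d *\<^sub>C (sg_v r * star (sg_v s)) =
        (c * d) *\<^sub>C (sg_v p * (star (sg_v q) * sg_v r) * star (sg_v s))"
      by (simp add: mult_scaleC_left mult_scaleC_right scaleC_scaleC mult.commute mult.assoc)
    show ?case
    proof (cases rule: lcm_cases[of q r])
      case disjoint
      then show ?thesis by (simp add: eq star_sg_v_disjoint toeplitz_span_closed)
    next
      case (lcm a b)
      have "sg_v p * (sg_v a * star (sg_v b)) * star (sg_v s) = sg_v (p * a) * star (sg_v (s * b))"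
        by (simp add: sg_v_mult[symmetric] star_mult mult.assoc)
      then show ?thesis by (simp add: eq star_sg_v_sg_v[OF lcm] toeplitz_span_gen)
    qed
  qed (simp_all add: toeplitz_span_closed distrib_left)
qed (simp_all add: toeplitz_span_closed distrib_right)

lemma closure_toeplitz_span: "closure toeplitz_span = (UNIV :: 's semigroup_cstar set)"
proof -
  have v: "sg_v p \<in> toeplitz_span" for p :: 's
    using toeplitz_span_gen[of 1 p 1] by (simp add: sg_v_one)
  have e: "sg_e X \<in> toeplitz_span" if "X \<in> constructible_ideals" for X :: "'s set"
    using constructible_principal[OF that]
  proof
    assume "X = {}"
    then show ?thesis by (simp add: sg_e_empty toeplitz_span_closed)
  next
    assume "\<exists>p. X = range ((*) p)"
    then obtain p where "X = range ((*) p)" by blast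
    then show ?thesis using toeplitz_span_gen[of 1 p p] by (simp add: range_proj_eq)
  qed
  have "cstar_subalgebra (closure toeplitz_span)"
    by (rule cstar_subalgebra_closure)
      (simp_all add: toeplitz_span_closed toeplitz_span_scaleC toeplitz_span_mult toeplitz_span_star)
  moreover have "range sg_v \<union> sg_e ` constructible_ideals \<subseteq> closure toeplitz_span"
    using v e closure_subset by blast
  ultimately have "cstar_generated (range sg_v \<union> sg_e ` constructible_ideals) \<subseteq> closure toeplitz_span"
    unfolding cstar_generated_def by (intro hull_minimal)
  then show ?thesis by (auto simp: semigroup_cstar_generated)
qed

text \<open>The induction over \<open>qs\<close> starts from the projection \<open>1\<close>. Each
  \<open>q\<close> splits the current projection \<open>?P\<close> into
  \<open>?P * range_proj q\<close> and its complement in \<open>?P\<close>, and by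
  \<open>norm_le_max_projection\<close> one half keeps the norm of \<open>D\<close>. Both halves
  have the required shape: the first replaces \<open>c\<close> by a least common multiple of
  \<open>c\<close> and \<open>q\<close>, the second adds \<open>q\<close> to \<open>ds\<close>. That
  \<open>c\<close> avoids \<open>ds\<close> follows at the end from
  \<open>D \<noteq> 0\<close>.\<close>

lemma norm_attaining_projection:
  fixes D :: "'s semigroup_cstar"
  assumes D: "D \<noteq> 0" and comm: "\<And>q. range_proj q * D = D * range_proj q"
  obtains c ds where "norm D \<le> norm (avoiding_proj c ds * D)"
    "\<And>d. d \<in> set ds \<Longrightarrow> c \<notin> range ((*) d)"
    "\<And>q. q \<in> set qs \<Longrightarrow> avoiding_proj c ds * range_proj q \<in> {0, avoiding_proj c ds}"
proof -
  have "\<exists>c ds. norm D \<le> norm (avoiding_proj c ds * D) \<and>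
      (\<forall>q\<in>set qs. avoiding_proj c ds * range_proj q \<in> {0, avoiding_proj c ds})"
  proof (induction qs)
    case Nil
    have "avoiding_proj 1 [] = (1 :: 's semigroup_cstar)"
      by (simp add: avoiding_proj_def sg_e_UNIV)
    then show ?case by (intro exI[of _ 1] exI[of _ "[]"]) simp
  next
    case (Cons q qs)
    then obtain c ds where P: "norm D \<le> norm (avoiding_proj c ds * D)"
      "\<And>r. r \<in> set qs \<Longrightarrow> avoiding_proj c ds * range_proj r \<in> {0, avoiding_proj c ds}" by blast
    let ?P = "avoiding_proj c ds"
    have Pq: "range_proj r * ?P = ?P * range_proj r" for r
      using avoiding_proj_commutes[of "range_proj r" c ds] by (simp add: range_proj_commute)
    have X: "range_proj q * (?P * D) = ?P * range_proj q * D"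
      by (simp add: Pq mult.assoc[symmetric])
    have "range_proj q * (?P * D) = ?P * D * range_proj q"
      unfolding X by (simp add: comm mult.assoc)
    then have "norm (?P * D) \<le> max (norm (?P * range_proj q * D)) (norm (?P * D - ?P * range_proj q * D))"
      using norm_le_max_projection[OF range_proj_star range_proj_idem, of q "?P * D"] by (simp add: X)
    then consider "norm D \<le> norm (?P * range_proj q * D)" | "norm D \<le> norm (?P * D - ?P * range_proj q * D)"
      using P(1) by linarith
    then show ?case
    proof cases
      case 1
      \<comment> \<open>This rules out disjoint ideals in the next case distinction, so a least
        common multiple \<open>r\<close> exists.\<close>
      have ne: "?P * range_proj q \<noteq> 0" using 1 D by auto
      have Pe: "?P * range_proj q = range_proj c * range_proj q * complement_prod ds"
        by (simp add: avoiding_proj_def mult.assoc complement_prod_range_proj)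
      obtain r where "range ((*) c) \<inter> range ((*) q) = range ((*) r)"
      proof (cases rule: lcm_cases[of c q])
        case disjoint
        then show ?thesis using ne by (simp add: Pe range_proj_Int sg_e_empty)
      qed (rule that)
      then have P': "avoiding_proj r ds = ?P * range_proj q"
        by (simp add: Pe range_proj_Int) (simp add: avoiding_proj_def)
      have "?P * range_proj q * range_proj s \<in> {0, ?P * range_proj q}" if "s \<in> set (q # qs)" for s
      proof (cases "s = q")
        case True
        then show ?thesis by (simp add: mult.assoc range_proj_idem)
      next
        case False
        then have "?P * range_proj s \<in> {0, ?P}" using that P(2) by simp
        moreover have "?P * range_proj q * range_proj s = ?P * range_proj s * range_proj q"
          by (simp add: mult.assoc range_proj_commute)
        ultimately show ?thesis by auto
      qed
      then show ?thesis using 1 by (intro exI[of _ r] exI[of _ ds]) (simp add: P')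
    next
      case 2
      let ?P' = "?P - ?P * range_proj q"
      have "?P' * range_proj s \<in> {0, ?P'}" if "s \<in> set (q # qs)" for s
      proof (cases "s = q")
        case True
        then show ?thesis by (simp add: left_diff_distrib mult.assoc range_proj_idem)
      next
        case False
        then have "?P * range_proj s \<in> {0, ?P}" using that P(2) by simp
        moreover have "?P' * range_proj s = ?P * range_proj s - ?P * range_proj s * range_proj q"
          by (simp add: left_diff_distrib mult.assoc range_proj_commute)
        ultimately show ?thesis by auto
      qed
      then show ?thesis using 2
        by (intro exI[of _ c] exI[of _ "q # ds"]) (simp add: avoiding_proj_Cons left_diff_distrib)
    qed
  qed
  then obtain c ds where P: "norm D \<le> norm (avoiding_proj c ds * D)"
    "\<And>q. q \<in> set qs \<Longrightarrow> avoiding_proj c ds * range_proj q \<in> {0, avoiding_proj c ds}" by blast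
  have "c \<notin> range ((*) d)" if "d \<in> set ds" for d
    using avoiding_proj_eq_0[OF that, of c] P(1) D by auto
  then show ?thesis using that P by blast
qed


section \<open>Compressing away the off-diagonal part\<close>

text \<open>If \<open>c\<close> misses the ideal of \<open>p\<close> or of \<open>q\<close>,
  removing that ideal kills one factor. Otherwise \<open>c = p * \<alpha> = q * \<beta>\<close>, and
  inserting \<open>range_proj c\<close> on both sides leaves
  \<open>star (sg_v \<alpha>) * sg_v \<beta>\<close> between \<open>sg_v c\<close> and its adjoint.
  This is zero for disjoint ideals. In the remaining case the product becomes
  \<open>sg_v (c * a) * star (sg_v (c * b))\<close>, where \<open>a\<close> and \<open>b\<close> are
  not both units, so an ideal missing \<open>c\<close> can be removed. The quantification over
  \<open>Q\<close> allows lists for several terms to be merged later.\<close>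

lemma off_diagonal_compression:
  fixes p q c :: "'s::monoid_mult"
  assumes cancel: "cancellative TYPE('s)" and C1: "condition_C1 TYPE('s)"
    and pq: "(p, q) \<notin> unit_equiv"
  obtains ds where "\<And>d. d \<in> set ds \<Longrightarrow> c \<notin> range ((*) d)"
    "\<And>Q. star Q = Q \<Longrightarrow> Q * range_proj c = Q \<Longrightarrow> (\<And>d. d \<in> set ds \<Longrightarrow> Q * range_proj d = 0)
      \<Longrightarrow> Q * (sg_v p * star (sg_v q)) * Q = 0"
proof -
  have lc: "left_cancellative TYPE('s)" and rc: "right_cancellative TYPE('s)"
    using cancel by (simp_all add: cancellative_def)
  have left: "Q * sg_v r = 0" if "Q * range_proj r = 0" for Q and r :: 's
    using that by (metis range_proj_sg_v mult.assoc mult_zero_left)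
  have right: "star (sg_v r) * Q = 0" if "star Q = Q" "Q * range_proj r = 0" for Q and r :: 's
    using left[OF that(2)] that(1) by (metis star_mult star_zero)
  consider "c \<notin> range ((*) p)" | "c \<notin> range ((*) q)" | \<alpha> \<beta> where "c = p * \<alpha>" "c = q * \<beta>"
    by blast
  then show ?thesis
  proof cases
    case 1
    show ?thesis
    proof (rule that[of "[p]"])
      fix Q :: "'s semigroup_cstar" assume "\<And>d. d \<in> set [p] \<Longrightarrow> Q * range_proj d = 0"
      then have "Q * sg_v p = 0" by (intro left) simp
      then show "Q * (sg_v p * star (sg_v q)) * Q = 0" by (simp add: mult.assoc[symmetric])
    qed (use 1 in simp)
  next
    case 2
    show ?thesis
    proof (rule that[of "[q]"])
      fix Q :: "'s semigroup_cstar"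
      assume "star Q = Q" "\<And>d. d \<in> set [q] \<Longrightarrow> Q * range_proj d = 0"
      then have "star (sg_v q) * Q = 0" by (intro right) simp_all
      then show "Q * (sg_v p * star (sg_v q)) * Q = 0" by (simp add: mult.assoc)
    qed (use 2 in simp)
  next
    case (3 \<alpha> \<beta>)
    have vc: "sg_v c = sg_v p * sg_v \<alpha>" "sg_v c = sg_v q * sg_v \<beta>"
      using 3 by (simp_all add: sg_v_mult)
    have "star (sg_v c) * sg_v p = star (sg_v \<alpha>) * (star (sg_v p) * sg_v p)"
      unfolding vc(1) star_mult by (simp only: mult.assoc)
    then have cp: "star (sg_v c) * sg_v p = star (sg_v \<alpha>)" by (simp add: sg_v_isometry)
    have "star (sg_v q) * sg_v c = (star (sg_v q) * sg_v q) * sg_v \<beta>"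
      unfolding vc(2) by (simp only: mult.assoc)
    then have cq: "star (sg_v q) * sg_v c = sg_v \<beta>" by (simp add: sg_v_isometry)
    have compress: "Q * (sg_v p * star (sg_v q)) * Q =
        Q * (sg_v c * (star (sg_v \<alpha>) * sg_v \<beta>) * star (sg_v c)) * Q"
      if Q: "star Q = Q" "Q * range_proj c = Q" for Q
    proof -
      have Q': "range_proj c * Q = Q" using Q by (metis range_proj_star star_mult)
      have "Q * (sg_v p * star (sg_v q)) * Q =
          (Q * range_proj c) * (sg_v p * star (sg_v q)) * (range_proj c * Q)" by (simp only: Q Q')
      also have "\<dots> = Q * (sg_v c * ((star (sg_v c) * sg_v p) * (star (sg_v q) * sg_v c)) * star (sg_v c)) * Q"
        by (simp only: range_proj_eq mult.assoc)
      finally show ?thesis by (simp only: cp cq)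
    qed
    show ?thesis
    proof (cases rule: lcm_cases[of \<alpha> \<beta>])
      case disjoint
      show ?thesis
        by (rule that[of "[]"]) (simp_all add: compress star_sg_v_disjoint[OF disjoint])
    next
      case (lcm a b)
      have eq: "Q * (sg_v p * star (sg_v q)) * Q = Q * sg_v (c * a) * (star (sg_v (c * b)) * Q)"
        if Q: "star Q = Q" "Q * range_proj c = Q" for Q
        unfolding compress[OF Q] star_sg_v_sg_v[OF lcm] sg_v_mult[symmetric] star_mult
        by (simp only: mult.assoc)
      have "a \<notin> unit_group \<or> b \<notin> unit_group"
        using unit_equiv_of_common_multiple[OF rc C1 3(1)[symmetric, unfolded 3(2)] lcm(1)] pq by blast
      then show ?thesis
      proof
        assume a: "a \<notin> unit_group"
        show ?thesis
          by (rule that[of "[c * a]"]) (simp_all add: eq left nonunit_avoids[OF lc a])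
      next
        assume b: "b \<notin> unit_group"
        show ?thesis
          by (rule that[of "[c * b]"]) (simp_all add: eq right nonunit_avoids[OF lc b])
      qed
    qed
  qed
qed

section \<open>The composite of the two expectations on the dense span\<close>

context
  fixes \<Phi> \<Phi>\<^sub>0 :: "'s::monoid_mult semigroup_cstar \<Rightarrow> 's semigroup_cstar"
  assumes cancel: "cancellative TYPE('s)" and C1: "condition_C1 TYPE('s)"
    and Phi: "is_expectation_CI \<Phi>"
    and Phi0: "conditional_expectation cstar_CI cstar_D \<Phi>\<^sub>0"
    and Phi0_unit: "\<And>q x. x \<in> unit_group \<Longrightarrow>
      \<Phi>\<^sub>0 (sg_e (range ((*) q)) * sg_v x) = (if x = 1 then sg_e (range ((*) q)) else 0)"
begin

lemma Phi_props:
  "\<Phi> a \<in> cstar_CI" "\<Phi> (a + b) = \<Phi> a + \<Phi> b" "\<Phi> (z *\<^sub>C a) = z *\<^sub>C \<Phi> a"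
  "norm (\<Phi> a) \<le> norm a" "a \<in> positive_elements UNIV \<Longrightarrow> \<Phi> a \<in> positive_elements cstar_CI"
proof -
  have E: "conditional_expectation UNIV cstar_CI \<Phi>"
    using Phi unfolding is_expectation_CI_def by (rule conjunct1)
  show "\<Phi> a \<in> cstar_CI" "\<Phi> (a + b) = \<Phi> a + \<Phi> b" "\<Phi> (z *\<^sub>C a) = z *\<^sub>C \<Phi> a"
    "norm (\<Phi> a) \<le> norm a" "a \<in> positive_elements UNIV \<Longrightarrow> \<Phi> a \<in> positive_elements cstar_CI"
    using E unfolding conditional_expectation_def by simp_all
qed

lemma Phi_diagonal: "x \<in> unit_group \<Longrightarrow> \<Phi> (sg_v (x * q) * star (sg_v q)) = sg_v x * range_proj q"
  and Phi_off_diagonal: "(p, q) \<notin> unit_equiv \<Longrightarrow> \<Phi> (sg_v p * star (sg_v q)) = 0"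
  using Phi unfolding is_expectation_CI_def by simp_all

lemma Phi0_props:
  "a \<in> cstar_CI \<Longrightarrow> b \<in> cstar_CI \<Longrightarrow> \<Phi>\<^sub>0 (a + b) = \<Phi>\<^sub>0 a + \<Phi>\<^sub>0 b"
  "a \<in> cstar_CI \<Longrightarrow> \<Phi>\<^sub>0 (z *\<^sub>C a) = z *\<^sub>C \<Phi>\<^sub>0 a"
  "a \<in> cstar_CI \<Longrightarrow> norm (\<Phi>\<^sub>0 a) \<le> norm a"
  "a \<in> cstar_CI \<Longrightarrow> c \<in> cstar_D \<Longrightarrow> \<Phi>\<^sub>0 (c * a) = c * \<Phi>\<^sub>0 a"
  "a \<in> cstar_CI \<Longrightarrow> c \<in> cstar_D \<Longrightarrow> \<Phi>\<^sub>0 (a * c) = \<Phi>\<^sub>0 a * c"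
  using Phi0 unfolding conditional_expectation_def by simp_all

definition composite_expectation :: "'s semigroup_cstar \<Rightarrow> 's semigroup_cstar" where
  "composite_expectation a = \<Phi>\<^sub>0 (\<Phi> a)"

lemma composite_expectation_linear:
  "composite_expectation (a + b) = composite_expectation a + composite_expectation b"
  "composite_expectation (z *\<^sub>C a) = z *\<^sub>C composite_expectation a"
  "composite_expectation (r *\<^sub>R a) = r *\<^sub>R composite_expectation a"
  "composite_expectation 0 = 0"
  "composite_expectation (a - b) = composite_expectation a - composite_expectation b"
  "norm (composite_expectation a) \<le> norm a"
proof -
  show add: "composite_expectation (a + b) = composite_expectation a + composite_expectation b"
    and scale: "composite_expectation (z *\<^sub>C a) = z *\<^sub>C composite_expectation a" for a b z
    by (simp_all add: composite_expectation_def Phi_props Phi0_props)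
  show "composite_expectation (r *\<^sub>R a) = r *\<^sub>R composite_expectation a"
    by (simp add: scaleR_scaleC scale)
  show "composite_expectation 0 = 0" using scale[of 0 0] by simp
  show "composite_expectation (a - b) = composite_expectation a - composite_expectation b"
    using add[of "a - b" b] by simp
  show "norm (composite_expectation a) \<le> norm a"
    using Phi0_props(3)[OF Phi_props(1), of a] Phi_props(4)[of a] by (simp add: composite_expectation_def)
qed

text \<open>The rewriting \<open>v\<^sub>x e\<^bsub>qS\<^esub> = e\<^bsub>xqS\<^esub> v\<^sub>x\<close> turns the value of \<open>\<Phi>\<close> into the form in which
  \<open>\<Phi>\<^sub>0\<close> is prescribed.\<close>

lemma composite_expectation_gen:
  "\<exists>\<rho> r. composite_expectation (c *\<^sub>C (sg_v p * star (sg_v q))) = \<rho> *\<^sub>C range_proj r"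
proof (cases "(p, q) \<in> unit_equiv")
  case True
  then obtain x where x: "x \<in> unit_group" "p = x * q" unfolding unit_equiv_def by blast
  have "sg_v x * range_proj q = sg_v (x * q) * star (sg_v q)"
    by (simp add: range_proj_eq sg_v_mult[symmetric] mult.assoc)
  also have "\<dots> = sg_v (x * q) * star (sg_v q) * (star (sg_v x) * sg_v x)" by (simp add: sg_v_isometry)
  also have "\<dots> = sg_v (x * q) * star (sg_v (x * q)) * sg_v x"
    by (simp add: sg_v_mult[symmetric] star_mult mult.assoc)
  also have "\<dots> = range_proj (x * q) * sg_v x" by (simp only: range_proj_eq)
  finally have "composite_expectation (sg_v p * star (sg_v q)) = \<Phi>\<^sub>0 (range_proj (x * q) * sg_v x)"
    unfolding composite_expectation_def x(2) Phi_diagonal[OF x(1)] by (rule arg_cong)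
  then have "composite_expectation (c *\<^sub>C (sg_v p * star (sg_v q))) =
      c *\<^sub>C (if x = 1 then range_proj (x * q) else 0)"
    by (simp only: composite_expectation_linear Phi0_unit[OF x(1)])
  then show ?thesis
    by (intro exI[of _ "if x = 1 then c else 0"] exI[of _ "x * q"]) simp
next
  case False
  then have "composite_expectation (sg_v p * star (sg_v q)) = \<Phi>\<^sub>0 0"
    by (simp add: composite_expectation_def Phi_off_diagonal)
  moreover have "\<Phi>\<^sub>0 0 = 0"
    using Phi_props(1)[of 0] Phi0_props(2)[of "\<Phi> 0" 0] by simp
  ultimately show ?thesis
    by (intro exI[of _ 0] exI[of _ 1]) (simp add: composite_expectation_linear)
qed

lemma composite_expectation_commutes:
  "T \<in> toeplitz_span \<Longrightarrow> range_proj q * composite_expectation T = composite_expectation T * range_proj q"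
proof (induction T rule: toeplitz_span_induct)
  case (gen c p r)
  then show ?case
    using composite_expectation_gen[of c p r]
    by (auto simp: mult_scaleC_left mult_scaleC_right range_proj_commute)
qed (simp_all add: composite_expectation_linear distrib_left distrib_right)

text \<open>The value is a finite combination of range projections, and \<open>qs\<close> collects
  their indices. Each of them either fixes or annihilates \<open>P\<close>, hence the combination
  multiplies \<open>P\<close> by a scalar. As \<open>P\<close> is arbitrary, the lists of two
  summands can be concatenated.\<close>

lemma composite_expectation_scalar:
  "T \<in> toeplitz_span \<Longrightarrow> \<exists>qs. \<forall>P. (\<forall>q\<in>set qs. P * range_proj q \<in> {0, P}) \<longrightarrow>
     (\<exists>\<mu>. P * composite_expectation T = \<mu> *\<^sub>C P)"
proof (induction T rule: toeplitz_span_induct)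
  case zero
  have "\<exists>\<mu>. P * composite_expectation 0 = \<mu> *\<^sub>C P" for P
    by (rule exI[of _ 0]) (simp add: composite_expectation_linear)
  then show ?case by blast
next
  case (add x y)
  then obtain qs rs where xy:
    "\<And>P. (\<forall>q\<in>set qs. P * range_proj q \<in> {0, P}) \<Longrightarrow> (\<exists>\<mu>. P * composite_expectation x = \<mu> *\<^sub>C P)"
    "\<And>P. (\<forall>q\<in>set rs. P * range_proj q \<in> {0, P}) \<Longrightarrow> (\<exists>\<mu>. P * composite_expectation y = \<mu> *\<^sub>C P)"
    by metis
  have "\<exists>\<mu>. P * composite_expectation (x + y) = \<mu> *\<^sub>C P"
    if "\<forall>q\<in>set (qs @ rs). P * range_proj q \<in> {0, P}" for P
  proof -
    have "\<forall>q\<in>set qs. P * range_proj q \<in> {0, P}" "\<forall>q\<in>set rs. P * range_proj q \<in> {0, P}"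
      using that by simp_all
    then obtain \<mu> \<nu> where "P * composite_expectation x = \<mu> *\<^sub>C P" "P * composite_expectation y = \<nu> *\<^sub>C P"
      using xy(1) xy(2) by blast
    then have "P * composite_expectation (x + y) = (\<mu> + \<nu>) *\<^sub>C P"
      by (simp add: composite_expectation_linear distrib_left scaleC_add_left)
    then show ?thesis ..
  qed
  then show ?case by blast
next
  case (scaleR r x)
  then obtain qs where x:
    "\<And>P. (\<forall>q\<in>set qs. P * range_proj q \<in> {0, P}) \<Longrightarrow> (\<exists>\<mu>. P * composite_expectation x = \<mu> *\<^sub>C P)"
    by blast
  have "\<exists>\<mu>. P * composite_expectation (r *\<^sub>R x) = \<mu> *\<^sub>C P"
    if P: "\<forall>q\<in>set qs. P * range_proj q \<in> {0, P}" for P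
  proof -
    obtain \<mu> where "P * composite_expectation x = \<mu> *\<^sub>C P" using x[OF P] by blast
    then have "P * composite_expectation (r *\<^sub>R x) = (complex_of_real r * \<mu>) *\<^sub>C P"
      by (simp add: composite_expectation_linear scaleR_scaleC scaleC_scaleC mult_scaleC_right)
    then show ?thesis ..
  qed
  then show ?case by blast
next
  case (gen c p q)
  obtain \<rho> r where r: "composite_expectation (c *\<^sub>C (sg_v p * star (sg_v q))) = \<rho> *\<^sub>C range_proj r"
    using composite_expectation_gen by blast
  have "\<exists>\<mu>. P * (\<rho> *\<^sub>C range_proj r) = \<mu> *\<^sub>C P" if "P * range_proj r \<in> {0, P}" for P
    using that by (auto simp: mult_scaleC_right intro: exI[of _ 0])
  then show ?case unfolding r by (intro exI[of _ "[r]"]) simp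
qed

text \<open>A diagonal term is fixed by \<open>\<Phi>\<close>, because
  \<open>sg_v x * range_proj q\<close> is again \<open>sg_v (x * q) * star (sg_v q)\<close>. An
  off-diagonal term is sent to 0 by \<open>\<Phi>\<close> and is removed by compression with
  \<open>Q\<close>. The finitely many lists needed for this are concatenated.\<close>

lemma compression_in_CI:
  "T \<in> toeplitz_span \<Longrightarrow> \<exists>ds. (\<forall>d\<in>set ds. c \<notin> range ((*) d)) \<and>
     (\<forall>Q. star Q = Q \<and> Q * range_proj c = Q \<and> (\<forall>d\<in>set ds. Q * range_proj d = 0) \<longrightarrow>
       Q * T * Q = Q * \<Phi> T * Q)"
proof (induction T rule: toeplitz_span_induct)
  case zero
  have "\<Phi> 0 = 0" using Phi_props(3)[of 0 0] by simp
  then show ?case by (intro exI[of _ "[]"]) simp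
next
  case (add x y)
  then obtain ds ds' where "\<forall>d\<in>set ds. c \<notin> range ((*) d)" "\<forall>d\<in>set ds'. c \<notin> range ((*) d)"
    "\<forall>Q. star Q = Q \<and> Q * range_proj c = Q \<and> (\<forall>d\<in>set ds. Q * range_proj d = 0) \<longrightarrow>
       Q * x * Q = Q * \<Phi> x * Q"
    "\<forall>Q. star Q = Q \<and> Q * range_proj c = Q \<and> (\<forall>d\<in>set ds'. Q * range_proj d = 0) \<longrightarrow>
       Q * y * Q = Q * \<Phi> y * Q"
    by blast
  then show ?case
    by (intro exI[of _ "ds @ ds'"]) (auto simp: Phi_props distrib_left distrib_right)
next
  case (scaleR r x)
  then obtain ds where "\<forall>d\<in>set ds. c \<notin> range ((*) d)"
    "\<forall>Q. star Q = Q \<and> Q * range_proj c = Q \<and> (\<forall>d\<in>set ds. Q * range_proj d = 0) \<longrightarrow>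
       Q * x * Q = Q * \<Phi> x * Q"
    by blast
  then show ?case
    by (intro exI[of _ ds]) (simp add: scaleR_scaleC Phi_props mult_scaleC_left mult_scaleC_right)
next
  case (gen z p q)
  show ?case
  proof (cases "(p, q) \<in> unit_equiv")
    case True
    then obtain x where x: "x \<in> unit_group" "p = x * q" unfolding unit_equiv_def by blast
    then have "\<Phi> (sg_v p * star (sg_v q)) = sg_v p * star (sg_v q)"
      by (simp add: Phi_diagonal) (simp add: range_proj_eq sg_v_mult[symmetric] mult.assoc)
    then show ?thesis by (intro exI[of _ "[]"]) (simp add: Phi_props)
  next
    case False
    show ?thesis
    proof (rule off_diagonal_compression[OF cancel C1 False, of c])
      fix ds assume ds: "\<And>d. d \<in> set ds \<Longrightarrow> c \<notin> range ((*) d)"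
        "\<And>Q. star Q = Q \<Longrightarrow> Q * range_proj c = Q \<Longrightarrow> (\<And>d. d \<in> set ds \<Longrightarrow> Q * range_proj d = 0)
          \<Longrightarrow> Q * (sg_v p * star (sg_v q)) * Q = 0"
      have "Q * (z *\<^sub>C (sg_v p * star (sg_v q))) * Q = Q * \<Phi> (z *\<^sub>C (sg_v p * star (sg_v q))) * Q"
        if "star Q = Q" "Q * range_proj c = Q" "\<forall>d\<in>set ds. Q * range_proj d = 0" for Q
        using ds(2)[OF that(1,2)] that(3)
        by (simp add: Phi_props Phi_off_diagonal[OF False] mult_scaleC_left mult_scaleC_right)
      then show ?thesis using ds(1) by blast
    qed
  qed
qed

lemma range_proj_in_CI: "range_proj p \<in> cstar_CI"
  and range_proj_in_D: "range_proj p \<in> cstar_D"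
proof -
  have "range (\<lambda>p. range_proj p) \<union> sg_v ` unit_group \<subseteq> cstar_CI"
    unfolding cstar_CI_def cstar_generated_def by (rule hull_subset)
  then show "range_proj p \<in> cstar_CI" by blast
  have "sg_e ` constructible_ideals \<subseteq> cstar_D"
    unfolding cstar_D_def cstar_generated_def by (rule hull_subset)
  then show "range_proj p \<in> cstar_D" using range_constructible by blast
qed

section \<open>The norm estimate and the kernel of the homomorphism\<close>

lemma norm_composite_expectation_le:
  fixes \<pi> :: "'s semigroup_cstar \<Rightarrow> 'b::cstar_algebra"
  assumes hom: "star_hom \<pi>" and inj: "inj_on \<pi> cstar_CI" and T: "T \<in> toeplitz_span"
  shows "norm (composite_expectation T) \<le> norm (\<pi> T)"
proof (cases "composite_expectation T = 0")
  case False
  have CI: "cstar_subalgebra (cstar_CI :: 's semigroup_cstar set)"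
    and D: "cstar_subalgebra (cstar_D :: 's semigroup_cstar set)"
    by (simp_all add: cstar_CI_def cstar_D_def cstar_subalgebra_generated)
  have one: "1 \<in> (cstar_CI :: 's semigroup_cstar set)"
    using range_proj_in_CI[of 1] by (simp add: sg_e_UNIV)
  obtain qs where qs: "\<And>P. (\<forall>q\<in>set qs. P * range_proj q \<in> {0, P}) \<Longrightarrow>
      (\<exists>\<mu>. P * composite_expectation T = \<mu> *\<^sub>C P)"
    using composite_expectation_scalar[OF T] by metis
  obtain c ds where P: "norm (composite_expectation T) \<le> norm (avoiding_proj c ds * composite_expectation T)"
    "\<And>d. d \<in> set ds \<Longrightarrow> c \<notin> range ((*) d)"
    "\<And>q. q \<in> set qs \<Longrightarrow> avoiding_proj c ds * range_proj q \<in> {0, avoiding_proj c ds}"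
    using norm_attaining_projection[OF False composite_expectation_commutes[OF T], where qs = qs] by blast
  obtain \<mu> where \<mu>: "avoiding_proj c ds * composite_expectation T = \<mu> *\<^sub>C avoiding_proj c ds"
    using qs[of "avoiding_proj c ds"] P(3) by blast
  have "norm (composite_expectation T) \<le> cmod \<mu> * norm (avoiding_proj c ds)"
    using P(1) by (simp add: \<mu> norm_scaleC)
  also have "\<dots> \<le> cmod \<mu>"
    using norm_idem_le_1[OF avoiding_proj_projection, of c ds] by (simp add: mult_left_le)
  finally have le_mu: "norm (composite_expectation T) \<le> cmod \<mu>" .
  obtain ds' where ds': "\<forall>d\<in>set ds'. c \<notin> range ((*) d)"
    "\<And>Q. star Q = Q \<Longrightarrow> Q * range_proj c = Q \<Longrightarrow> (\<forall>d\<in>set ds'. Q * range_proj d = 0) \<Longrightarrow>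
       Q * T * Q = Q * \<Phi> T * Q"
    using compression_in_CI[OF T, of c] by metis
  \<comment> \<open>The factors from \<open>ds\<close> keep \<open>Q\<close> below the projection on
    which \<open>composite_expectation T\<close> is the scalar \<open>\<mu>\<close>, and those from
    \<open>ds'\<close> remove the off-diagonal terms of \<open>T\<close>. Since \<open>c\<close>
    avoids both lists, \<open>Q\<close> is nonzero.\<close>
  define Q where "Q = avoiding_proj c (ds' @ ds)"
  have Q: "star Q = Q" "Q * Q = Q" unfolding Q_def by (rule avoiding_proj_projection)+
  have QTQ: "Q * T * Q = Q * \<Phi> T * Q"
    by (rule ds'(2)) (simp_all add: Q_def avoiding_proj_projection avoiding_proj_range_proj avoiding_proj_kills)
  have "Q \<noteq> 0"
    unfolding Q_def avoiding_proj_def complement_prod_def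
    by (rule avoiding_projection_nonzero[OF canc]) (use ds'(1) P(2) in auto)
  then have normQ: "norm Q = 1"
    using cstar_identity[of Q] Q by (simp add: power2_eq_square)
  have "Q = complement_prod ds' * avoiding_proj c ds"
    unfolding Q_def avoiding_proj_def complement_prod_append
    by (simp add: mult.assoc[symmetric] complement_prod_range_proj)
  then have QE: "Q * composite_expectation T = \<mu> *\<^sub>C Q"
    by (simp add: mult.assoc \<mu> mult_scaleC_right)
  have QCI: "Q \<in> cstar_CI" and QD: "Q \<in> cstar_D"
    unfolding Q_def by (rule avoiding_proj_in_subalgebra; simp add: CI D range_proj_in_CI range_proj_in_D)+
  note C = cstar_subalgebraD[OF CI]
  have QPQ: "Q * \<Phi> T * Q \<in> cstar_CI" by (intro C QCI Phi_props)
  \<comment> \<open>\<open>Q\<close> lies in \<open>cstar_D\<close>, so the bimodule property pulls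
    it out of \<open>\<Phi>\<^sub>0\<close> on both sides.\<close>
  have "\<Phi>\<^sub>0 (Q * \<Phi> T * Q) = Q * composite_expectation T * Q"
    by (simp add: Phi0_props QD Phi_props C QCI composite_expectation_def)
  then have "\<Phi>\<^sub>0 (Q * \<Phi> T * Q) = \<mu> *\<^sub>C Q" by (simp add: QE mult_scaleC_left Q)
  then have "cmod \<mu> \<le> norm (Q * \<Phi> T * Q)"
    using Phi0_props(3)[OF QPQ] by (simp add: norm_scaleC normQ)
  also have "\<dots> = norm (\<pi> (Q * T * Q))"
    unfolding QTQ by (rule star_hom_inj_isometric[OF hom CI one inj QPQ, symmetric])
  also have "\<dots> \<le> norm (\<pi> Q) * norm (\<pi> T) * norm (\<pi> Q)"
    unfolding star_hom_mult[OF hom]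
    by (rule order_trans[OF norm_mult_ineq]) (intro mult_right_mono norm_mult_ineq norm_ge_zero)
  also have "\<dots> \<le> 1 * norm (\<pi> T) * 1"
    using star_hom_contractive[OF hom, of Q] normQ by (intro mult_mono) simp_all
  finally show ?thesis using le_mu by simp
qed simp

text \<open>The norm estimate is available on the dense span only. For \<open>T\<close> near
  \<open>b\<close>, however, \<open>\<pi> T = \<pi> (T - b)\<close>, and both \<open>\<pi>\<close>
  and the composite expectation are contractive, so the norm at \<open>b\<close> is at most twice
  the distance from \<open>T\<close> to \<open>b\<close>.\<close>

lemma composite_expectation_kernel:
  fixes \<pi> :: "'s semigroup_cstar \<Rightarrow> 'b::cstar_algebra"
  assumes hom: "star_hom \<pi>" and inj: "inj_on \<pi> cstar_CI" and b: "\<pi> b = 0"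
  shows "composite_expectation b = 0"
proof -
  have "b \<in> closure toeplitz_span" using closure_toeplitz_span by simp
  then have close: "\<exists>T\<in>toeplitz_span. dist T b < \<epsilon>" if "0 < \<epsilon>" for \<epsilon>
    using that unfolding closure_approachable by blast
  have "norm (composite_expectation b) \<le> 0 + \<epsilon>" if \<epsilon>: "0 < \<epsilon>" for \<epsilon>
  proof -
    obtain T where T: "T \<in> toeplitz_span" "dist T b < \<epsilon> / 2" using close[of "\<epsilon> / 2"] \<epsilon> by auto
    have "norm (composite_expectation b) \<le> norm (composite_expectation (T - b)) + norm (composite_expectation T)"
      using norm_triangle_ineq4[of "composite_expectation T" "composite_expectation (T - b)"]
      by (simp add: composite_expectation_linear)
    also have "\<dots> \<le> norm (T - b) + norm (\<pi> T)"
      by (intro add_mono composite_expectation_linear norm_composite_expectation_le hom inj T)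
    also have "\<pi> T = \<pi> (T - b)" by (simp add: star_hom_diff[OF hom] b)
    also have "norm \<dots> \<le> norm (T - b)" by (rule star_hom_contractive[OF hom])
    finally show ?thesis using T(2) by (simp add: dist_norm)
  qed
  then have "norm (composite_expectation b) \<le> 0" by (rule field_le_epsilon)
  then show ?thesis by simp
qed

text \<open>Faithfulness concerns positive elements, hence the passage to \<open>star a * a\<close>.
  Its image under \<open>\<Phi>\<close> is positive in \<open>cstar_CI\<close>, so the two
  faithfulness hypotheses apply one after the other, first that of \<open>\<Phi>\<^sub>0\<close> and
  then that of \<open>\<Phi>\<close>.\<close>

lemma star_hom_kernel_trivial:
  fixes \<pi> :: "'s semigroup_cstar \<Rightarrow> 'b::cstar_algebra"
  assumes "faithful_on UNIV \<Phi>" "faithful_on cstar_CI \<Phi>\<^sub>0"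
    and hom: "star_hom \<pi>" and inj: "inj_on \<pi> cstar_CI" and a: "\<pi> a = 0"
  shows "a = 0"
proof -
  let ?b = "star a * a"
  have "\<pi> ?b = 0" by (simp add: star_hom_mult[OF hom] a)
  then have "\<Phi>\<^sub>0 (\<Phi> ?b) = 0"
    using composite_expectation_kernel[OF hom inj] by (simp add: composite_expectation_def)
  moreover have b: "?b \<in> positive_elements UNIV" unfolding positive_elements_def by blast
  moreover from b have "\<Phi> ?b \<in> positive_elements cstar_CI" by (rule Phi_props(5))
  ultimately have "?b = 0" using assms(1,2) unfolding faithful_on_def by blast
  then have "(norm a)\<^sup>2 = 0" using cstar_identity[of a] by simp
  then show ?thesis by simp
qed

end

end

theorem theorem7p4:
  fixes \<Gamma> :: "'g monoid"
    and \<iota> :: "'s::monoid_mult set \<Rightarrow> 'g"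
    and \<Phi> \<Phi>\<^sub>0 :: "'s semigroup_cstar \<Rightarrow> 's semigroup_cstar"
    and \<pi> :: "'s semigroup_cstar \<Rightarrow> 'b::cstar_algebra"
  assumes "cancellative TYPE('s)" and "right_LCM TYPE('s)" and "condition_C1 TYPE('s)"
    and "group \<Gamma>" and "\<iota> \<in> mon unit_quotient \<Gamma>"
    and "generate \<Gamma> (\<iota> ` carrier unit_quotient) = carrier \<Gamma>"
    and "is_expectation_CI \<Phi>" and "faithful_on UNIV \<Phi>"
    and "conditional_expectation cstar_CI cstar_D \<Phi>\<^sub>0" and "faithful_on cstar_CI \<Phi>\<^sub>0"
    and "\<And>q x. x \<in> unit_group \<Longrightarrow>
      \<Phi>\<^sub>0 (sg_e (range ((*) q)) * sg_v x) = (if x = 1 then sg_e (range ((*) q)) else 0)"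
    and "star_hom \<pi>"
  shows "inj \<pi> \<longleftrightarrow> inj_on \<pi> cstar_CI"
proof
  assume "inj \<pi>"
  then show "inj_on \<pi> cstar_CI" by (rule inj_on_subset) simp
next
  assume inj: "inj_on \<pi> cstar_CI"
  show "inj \<pi>"
  proof (rule injI)
    fix x y assume xy: "\<pi> x = \<pi> y"
    have "x - y = 0"
    proof (rule star_hom_kernel_trivial[OF assms(2,1,3,7,9) _ assms(8,10,12) inj])
      show "\<pi> (x - y) = 0" using xy by (simp add: star_hom_diff[OF assms(12)])
    qed (rule assms(11))
    then show "x = y" by simp
  qed
qed

end
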